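(* Let $G$ be the $2$-generated pro-$2$ group and $\mathcal{M},\mathcal{L},\mathcal{D},\mathcal{P},\mathcal{F}$ the filtration series of $G$ defined in the context. Then, for every $\mathcal{S}\in\{\mathcal{M},\mathcal{L},\mathcal{D},\mathcal{P},\mathcal{F}\}$, $$\operatorname{hspec}_{\trianglelefteq}^{\mathcal{S}}(G)=\operatorname{hspec}^{\mathcal{S}}(G)=[0,1].$$
   Context: Conventions: $\mathbb{N}=\{1,2,\dots\}$, $\mathbb{N}_0=\mathbb{N}\cup\{0\}$. All subgroups of profinite groups (including subgroups generated by sets, commutator subgroups, powers) are taken to be closed. $[u,v]=u^{-1}v^{-1}uv$, $u^v=v^{-1}uv$; $C_n$ is the cyclic group of order $n$; $K^m=\langle g^m\mid g\in K\rangle$ for a group $K$; $\langle S\rangle^{F}$ is the (closed) normal closure of $S$ in $F$. The group $G$. For $k\in\mathbb{N}$ let $\langle\dot x_k\rangle\cong C_{2^k}$, $\langle\dot y_k\rangle\cong C_2$ and $W_k=\langle\dot y_k\rangle\wr\langle\dot x_k\rangle=B_k\rtimes\langle\dot x_k\rangle$ the (regular) wreath product, with base group $B_k=\prod_{i=0}^{2^k-1}\langle\dot y_k^{\,\dot x_k^{\,i}}\rangle\cong C_2^{\,2^k}$. Let $W=\varprojlim_k W_k$ (transition maps $\dot x_{k+1}\mapsto\dot x_k$, $\dot y_{k+1}\mapsto\dot y_k$), so $W=\langle\dot x,\dot y\rangle=B\rtimes\langle\dot x\rangle$ is the pro-$2$ wreath product $C_2\,\hat\wr\,\mathbb{Z}_2$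 with $\langle\dot x\rangle\cong\mathbb{Z}_2$ and $B=\langle\dot y^{\dot x^i}\mid i\in\mathbb{Z}\rangle$ its base group. Let $F_2=\langle a,b\rangle$ be the free pro-$2$ group on $a,b$. Let $R\trianglelefteq F_2$ be the kernel of the epimorphism $F_2\to W$, $a\mapsto\dot x$, $b\mapsto\dot y$, and $R_k\trianglelefteq F_2$ the kernel of $F_2\to W_k$, $a\mapsto\dot x_k$, $b\mapsto\dot y_k$. Let $Y\ge R$ be the full preimage of $B$ in $F_2$ and $Y_k\ge R_k$ the full preimage of $B_k$ in $F_2$. Put $N=[R,Y]R^2$, $N_k=[R_k,Y_k]R_k^{\,2}\langle a^{2^k}\rangle^{F_2}$, and $G=F_2/N$. Filtration series. A filtration series of a countably based infinite profinite group $\Gamma$ is a descending chain $\Gamma=\Gamma_0\ge\Gamma_1\ge\cdots$ of open normal subgroups with $\bigcap_i\Gamma_i=1$. The following are used for $\Gamma=G$: - $\mathcal{M}$: $M_0=G$ and $M_k=N_k/N$ for $k\in\mathbb{N}$; - $\mathcal{P}$ ($2$-power series): $\Gamma^{2^i}$, $i\in\mathbb{N}_0$; - $\mathcal{L}$ (lower $2$-series): $P_0(\Gamma)=P_1(\Gamma)=\Gamma$, $P_i(\Gamma)=P_{i-1}(\Gamma)^2[P_{i-1}(\Gamma),\Gamma]$ for $i\ge2$; - $\mathcal{F}$ (Frattini series): $\Phi_0(\Gamma)=\Gamma$, $\Phi_i(\Gamma)=\Phi_{i-1}(\Gamma)^2[\Phi_{i-1}(\Gamma),\Phi_{i-1}(\Gamma)]$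 for $i\ge1$; - $\mathcal{D}$ (dimension subgroup series): $D_0(\Gamma)=D_1(\Gamma)=\Gamma$, $D_i(\Gamma)=D_{\lceil i/2\rceil}(\Gamma)^2\prod_{1\le j<i}[D_j(\Gamma),D_{i-j}(\Gamma)]$ for $i\ge2$. Hausdorff spectra. For a filtration series $\mathcal{S}:\Gamma=\Gamma_0\ge\Gamma_1\ge\cdots$ and a closed subgroup $K\le\Gamma$, the Hausdorff dimension is $\operatorname{hdim}_\Gamma^{\mathcal{S}}(K)=\liminf_{i\to\infty}\frac{\log|K\Gamma_i:\Gamma_i|}{\log|\Gamma:\Gamma_i|}$. The Hausdorff spectrum $\operatorname{hspec}^{\mathcal{S}}(\Gamma)$ is the set of all $\operatorname{hdim}_\Gamma^{\mathcal{S}}(K)$ with $K$ a closed subgroup of $\Gamma$, and the normal Hausdorff spectrum $\operatorname{hspec}_{\trianglelefteq}^{\mathcal{S}}(\Gamma)$ is the set of all $\operatorname{hdim}_\Gamma^{\mathcal{S}}(K)$ with $K$ a closed normal subgroup of $\Gamma$. *)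

theory Defs
  imports "HOL-Analysis.Analysis" "HOL-Algebra.Algebra"
begin

section \<open>Profinite and pro-\<open>p\<close> groups\<close>

text \<open>A topological group is a pair of a group \<open>G\<close> and a topology \<open>T\<close> on its carrier.\<close>

definition topological_group :: "'a monoid \<Rightarrow> 'a topology \<Rightarrow> bool" where
  "topological_group G T \<longleftrightarrow>
     group G \<and> topspace T = carrier G \<and>
     continuous_map (prod_topology T T) T (\<lambda>(x, y). x \<otimes>\<^bsub>G\<^esub> y) \<and>
     continuous_map T T (\<lambda>x. inv\<^bsub>G\<^esub> x)"

definition profinite_group :: "'a monoid \<Rightarrow> 'a topology \<Rightarrow> bool" where
  "profinite_group G T \<longleftrightarrow>
     topological_group G T \<and> compact_space T \<and> Hausdorff_space T \<and>
     (\<forall>C. connectedin T C \<longrightarrow> C = {} \<or> (\<exists>x. C = {x}))"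

definition pro_p_group :: "nat \<Rightarrow> 'a monoid \<Rightarrow> 'a topology \<Rightarrow> bool" where
  "pro_p_group p G T \<longleftrightarrow>
     profinite_group G T \<and>
     (\<forall>U. U \<lhd> G \<and> openin T U \<longrightarrow> (\<exists>n. card (rcosets\<^bsub>G\<^esub> U) = p ^ n))"

text \<open>The least closed subgroup containing a set.\<close>

definition closed_generate :: "'a monoid \<Rightarrow> 'a topology \<Rightarrow> 'a set \<Rightarrow> 'a set" where
  "closed_generate G T S = T closure_of (generate G S)"

text \<open>
  The free pro-\<open>p\<close> group on the two elements \<open>a\<close>, \<open>b\<close>: they generate \<open>F\<close> topologically, and
  every assignment of values to \<open>a\<close> and \<open>b\<close> in a finite \<open>p\<close>-group extends to a continuous
  homomorphism.  Testing on finite \<open>p\<close>-groups is formally weaker than, and by passing to inverse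
  limits equivalent to, testing on all pro-\<open>p\<close> groups; every finite group has a copy on
  \<^typ>\<open>nat\<close>.  Note that \<^prop>\<open>order H = p ^ n\<close> makes \<open>H\<close> finite for \<open>p > 0\<close>.
\<close>

definition free_pro_p_group ::
    "nat \<Rightarrow> 'a monoid \<Rightarrow> 'a topology \<Rightarrow> 'a \<Rightarrow> 'a \<Rightarrow> bool" where
  "free_pro_p_group p F T a b \<longleftrightarrow>
     pro_p_group p F T \<and> a \<in> carrier F \<and> b \<in> carrier F \<and>
     closed_generate F T {a, b} = carrier F \<and>
     (\<forall>(H :: nat monoid) x y.
        group H \<and> (\<exists>n. order H = p ^ n) \<and> x \<in> carrier H \<and> y \<in> carrier H \<longrightarrow>
        (\<exists>\<phi> \<in> hom F H. continuous_map T (discrete_topology (carrier H)) \<phi> \<and>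
                       \<phi> a = x \<and> \<phi> b = y))"

text \<open>
  The continuous homomorphism with \<open>a \<mapsto> x\<close>, \<open>b \<mapsto> y\<close>; it is used only where such a map exists,
  and where \<open>a\<close>, \<open>b\<close> topologically generate the source and the target is Hausdorff, so that it is unique.
\<close>

definition gen_hom ::
    "'a monoid \<Rightarrow> 'a topology \<Rightarrow> 'a \<Rightarrow> 'a \<Rightarrow> 'b monoid \<Rightarrow> 'b topology \<Rightarrow> 'b \<Rightarrow> 'b \<Rightarrow> 'a \<Rightarrow> 'b" where
  "gen_hom G T a b H S x y =
     (THE \<phi>. \<phi> \<in> hom G H \<inter> extensional (carrier G) \<and> continuous_map T S \<phi> \<and> \<phi> a = x \<and> \<phi> b = y)"


section \<open>Closed subgroups derived from given ones\<close>

definition group_commutator :: "'a monoid \<Rightarrow> 'a \<Rightarrow> 'a \<Rightarrow> 'a" where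
  "group_commutator G u v = inv\<^bsub>G\<^esub> u \<otimes>\<^bsub>G\<^esub> inv\<^bsub>G\<^esub> v \<otimes>\<^bsub>G\<^esub> u \<otimes>\<^bsub>G\<^esub> v"

definition group_conjugate :: "'a monoid \<Rightarrow> 'a \<Rightarrow> 'a \<Rightarrow> 'a" where
  "group_conjugate G u v = inv\<^bsub>G\<^esub> v \<otimes>\<^bsub>G\<^esub> u \<otimes>\<^bsub>G\<^esub> v"

definition commutator_subgroup ::
    "'a monoid \<Rightarrow> 'a topology \<Rightarrow> 'a set \<Rightarrow> 'a set \<Rightarrow> 'a set" where
  "commutator_subgroup G T H K = closed_generate G T {group_commutator G u v | u v. u \<in> H \<and> v \<in> K}"

definition power_subgroup :: "'a monoid \<Rightarrow> 'a topology \<Rightarrow> 'a set \<Rightarrow> nat \<Rightarrow> 'a set" where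
  "power_subgroup G T K m = closed_generate G T {g [^]\<^bsub>G\<^esub> m | g. g \<in> K}"

definition normal_closure :: "'a monoid \<Rightarrow> 'a topology \<Rightarrow> 'a set \<Rightarrow> 'a set" where
  "normal_closure G T S = closed_generate G T {group_conjugate G s g | s g. s \<in> S \<and> g \<in> carrier G}"

text \<open>The quotient topology on \<open>G Mod N\<close>; a set of cosets is open iff its union is.\<close>

definition quotient_group_topology :: "'a monoid \<Rightarrow> 'a topology \<Rightarrow> 'a set \<Rightarrow> 'a set topology" where
  "quotient_group_topology G T N =
     topology (\<lambda>\<U>. \<U> \<subseteq> carrier (G Mod N) \<and> openin T {g \<in> carrier G. N #>\<^bsub>G\<^esub> g \<in> \<U>})"


section \<open>The wreath products\<close>

text \<open>
  The regular wreath product \<open>A \<wr> H\<close> with \<open>H\<close> finite: \<open>(f, h)\<close> stands for \<open>f h\<close>, where \<open>f\<close> is the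
  element of the base group whose component in the factor \<open>A\<^sup>m\<close>, \<open>m \<in> H\<close>, is \<open>(f m)\<^sup>m\<close>.
  Since conjugating \<open>a\<^sup>m\<close> by \<open>h\<^sup>-\<^sup>1\<close> yields \<open>a\<close> conjugated by \<open>m h\<^sup>-\<^sup>1\<close>, moving \<open>h\<close> past \<open>f'\<close> shifts the argument by \<open>h\<close>.
\<close>

definition wreath :: "'a monoid \<Rightarrow> 'b monoid \<Rightarrow> (('b \<Rightarrow> 'a) \<times> 'b) monoid" where
  "wreath A H =
     \<lparr>carrier = (carrier H \<rightarrow>\<^sub>E carrier A) \<times> carrier H,
      monoid.mult = (\<lambda>(f, h) (f', h').
         (\<lambda>m \<in> carrier H. f m \<otimes>\<^bsub>A\<^esub> f' (m \<otimes>\<^bsub>H\<^esub> h), h \<otimes>\<^bsub>H\<^esub> h')),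
      one = (\<lambda>m \<in> carrier H. \<one>\<^bsub>A\<^esub>, \<one>\<^bsub>H\<^esub>)\<rparr>"

definition W_level :: "nat \<Rightarrow> ((int \<Rightarrow> int) \<times> int) monoid" where
  "W_level k = wreath (integer_mod_group 2) (integer_mod_group (2 ^ k))"

definition x_level :: "nat \<Rightarrow> (int \<Rightarrow> int) \<times> int" where
  "x_level k = (\<lambda>m \<in> carrier (integer_mod_group (2 ^ k)). 0, 1)"

definition y_level :: "nat \<Rightarrow> (int \<Rightarrow> int) \<times> int" where
  "y_level k = (\<lambda>m \<in> carrier (integer_mod_group (2 ^ k)). if m = 0 then 1 else 0, 0)"

definition B_level :: "nat \<Rightarrow> ((int \<Rightarrow> int) \<times> int) set" where
  "B_level k = {w \<in> carrier (W_level k). snd w = 0}"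

definition top_level :: "nat \<Rightarrow> ((int \<Rightarrow> int) \<times> int) topology" where
  "top_level k = discrete_topology (carrier (W_level k))"

definition W_transition :: "nat \<Rightarrow> (int \<Rightarrow> int) \<times> int \<Rightarrow> (int \<Rightarrow> int) \<times> int" where
  "W_transition k =
     gen_hom (W_level (Suc k)) (top_level (Suc k)) (x_level (Suc k)) (y_level (Suc k))
             (W_level k) (top_level k) (x_level k) (y_level k)"

definition W_limit :: "(nat \<Rightarrow> (int \<Rightarrow> int) \<times> int) monoid" where
  "W_limit =
     (let P = product_group {1..} W_level
      in P\<lparr>carrier := {w \<in> carrier P. \<forall>k\<ge>1. W_transition k (w (Suc k)) = w k}\<rparr>)"

definition W_topology :: "(nat \<Rightarrow> (int \<Rightarrow> int) \<times> int) topology" where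
  "W_topology = subtopology (product_topology top_level {1..}) (carrier W_limit)"

definition x_limit :: "nat \<Rightarrow> (int \<Rightarrow> int) \<times> int" where
  "x_limit = restrict x_level {1..}"

definition y_limit :: "nat \<Rightarrow> (int \<Rightarrow> int) \<times> int" where
  "y_limit = restrict y_level {1..}"

definition B_limit :: "(nat \<Rightarrow> (int \<Rightarrow> int) \<times> int) set" where
  "B_limit = closed_generate W_limit W_topology
     {group_conjugate W_limit y_limit (x_limit [^]\<^bsub>W_limit\<^esub> i) | i :: int. True}"


section \<open>The group \<open>G\<close>\<close>

text \<open>Here \<open>F\<close>, \<open>T\<close>, \<open>a\<close>, \<open>b\<close> are a free pro-\<open>2\<close> group, its topology and its free generators.\<close>

definition to_W ::
    "'a monoid \<Rightarrow> 'a topology \<Rightarrow> 'a \<Rightarrow> 'a \<Rightarrow> 'a \<Rightarrow> nat \<Rightarrow> (int \<Rightarrow> int) \<times> int" where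
  "to_W F T a b = gen_hom F T a b W_limit W_topology x_limit y_limit"

definition to_W_level ::
    "'a monoid \<Rightarrow> 'a topology \<Rightarrow> 'a \<Rightarrow> 'a \<Rightarrow> nat \<Rightarrow> 'a \<Rightarrow> (int \<Rightarrow> int) \<times> int" where
  "to_W_level F T a b k = gen_hom F T a b (W_level k) (top_level k) (x_level k) (y_level k)"

definition R_sub :: "'a monoid \<Rightarrow> 'a topology \<Rightarrow> 'a \<Rightarrow> 'a \<Rightarrow> 'a set" where
  "R_sub F T a b = kernel F W_limit (to_W F T a b)"

definition R_level :: "'a monoid \<Rightarrow> 'a topology \<Rightarrow> 'a \<Rightarrow> 'a \<Rightarrow> nat \<Rightarrow> 'a set" where
  "R_level F T a b k = kernel F (W_level k) (to_W_level F T a b k)"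

definition Y_sub :: "'a monoid \<Rightarrow> 'a topology \<Rightarrow> 'a \<Rightarrow> 'a \<Rightarrow> 'a set" where
  "Y_sub F T a b = {w \<in> carrier F. to_W F T a b w \<in> B_limit}"

definition Y_level :: "'a monoid \<Rightarrow> 'a topology \<Rightarrow> 'a \<Rightarrow> 'a \<Rightarrow> nat \<Rightarrow> 'a set" where
  "Y_level F T a b k = {w \<in> carrier F. to_W_level F T a b k w \<in> B_level k}"

definition N_sub :: "'a monoid \<Rightarrow> 'a topology \<Rightarrow> 'a \<Rightarrow> 'a \<Rightarrow> 'a set" where
  "N_sub F T a b =
     commutator_subgroup F T (R_sub F T a b) (Y_sub F T a b) <#>\<^bsub>F\<^esub> power_subgroup F T (R_sub F T a b) 2"

definition N_level :: "'a monoid \<Rightarrow> 'a topology \<Rightarrow> 'a \<Rightarrow> 'a \<Rightarrow> nat \<Rightarrow> 'a set" where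
  "N_level F T a b k =
     commutator_subgroup F T (R_level F T a b k) (Y_level F T a b k)
       <#>\<^bsub>F\<^esub> power_subgroup F T (R_level F T a b k) 2
       <#>\<^bsub>F\<^esub> normal_closure F T {a [^]\<^bsub>F\<^esub> (2 ^ k :: nat)}"

definition G_group :: "'a monoid \<Rightarrow> 'a topology \<Rightarrow> 'a \<Rightarrow> 'a \<Rightarrow> 'a set monoid" where
  "G_group F T a b = F Mod N_sub F T a b"

definition G_topology :: "'a monoid \<Rightarrow> 'a topology \<Rightarrow> 'a \<Rightarrow> 'a \<Rightarrow> 'a set topology" where
  "G_topology F T a b = quotient_group_topology F T (N_sub F T a b)"


section \<open>Filtration series\<close>

definition M_series :: "'a monoid \<Rightarrow> 'a topology \<Rightarrow> 'a \<Rightarrow> 'a \<Rightarrow> nat \<Rightarrow> 'a set set" where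
  "M_series F T a b k =
     (if k = 0 then carrier (G_group F T a b)
      else (\<lambda>w. N_sub F T a b #>\<^bsub>F\<^esub> w) ` N_level F T a b k)"

definition two_power_series :: "'a monoid \<Rightarrow> 'a topology \<Rightarrow> nat \<Rightarrow> 'a set" where
  "two_power_series \<Gamma> T i = power_subgroup \<Gamma> T (carrier \<Gamma>) (2 ^ i)"

fun lower_series :: "'a monoid \<Rightarrow> 'a topology \<Rightarrow> nat \<Rightarrow> 'a set" where
  "lower_series \<Gamma> T 0 = carrier \<Gamma>"
| "lower_series \<Gamma> T (Suc 0) = carrier \<Gamma>"
| "lower_series \<Gamma> T (Suc (Suc i)) =
     power_subgroup \<Gamma> T (lower_series \<Gamma> T (Suc i)) 2
       <#>\<^bsub>\<Gamma>\<^esub> commutator_subgroup \<Gamma> T (lower_series \<Gamma> T (Suc i)) (carrier \<Gamma>)"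

fun frattini_series :: "'a monoid \<Rightarrow> 'a topology \<Rightarrow> nat \<Rightarrow> 'a set" where
  "frattini_series \<Gamma> T 0 = carrier \<Gamma>"
| "frattini_series \<Gamma> T (Suc i) =
     power_subgroup \<Gamma> T (frattini_series \<Gamma> T i) 2
       <#>\<^bsub>\<Gamma>\<^esub> commutator_subgroup \<Gamma> T (frattini_series \<Gamma> T i) (frattini_series \<Gamma> T i)"

text \<open>\<open>(i + 1) div 2\<close> is the ceiling of \<open>i / 2\<close>.\<close>

function dimension_series :: "'a monoid \<Rightarrow> 'a topology \<Rightarrow> nat \<Rightarrow> 'a set" where
  "dimension_series \<Gamma> T i =
     (if i < 2 then carrier \<Gamma>
      else power_subgroup \<Gamma> T (dimension_series \<Gamma> T ((i + 1) div 2)) 2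
        <#>\<^bsub>\<Gamma>\<^esub> foldr (\<lambda>j P. commutator_subgroup \<Gamma> T
                          (dimension_series \<Gamma> T j) (dimension_series \<Gamma> T (i - j)) <#>\<^bsub>\<Gamma>\<^esub> P)
              [1..<i] {\<one>\<^bsub>\<Gamma>\<^esub>})"
  by pat_completeness auto
termination
  by (relation "Wellfounded.measure (\<lambda>(_, _, i). i)") auto

declare dimension_series.simps [simp del]


section \<open>Hausdorff spectra\<close>

definition subgroup_index :: "'a monoid \<Rightarrow> 'a set \<Rightarrow> 'a set \<Rightarrow> nat" where
  "subgroup_index \<Gamma> H K = card ((\<lambda>h. K #>\<^bsub>\<Gamma>\<^esub> h) ` H)"

text \<open>
  The lower limit is taken in the extended reals, where it always exists.  All quotients lie in
  the real interval from 0 to 1 (with \<open>0 / 0 = 0\<close> at any \<open>i\<close> with \<open>S i\<close> the whole group).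
\<close>

definition hdim :: "'a monoid \<Rightarrow> (nat \<Rightarrow> 'a set) \<Rightarrow> 'a set \<Rightarrow> ereal" where
  "hdim \<Gamma> S K =
     liminf (\<lambda>i. ereal (ln (real (subgroup_index \<Gamma> (K <#>\<^bsub>\<Gamma>\<^esub> S i) (S i)))
                      / ln (real (subgroup_index \<Gamma> (carrier \<Gamma>) (S i)))))"

definition hspec :: "'a monoid \<Rightarrow> 'a topology \<Rightarrow> (nat \<Rightarrow> 'a set) \<Rightarrow> ereal set" where
  "hspec \<Gamma> T S = {hdim \<Gamma> S K | K. subgroup K \<Gamma> \<and> closedin T K}"

definition normal_hspec :: "'a monoid \<Rightarrow> 'a topology \<Rightarrow> (nat \<Rightarrow> 'a set) \<Rightarrow> ereal set" where
  "normal_hspec \<Gamma> T S = {hdim \<Gamma> S K | K. K \<lhd> \<Gamma> \<and> closedin T K}"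

end

theory Submission
  imports Defs
begin

text \<open>
  The group \<open>Z = R/N\<close> is elementary abelian and centralised by \<open>Y/N\<close>, so closed normal subgroups of \<open>G\<close>
  inside \<open>Z\<close> are the submodules over the power series ring in \<open>x - 1\<close>.  For each of the series there
  are \<open>n\<^sub>i\<close> such that modulo \<open>S\<^sub>i\<close> the group \<open>G/Z\<close> and all cyclic submodules of \<open>Z\<close> have dimension
  \<open>O(n\<^sub>i)\<close>, while \<open>log |G : S\<^sub>i|\<close> is at least a constant times \<open>n\<^sub>i\<^sup>2\<close>.  The latter is the growth of
  \<open>|G : M\<^sub>k|\<close>, in which the commutators of \<open>2\<^sup>k\<close> conjugates of \<open>y\<close> are independent; it carries over to the
  other series because \<open>G/M\<^sub>k\<close> has a filtration \<open>E\<close>, trivial from \<open>4 \<cdot> 2\<^sup>k\<close> on, with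
  \<open>[E\<^sub>i, E\<^sub>j] \<le> E\<^sub>i\<^sub>+\<^sub>j\<close> and squares of \<open>E\<^sub>i\<close> in \<open>E\<^sub>2\<^sub>i\<close>.

  Given \<open>\<eta>\<close>, let \<open>K \<le> Z\<close> be minimal among the closed normal subgroups whose dimension at every level is at
  least \<open>\<eta> log |G : S\<^sub>i|\<close> up to \<open>O(n\<^sub>i)\<close>; it exists by compactness.  If the Hausdorff dimension of \<open>K\<close>
  exceeded \<open>\<eta>\<close>, a subgroup of index 2 that agrees with \<open>K\<close> on the finitely many levels without slack
  would violate minimality.  Such a subgroup is missing only if \<open>K\<close> is finitely generated modulo every \<open>S\<^sub>i\<close>,
  with a uniform number of generators, and then its dimension is \<open>O(n\<^sub>i)\<close>.
\<close>


section \<open>Finite groups\<close>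

text \<open>Everything rests on a gap between linear and quadratic growth. In characteristic 2,
  \<open>(x - 1)^(2^l) = x^(2^l) - 1\<close>, so as soon as \<open>x^(2^l)\<close> lies in
  \<open>S i\<close>, the operator \<open>(x - 1)^(2^l)\<close> kills \<open>Z\<close> modulo
  \<open>S i\<close>; this is one source of \<open>n i\<close>. Finitely generated submodules thus
  have dimension 0, and \<open>Z\<close> has dimension 1 because \<open>G/Z\<close> is also linear
  in \<open>n i\<close>. Hausdorff dimension is a liminf, so all levels have to be controlled at
  once: a lower bound is imposed at every level, and minimality makes it nearly sharp at infinitely
  many. Passing to index 2 costs at most \<open>log 2\<close> per level, which any positive multiple
  of \<open>log |G : S i|\<close> eventually absorbs. The independence of the commutators is seen in
  a Magnus embedding truncated after degree 2. There the relators of level \<open>k\<close> map into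
  degree 2, have exponent 2 and commute with the image of the preimage of the base group, so the map
  factors through \<open>G/M k\<close>; distinct unordered pairs of conjugates of \<open>y\<close>
  give distinct coefficients.\<close>

lemma (in group) mult_inv_cancel:
  "x \<in> carrier G \<Longrightarrow> y \<in> carrier G \<Longrightarrow> x \<otimes> (inv x \<otimes> y) = y"
  "x \<in> carrier G \<Longrightarrow> y \<in> carrier G \<Longrightarrow> inv x \<otimes> (x \<otimes> y) = y"
  by (simp_all flip: m_assoc)

lemma (in group) conj_eq_self:
  assumes "a \<in> carrier G" "s \<in> carrier G" "a \<otimes> s = s \<otimes> a"
  shows "inv a \<otimes> s \<otimes> a = s"
proof -
  have "inv a \<otimes> s \<otimes> a = inv a \<otimes> (a \<otimes> s)" using assms by (simp add: m_assoc)
  then show ?thesis using assms(1,2) by (simp add: mult_inv_cancel)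
qed

lemmas (in group) group_norm = m_assoc inv_mult_group mult_inv_cancel

text \<open>The constants of the definitions are restricted to monoid records without extension.\<close>

locale plain_group = group G for G :: "'a monoid" (structure)

lemma (in plain_group) group_hom_FactGroup: "S \<lhd> G \<Longrightarrow> group_hom G (G Mod S) ((#>) S)"
  by (simp add: group_hom.intro group_hom_axioms.intro group_axioms
      normal.factorgroup_is_group normal.r_coset_hom_Mod)

lemma (in plain_group) commutator_closed [simp]:
  "u \<in> carrier G \<Longrightarrow> v \<in> carrier G \<Longrightarrow> group_commutator G u v \<in> carrier G"
  by (simp add: group_commutator_def)

lemma (in plain_group) conjugate_eq_commutator:
  "u \<in> carrier G \<Longrightarrow> v \<in> carrier G \<Longrightarrow> inv v \<otimes> u \<otimes> v = u \<otimes> group_commutator G u v"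
  by (simp add: group_commutator_def group_norm)

lemma (in plain_group) commutator_eq_one_iff:
  assumes "u \<in> carrier G" "v \<in> carrier G"
  shows "group_commutator G u v = \<one> \<longleftrightarrow> u \<otimes> v = v \<otimes> u"
proof -
  have "group_commutator G u v = inv (v \<otimes> u) \<otimes> (u \<otimes> v)"
    using assms by (simp add: group_commutator_def group_norm)
  also have "\<dots> = \<one> \<longleftrightarrow> u \<otimes> v = v \<otimes> u"
    using assms by (metis inv_closed inv_equality inv_inv l_inv m_closed)
  finally show ?thesis .
qed

lemma (in plain_group) normal_Inter:
  assumes "\<C> \<noteq> {}" "\<And>K. K \<in> \<C> \<Longrightarrow> K \<lhd> G"
  shows "\<Inter>\<C> \<lhd> G"
  unfolding normal_inv_iff
proof (intro conjI ballI)
  show "subgroup (\<Inter>\<C>) G" using assms normal_imp_subgroup by (intro subgroups_Inter) auto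
  show "g \<otimes> h \<otimes> inv g \<in> \<Inter>\<C>" if "g \<in> carrier G" "h \<in> \<Inter>\<C>" for g h
  proof
    fix K assume K: "K \<in> \<C>"
    show "g \<otimes> h \<otimes> inv g \<in> K"
      using that K by (intro normal.inv_op_closed2[OF assms(2)[OF K]]) auto
  qed
qed

lemma hom_commutator:
  fixes G :: "'a monoid" and H :: "'b monoid"
  assumes "group_hom G H h" "u \<in> carrier G" "v \<in> carrier G"
  shows "h (group_commutator G u v) = group_commutator H (h u) (h v)"
proof -
  interpret group_hom G H h by fact
  show ?thesis using assms(2,3) by (simp add: group_commutator_def)
qed

lemma (in plain_group) normal_commutator_left:
  assumes "K \<lhd> G" "u \<in> K" "v \<in> carrier G"
  shows "group_commutator G u v \<in> K"
proof -
  interpret normal K G by fact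
  have "inv v \<otimes> u \<otimes> v \<in> K" using assms by (intro inv_op_closed1)
  then have "inv u \<otimes> (inv v \<otimes> u \<otimes> v) \<in> K" using assms by auto
  then show ?thesis using assms by (simp add: group_commutator_def m_assoc)
qed

lemma (in plain_group) inv_commutator:
  assumes "u \<in> carrier G" "v \<in> carrier G"
  shows "inv (group_commutator G u v) = group_commutator G v u"
  using assms by (simp add: group_commutator_def group_norm)

lemma (in plain_group) normal_commutator_right:
  assumes "K \<lhd> G" "u \<in> carrier G" "v \<in> K"
  shows "group_commutator G u v \<in> K"
proof -
  have "v \<in> carrier G" using assms normal_imp_subgroup subgroup.mem_carrier by fast
  then have "group_commutator G u v = inv (group_commutator G v u)"
    using assms inv_commutator by simp
  then show ?thesis using normal_commutator_left[OF assms(1,3,2)] assms(1)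
    by (metis normal_imp_subgroup subgroup.m_inv_closed)
qed

text \<open>Lets stability under conjugation by a fixed element be tested on generators. The target
  \<open>V\<close> is kept separate from \<open>generate G S\<close>, since the conjugates of the
  generators are sometimes only known to lie in a larger subgroup.\<close>

lemma (in group) conj_generate:
  assumes a: "a \<in> carrier G" and S: "S \<subseteq> carrier G" and V: "subgroup V G"
    and conj: "\<And>s. s \<in> S \<Longrightarrow> inv a \<otimes> s \<otimes> a \<in> V"
    and g: "g \<in> generate G S"
  shows "inv a \<otimes> g \<otimes> a \<in> V"
  using g
proof (induction rule: generate.induct)
  case one
  then show ?case using a V by (simp add: subgroup.one_closed)
next
  case (incl h)
  then show ?case using conj by blast
next
  case (inv h)
  then have h: "h \<in> carrier G" using S by auto
  have "inv (inv a \<otimes> h \<otimes> a) \<in> V" using conj[OF inv] V by (simp add: subgroup.m_inv_closed)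
  then show ?case using a h by (simp add: group_norm)
next
  case (eng h1 h2)
  then have h: "h1 \<in> carrier G" "h2 \<in> carrier G" using S generate_in_carrier by auto
  have "(inv a \<otimes> h1 \<otimes> a) \<otimes> (inv a \<otimes> h2 \<otimes> a) \<in> V"
    using eng V by (simp add: subgroup.m_closed)
  also have "(inv a \<otimes> h1 \<otimes> a) \<otimes> (inv a \<otimes> h2 \<otimes> a) = inv a \<otimes> (h1 \<otimes> h2) \<otimes> a"
    using a h by (simp add: group_norm)
  finally show ?case .
qed

section \<open>Finite groups grown by adjoining one generator at a time\<close>

lemma (in group) subgroup_union_rcos:
  assumes V: "subgroup V G" and a: "a \<in> carrier G" "a \<otimes> a \<in> V"
    and conj: "\<And>v. v \<in> V \<Longrightarrow> inv a \<otimes> v \<otimes> a \<in> V"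
  shows "subgroup (V \<union> (V #> a)) G"
proof -
  interpret V: subgroup V G by fact
  \<comment> \<open>Conjugation by \<open>a\<close> is assumed in one direction; the opposite
    direction is its composite with conjugation by \<open>a \<otimes> a\<close>, which lies in
    \<open>V\<close>.\<close>
  have conj': "a \<otimes> v \<otimes> inv a \<in> V" if "v \<in> V" for v
  proof -
    have vc: "v \<in> carrier G" using that by auto
    have "(a \<otimes> a) \<otimes> (inv a \<otimes> v \<otimes> a) \<otimes> inv (a \<otimes> a) \<in> V"
      using a conj[OF that] by (meson V.m_closed V.m_inv_closed)
    also have "(a \<otimes> a) \<otimes> (inv a \<otimes> v \<otimes> a) \<otimes> inv (a \<otimes> a) = a \<otimes> v \<otimes> inv a"
    proof -
      have "(a \<otimes> a) \<otimes> (inv a \<otimes> v \<otimes> a) = a \<otimes> v \<otimes> a"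
        using a vc by (simp add: group_norm)
      then show ?thesis using a vc by (simp add: group_norm)
    qed
    finally show ?thesis .
  qed
  have rc: "V #> a = {v \<otimes> a | v. v \<in> V}" by (auto simp: r_coset_def)
  have m1: "v \<otimes> a \<otimes> w = (v \<otimes> (a \<otimes> w \<otimes> inv a)) \<otimes> a" if "v \<in> V" "w \<in> V" for v w
    using that a by (simp add: m_assoc)
  show ?thesis
  proof (rule subgroupI)
    show "V \<union> (V #> a) \<subseteq> carrier G" using a V.subset r_coset_subset_G by auto
    show "V \<union> (V #> a) \<noteq> {}" using V.one_closed by (metis Un_iff empty_iff)
  next
    fix g assume "g \<in> V \<union> (V #> a)"
    then show "inv g \<in> V \<union> (V #> a)"
    proof
      assume "g \<in> V #> a"
      then obtain v where v: "v \<in> V" "g = v \<otimes> a" by (auto simp: rc)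
      have "inv g = (inv a \<otimes> inv v \<otimes> a) \<otimes> inv (a \<otimes> a) \<otimes> a"
        using v a by (simp add: group_norm)
      moreover have "(inv a \<otimes> inv v \<otimes> a) \<otimes> inv (a \<otimes> a) \<in> V"
        using v a conj by (meson V.m_closed V.m_inv_closed)
      ultimately show ?thesis by (auto simp: rc)
    qed auto
  next
    fix g h assume g: "g \<in> V \<union> (V #> a)" and h: "h \<in> V \<union> (V #> a)"
    from g show "g \<otimes> h \<in> V \<union> (V #> a)"
    proof
      assume gV: "g \<in> V"
      from h show ?thesis
      proof
        assume "h \<in> V #> a"
        then obtain v where v: "v \<in> V" "h = v \<otimes> a" by (auto simp: rc)
        then have "g \<otimes> h = (g \<otimes> v) \<otimes> a" using gV a by (simp add: m_assoc)
        then show ?thesis using v gV by (auto simp: rc)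
      qed (use gV in auto)
    next
      assume "g \<in> V #> a"
      then obtain v where v: "v \<in> V" "g = v \<otimes> a" by (auto simp: rc)
      from h show ?thesis
      proof
        assume "h \<in> V"
        then show ?thesis using m1[OF v(1)] v conj' by (auto simp: rc)
      next
        assume "h \<in> V #> a"
        then obtain w where w: "w \<in> V" "h = w \<otimes> a" by (auto simp: rc)
        have "g \<otimes> h = (v \<otimes> (a \<otimes> w \<otimes> inv a)) \<otimes> (a \<otimes> a)"
          using v w a by (simp add: group_norm)
        then show ?thesis using v w a conj' by auto
      qed
    qed
  qed
qed

text \<open>The new generator normalises the old group and squares into it, so the old group and one
  further coset suffice.\<close>

lemma (in group) generate_insert_bound:
  assumes S: "S \<subseteq> carrier G" and fin: "finite (generate G S)"
    and a: "a \<in> carrier G" "a \<otimes> a \<in> generate G S"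
    and conj: "\<And>s. s \<in> S \<Longrightarrow> inv a \<otimes> s \<otimes> a \<in> generate G S"
  shows "finite (generate G (insert a S)) \<and> card (generate G (insert a S)) \<le> 2 * card (generate G S)"
proof -
  let ?V = "generate G S"
  have V: "subgroup ?V G" using generate_is_subgroup[OF S] .
  have "subgroup (?V \<union> (?V #> a)) G"
    using subgroup_union_rcos[OF V a] conj_generate[OF a(1) S V conj] by blast
  moreover have "a \<in> ?V #> a" using V a rcos_self by blast
  ultimately have sub: "generate G (insert a S) \<subseteq> ?V \<union> (?V #> a)"
    by (intro generate_subgroup_incl) (auto intro: generate.incl)
  have im: "?V #> a = (\<lambda>v. v \<otimes> a) ` ?V" by (auto simp: r_coset_def)
  have "card (?V \<union> (?V #> a)) \<le> card ?V + card ?V"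
    unfolding im using card_Un_le card_image_le[OF fin] by (meson add_left_mono le_trans)
  moreover have fin': "finite (?V \<union> (?V #> a))" using fin im by simp
  ultimately show ?thesis using sub finite_subset card_mono[OF fin' sub] by auto
qed

text \<open>Iterated doubling along a polycyclic sequence: each term acts on, and squares into, what
  precedes it.\<close>

lemma (in group) generate_chain_bound:
  fixes a :: "nat \<Rightarrow> 'a"
  assumes V: "subgroup V G" "finite V" and a: "\<And>i. i < r \<Longrightarrow> a i \<in> carrier G"
    and sq: "\<And>i. i < r \<Longrightarrow> a i \<otimes> a i \<in> generate G (V \<union> a ` {..<i})"
    and conj: "\<And>i v. i < r \<Longrightarrow> v \<in> V \<union> a ` {..<i} \<Longrightarrow>
                 inv (a i) \<otimes> v \<otimes> a i \<in> generate G (V \<union> a ` {..<i})"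
  shows "finite (generate G (V \<union> a ` {..<r})) \<and> card (generate G (V \<union> a ` {..<r})) \<le> 2 ^ r * card V"
  using a sq conj
proof (induction r)
  case 0
  have "generate G V = V" using V(1) generate_subgroup_incl generate.incl
    by (metis subsetI subset_antisym order_refl)
  then show ?case using V by simp
next
  case (Suc r)
  have IH: "finite (generate G (V \<union> a ` {..<r}))" "card (generate G (V \<union> a ` {..<r})) \<le> 2 ^ r * card V"
    using Suc.IH Suc.prems by (auto simp: less_Suc_eq)
  have eq: "V \<union> a ` {..<Suc r} = insert (a r) (V \<union> a ` {..<r})" by (auto simp: lessThan_Suc)
  have "V \<union> a ` {..<r} \<subseteq> carrier G" using V(1) subgroup.subset Suc.prems(1) by fastforce
  from generate_insert_bound[OF this IH(1), of "a r"] Suc.prems(1,2)[of r] Suc.prems(3)[of r]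
  show ?case unfolding eq using IH(2) by auto
qed

lemma (in group) finite_generate_commuting_involutions:
  assumes "finite S" "S \<subseteq> carrier G" "\<And>s. s \<in> S \<Longrightarrow> s \<otimes> s = \<one>"
    "\<And>s t. s \<in> S \<Longrightarrow> t \<in> S \<Longrightarrow> s \<otimes> t = t \<otimes> s"
  shows "finite (generate G S)"
  using assms
proof (induction rule: finite_induct)
  case empty
  then show ?case using generate_empty by simp
next
  case (insert a S)
  have "inv a \<otimes> s \<otimes> a = s" if "s \<in> S" for s
    using insert.prems(1) insert.prems(3)[of a s] that by (intro conj_eq_self) auto
  then show ?case using generate_insert_bound[of S a] insert
    by (simp add: generate.incl generate.one)
qed

lemma (in group) generate_two_power_bound:
  assumes V: "subgroup V G" "finite V" and x: "x \<in> carrier G" "x [^] (2 ^ r :: nat) = \<one>"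
    and conj: "\<And>v. v \<in> V \<Longrightarrow> inv x \<otimes> v \<otimes> x \<in> V"
  shows "finite (generate G (insert x V)) \<and> card (generate G (insert x V)) \<le> 2 ^ r * card V"
proof -
  \<comment> \<open>The powers \<open>x^(2^(r-1))\<close>, ..., \<open>x^2\<close>, \<open>x\<close>
    in this order: the first squares to 1 and each later one to its predecessor, so \<open>r\<close>
    doublings adjoin \<open>x\<close>.\<close>
  define a where "a i = x [^] (2 ^ (r - Suc i) :: nat)" for i
  have ac: "a i \<in> carrier G" for i using x by (simp add: a_def)
  have conj': "inv (x [^] m) \<otimes> v \<otimes> x [^] m \<in> V" if "v \<in> V" for v and m :: nat
  proof (induction m)
    case 0
    then show ?case using that V subgroup.mem_carrier by force
  next
    case (Suc m)
    have vc: "v \<in> carrier G" using that V subgroup.mem_carrier by force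
    have "inv (x [^] Suc m) \<otimes> v \<otimes> x [^] Suc m = inv x \<otimes> (inv (x [^] m) \<otimes> v \<otimes> x [^] m) \<otimes> x"
      using x vc by (simp add: group_norm)
    then show ?case using conj Suc by simp
  qed
  have "finite (generate G (V \<union> a ` {..<r})) \<and> card (generate G (V \<union> a ` {..<r})) \<le> 2 ^ r * card V"
  proof (rule generate_chain_bound[OF V ac])
    fix i assume i: "i < r"
    have "a i \<otimes> a i = x [^] (2 ^ (r - i) :: nat)"
      using x i by (simp add: a_def nat_pow_mult Suc_diff_Suc flip: mult_2 power_Suc)
    moreover have "x [^] (2 ^ (r - i) :: nat) \<in> generate G (V \<union> a ` {..<i})"
    proof (cases i)
      case 0
      then show ?thesis using x by (simp add: generate.one)
    next
      case (Suc j)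
      then have "x [^] (2 ^ (r - i) :: nat) = a j" by (simp add: a_def)
      then show ?thesis using Suc by (intro generate.incl) auto
    qed
    ultimately show "a i \<otimes> a i \<in> generate G (V \<union> a ` {..<i})" by simp
  next
    fix i v assume i: "i < r" and v: "v \<in> V \<union> a ` {..<i}"
    from v show "inv (a i) \<otimes> v \<otimes> a i \<in> generate G (V \<union> a ` {..<i})"
    proof
      assume "v \<in> V"
      then show ?thesis unfolding a_def using conj' by (intro generate.incl) auto
    next
      assume va: "v \<in> a ` {..<i}"
      then obtain j where j: "v = a j" by auto
      have "a i \<otimes> v = v \<otimes> a i" unfolding j a_def using x by (simp add: nat_pow_mult add.commute)
      then have "inv (a i) \<otimes> v \<otimes> a i = v"
        using ac j by (intro conj_eq_self) auto
      then show ?thesis using va by (intro generate.incl) auto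
    qed
  qed
  moreover have "generate G (V \<union> a ` {..<r}) \<supseteq> generate G (insert x V)"
  proof (rule generate_subgroup_incl)
    have sub: "V \<union> a ` {..<r} \<subseteq> carrier G" using V(1) subgroup.subset ac by fastforce
    show "subgroup (generate G (V \<union> a ` {..<r})) G" using generate_is_subgroup[OF sub] .
    have "x \<in> generate G (V \<union> a ` {..<r})"
    proof (cases r)
      case 0
      then show ?thesis using x by (simp add: generate.one)
    next
      case (Suc s)
      then have "x = a s" using x by (simp add: a_def)
      then show ?thesis using Suc by (intro generate.incl) auto
    qed
    then show "insert x V \<subseteq> generate G (V \<union> a ` {..<r})" by (auto intro: generate.incl)
  qed
  ultimately show ?thesis by (meson card_mono finite_subset le_trans)
qed

section \<open>Elementary abelian normal subgroups\<close>

text \<open>Written additively, \<open>ad G x\<close> is \<open>x - 1\<close> on an abelian normal subgroup.\<close>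

abbreviation ad :: "'a monoid \<Rightarrow> 'a \<Rightarrow> 'a \<Rightarrow> 'a" where
  "ad G x \<equiv> (\<lambda>g. group_commutator G g x)"

locale elementary_abelian_normal = plain_group G for G :: "'a monoid" (structure) +
  fixes A :: "'a set"
  assumes A_normal: "A \<lhd> G"
    and A_comm: "a \<in> A \<Longrightarrow> b \<in> A \<Longrightarrow> a \<otimes> b = b \<otimes> a"
    and A_sq: "a \<in> A \<Longrightarrow> a \<otimes> a = \<one>"
begin

lemma A_subgroup: "subgroup A G" using A_normal normal_imp_subgroup by blast

lemma A_carrier: "a \<in> A \<Longrightarrow> a \<in> carrier G" using A_subgroup subgroup.mem_carrier by fast

lemma A_m_closed: "a \<in> A \<Longrightarrow> b \<in> A \<Longrightarrow> a \<otimes> b \<in> A" using A_subgroup subgroup.m_closed by fast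

lemma A_inv: "a \<in> A \<Longrightarrow> inv a = a"
  using A_sq A_carrier inv_equality by blast

lemma A_conj: "a \<in> A \<Longrightarrow> g \<in> carrier G \<Longrightarrow> inv g \<otimes> a \<otimes> g \<in> A"
  by (rule normal.inv_op_closed1[OF A_normal])

lemma ad_eq: "a \<in> A \<Longrightarrow> g \<in> carrier G \<Longrightarrow> ad G g a = a \<otimes> (inv g \<otimes> a \<otimes> g)"
  by (simp add: group_commutator_def A_inv m_assoc A_carrier)

lemma ad_closed: "a \<in> A \<Longrightarrow> g \<in> carrier G \<Longrightarrow> ad G g a \<in> A"
  by (simp add: ad_eq A_conj A_m_closed)

lemma conj_mult:
  "a \<in> carrier G \<Longrightarrow> b \<in> carrier G \<Longrightarrow> g \<in> carrier G \<Longrightarrow>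
    inv g \<otimes> (a \<otimes> b) \<otimes> g = (inv g \<otimes> a \<otimes> g) \<otimes> (inv g \<otimes> b \<otimes> g)"
  by (simp add: group_norm)

lemma A_lcomm: "a \<in> A \<Longrightarrow> b \<in> A \<Longrightarrow> c \<in> A \<Longrightarrow> a \<otimes> (b \<otimes> c) = b \<otimes> (a \<otimes> c)"
  by (metis A_carrier A_comm m_assoc)

lemma A_interchange:
  assumes "a \<in> A" "b \<in> A" "c \<in> A" "d \<in> A"
  shows "(a \<otimes> b) \<otimes> (c \<otimes> d) = (a \<otimes> c) \<otimes> (b \<otimes> d)"
proof -
  have "(a \<otimes> b) \<otimes> (c \<otimes> d) = a \<otimes> (b \<otimes> (c \<otimes> d))"
    using assms by (simp add: m_assoc A_carrier)
  also have "b \<otimes> (c \<otimes> d) = c \<otimes> (b \<otimes> d)" using assms by (intro A_lcomm)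
  finally show ?thesis using assms by (simp add: m_assoc A_carrier)
qed

lemma ad_mult:
  assumes "a \<in> A" "b \<in> A" "g \<in> carrier G"
  shows "ad G g (a \<otimes> b) = ad G g a \<otimes> ad G g b"
proof -
  have "ad G g (a \<otimes> b) = (a \<otimes> b) \<otimes> ((inv g \<otimes> a \<otimes> g) \<otimes> (inv g \<otimes> b \<otimes> g))"
    using assms by (simp only: ad_eq A_m_closed conj_mult A_carrier)
  also have "\<dots> = (a \<otimes> (inv g \<otimes> a \<otimes> g)) \<otimes> (b \<otimes> (inv g \<otimes> b \<otimes> g))"
    using assms by (intro A_interchange A_conj)
  finally show ?thesis using assms by (simp only: ad_eq)
qed

lemma ad_funpow_closed: "a \<in> A \<Longrightarrow> g \<in> carrier G \<Longrightarrow> (ad G g ^^ m) a \<in> A"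
  by (induction m) (auto simp: ad_closed)

lemma ad_funpow_mult:
  "a \<in> A \<Longrightarrow> b \<in> A \<Longrightarrow> g \<in> carrier G \<Longrightarrow>
    (ad G g ^^ m) (a \<otimes> b) = (ad G g ^^ m) a \<otimes> (ad G g ^^ m) b"
  by (induction m) (auto simp: ad_mult ad_funpow_closed)

lemma ad_one: "g \<in> carrier G \<Longrightarrow> (ad G g ^^ m) \<one> = \<one>"
  by (induction m) (auto simp: group_commutator_def)

text \<open>The identity \<open>(g - 1)^2 = g^2 - 1\<close>: the cross term \<open>2 g\<close>
  appears as \<open>c \<otimes> c\<close>, which is trivial.\<close>

lemma ad_ad:
  assumes a: "a \<in> A" and g: "g \<in> carrier G"
  shows "ad G g (ad G g a) = ad G (g \<otimes> g) a"
proof -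
  define c where "c = inv g \<otimes> a \<otimes> g"
  define d where "d = inv g \<otimes> c \<otimes> g"
  have A: "c \<in> A" "d \<in> A" using a g A_conj by (auto simp: c_def d_def)
  have e: "ad G g a = a \<otimes> c" using a g by (simp only: ad_eq c_def)
  have "ad G g (ad G g a) = (a \<otimes> c) \<otimes> (inv g \<otimes> (a \<otimes> c) \<otimes> g)"
    unfolding e[symmetric] using a g by (intro ad_eq ad_closed)
  also have "inv g \<otimes> (a \<otimes> c) \<otimes> g = c \<otimes> d"
    using a g A A_carrier by (simp only: conj_mult c_def d_def)
  also have "(a \<otimes> c) \<otimes> (c \<otimes> d) = a \<otimes> ((c \<otimes> c) \<otimes> d)" using a A A_carrier by (simp add: m_assoc)
  also have "\<dots> = a \<otimes> d" using a A A_carrier by (simp add: A_sq)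
  also have "d = inv (g \<otimes> g) \<otimes> a \<otimes> (g \<otimes> g)"
    using a g A_carrier by (simp add: group_norm c_def d_def)
  also have "a \<otimes> (inv (g \<otimes> g) \<otimes> a \<otimes> (g \<otimes> g)) = ad G (g \<otimes> g) a"
    using a g by (simp only: ad_eq m_closed)
  finally show ?thesis .
qed

text \<open>In characteristic 2, \<open>(x - 1)\<^sup>m = x\<^sup>m - 1\<close> for \<open>m\<close> a power of 2.\<close>

lemma ad_two_power:
  assumes a: "a \<in> A" and g: "g \<in> carrier G"
  shows "(ad G g ^^ (2 ^ l)) a = ad G (g [^] (2 ^ l :: nat)) a"
  using a
proof (induction l arbitrary: a)
  case 0
  then show ?case using g by simp
next
  case (Suc l)
  have "(ad G g ^^ (2 ^ Suc l)) a = (ad G g ^^ (2 ^ l)) ((ad G g ^^ (2 ^ l)) a)"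
    by (simp add: mult_2 funpow_add)
  also have "\<dots> = ad G (g [^] (2 ^ l :: nat)) (ad G (g [^] (2 ^ l :: nat)) a)"
    using Suc g by (simp add: ad_funpow_closed ad_closed)
  also have "\<dots> = ad G (g [^] (2 ^ Suc l :: nat)) a"
    using Suc.prems g by (simp add: ad_ad nat_pow_mult mult_2)
  finally show ?case .
qed

lemma ad_funpow_eq_one:
  assumes "a \<in> A" "g \<in> carrier G" "g [^] (2 ^ l :: nat) = \<one>" "2 ^ l \<le> m"
  shows "(ad G g ^^ m) a = \<one>"
proof -
  obtain d where m: "m = d + 2 ^ l" using assms(4) le_iff_add by (metis add.commute)
  have "(ad G g ^^ (2 ^ l)) a = \<one>"
    using assms(1-3) by (simp only: ad_two_power) (simp add: group_commutator_def A_carrier)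
  then show ?thesis using assms by (simp add: m funpow_add ad_one)
qed

end


section \<open>Extensions of an elementary abelian group by a central one\<close>

lemma hom_ad_funpow:
  fixes G :: "'a monoid" and H :: "'b monoid"
  assumes "group_hom G H h" "u \<in> carrier G" "v \<in> carrier G"
  shows "(ad G v ^^ m) u \<in> carrier G \<and> h ((ad G v ^^ m) u) = (ad H (h v) ^^ m) (h u)"
proof -
  interpret group_hom G H h by fact
  interpret G: plain_group G by unfold_locales
  show ?thesis using assms(2,3) by (induction m) (auto simp: hom_commutator[OF assms(1)])
qed

text \<open>Models \<open>G = F/N\<close> with \<open>H = Y/N\<close>, \<open>Z = R/N\<close> and
  \<open>x\<close> the image of \<open>a\<close>: \<open>H\<close> is an extension of the elementary
  abelian group \<open>H/Z\<close> by a central elementary abelian one. These conditions pass to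
  every quotient, and the estimates are made in finite quotients.\<close>

locale tower = plain_group G for G :: "'a monoid" (structure) +
  fixes x :: 'a and H Z :: "'a set"
  assumes x_carrier: "x \<in> carrier G" and H_normal: "H \<lhd> G" and Z_normal: "Z \<lhd> G"
    and Z_le_H: "Z \<subseteq> H"
    and Z_central: "z \<in> Z \<Longrightarrow> h \<in> H \<Longrightarrow> z \<otimes> h = h \<otimes> z"
    and Z_sq: "z \<in> Z \<Longrightarrow> z \<otimes> z = \<one>"
    and H_sq: "h \<in> H \<Longrightarrow> h \<otimes> h \<in> Z"
    and H_commutator: "h \<in> H \<Longrightarrow> k \<in> H \<Longrightarrow> group_commutator G h k \<in> Z"
begin

lemma H_subgroup: "subgroup H G" using H_normal normal_imp_subgroup by blast
lemma Z_subgroup: "subgroup Z G" using Z_normal normal_imp_subgroup by blast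
lemma H_carrier: "h \<in> H \<Longrightarrow> h \<in> carrier G" using H_subgroup subgroup.mem_carrier by fast
lemma Z_carrier: "h \<in> Z \<Longrightarrow> h \<in> carrier G" using Z_subgroup subgroup.mem_carrier by fast

sublocale Z: elementary_abelian_normal G Z
  using Z_normal Z_sq Z_central Z_le_H plain_group_axioms
  by (intro elementary_abelian_normal.intro elementary_abelian_normal_axioms.intro) auto

lemma normal_image_Mod:
  assumes "S \<lhd> G" "K \<lhd> G"
  shows "(#>) S ` K \<lhd> G Mod S"
proof (rule normal.surj_hom_normal_subgroup[OF assms(2) group_hom_FactGroup[OF assms(1)]])
  show "(#>) S ` carrier G = carrier (G Mod S)" by (simp add: carrier_FactGroup)
qed

lemma tower_Mod:
  assumes S: "S \<lhd> G"
  shows "tower (G Mod S) (S #> x) ((#>) S ` H) ((#>) S ` Z)"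
proof -
  interpret q: group_hom G "G Mod S" "(#>) S" using group_hom_FactGroup[OF S] .
  show ?thesis
  proof (intro tower.intro tower_axioms.intro plain_group.intro)
    fix z h assume "z \<in> (#>) S ` Z" "h \<in> (#>) S ` H"
    then obtain z' h' where z: "z' \<in> Z" "z = S #> z'" and h: "h' \<in> H" "h = S #> h'" by auto
    then have "S #> (z' \<otimes> h') = S #> (h' \<otimes> z')" using Z_central by simp
    then show "z \<otimes>\<^bsub>G Mod S\<^esub> h = h \<otimes>\<^bsub>G Mod S\<^esub> z"
      using z h q.hom_mult H_carrier Z_carrier by metis
  next
    fix z assume "z \<in> (#>) S ` Z"
    then obtain z' where z: "z' \<in> Z" "z = S #> z'" by auto
    then have "S #> (z' \<otimes> z') = S #> \<one>" using Z_sq by simp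
    then show "z \<otimes>\<^bsub>G Mod S\<^esub> z = \<one>\<^bsub>G Mod S\<^esub>"
      using z q.hom_mult q.hom_one Z_carrier by metis
  next
    fix h assume "h \<in> (#>) S ` H"
    then obtain h' where h: "h' \<in> H" "h = S #> h'" by auto
    then have "S #> (h' \<otimes> h') \<in> (#>) S ` Z" using H_sq by blast
    then show "h \<otimes>\<^bsub>G Mod S\<^esub> h \<in> (#>) S ` Z" using h q.hom_mult H_carrier by metis
  next
    fix h k assume "h \<in> (#>) S ` H" "k \<in> (#>) S ` H"
    then obtain h' k' where h: "h' \<in> H" "h = S #> h'" "k' \<in> H" "k = S #> k'" by auto
    then have "S #> (group_commutator G h' k') \<in> (#>) S ` Z" using H_commutator by blast
    then show "group_commutator (G Mod S) h k \<in> (#>) S ` Z"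
      using h hom_commutator[OF q.group_hom_axioms] H_carrier by metis
  qed (use x_carrier q.hom_closed normal_image_Mod[OF S] H_normal Z_normal Z_le_H q.H.group_axioms in auto)
qed

text \<open>\<open>G Mod Z\<close> is again a tower and the image of \<open>Z\<close> in it is
  trivial, so the axioms on squares and commutators become equations there.\<close>

lemma Z_Mod_elementary_abelian: "elementary_abelian_normal (G Mod Z) ((#>) Z ` H)"
proof -
  interpret q: tower "G Mod Z" "Z #> x" "(#>) Z ` H" "(#>) Z ` Z"
    using tower_Mod[OF Z_normal] .
  have triv: "(#>) Z ` Z = {\<one>\<^bsub>G Mod Z\<^esub>}"
    using subgroup.rcos_const[OF Z_subgroup group_axioms] subgroup.one_closed[OF Z_subgroup]
    by force
  show ?thesis
  proof (intro elementary_abelian_normal.intro elementary_abelian_normal_axioms.intro)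
    fix a b assume ab: "a \<in> (#>) Z ` H" "b \<in> (#>) Z ` H"
    then show "a \<otimes>\<^bsub>G Mod Z\<^esub> b = b \<otimes>\<^bsub>G Mod Z\<^esub> a"
      using q.H_commutator[OF ab] triv q.commutator_eq_one_iff q.H_carrier by auto
  next
    fix a assume ab: "a \<in> (#>) Z ` H"
    then show "a \<otimes>\<^bsub>G Mod Z\<^esub> a = \<one>\<^bsub>G Mod Z\<^esub>" using q.H_sq[OF ab] triv by auto
  qed (use q.H_normal q.plain_group_axioms in auto)
qed

text \<open>A power of \<open>x\<close> is trivial, so \<open>y\<close> has finitely many conjugates
  \<open>b i\<close> under powers of \<open>x\<close>. Their squares and commutators generate a
  finite subgroup of \<open>Z\<close>; adjoining the \<open>b i\<close> one by one, and then
  \<open>x\<close>, preserves finiteness.\<close>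

lemma finite_generate_pair:
  assumes y: "y \<in> H" and x: "x [^] (2 ^ k :: nat) = \<one>"
  shows "finite (generate G {x, y})"
proof -
  define n where "n = (2::nat) ^ k"
  define b where "b i = inv (x [^] i) \<otimes> y \<otimes> x [^] i" for i :: nat
  have bH: "b i \<in> H" for i unfolding b_def
    using y x_carrier by (intro normal.inv_op_closed1[OF H_normal]) auto
  have bc: "b i \<in> carrier G" for i using bH H_carrier by blast
  have b_mod: "b i = b (i mod n)" for i
  proof -
    have "x [^] i = x [^] (n * (i div n) + i mod n)" by simp
    also have "\<dots> = (x [^] n) [^] (i div n) \<otimes> x [^] (i mod n)"
      using x_carrier by (simp only: nat_pow_mult nat_pow_pow)
    finally show ?thesis using x x_carrier by (simp add: b_def n_def)
  qed
  have n0: "n > 0" by (simp add: n_def)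
  have b_conj: "inv x \<otimes> b i \<otimes> x = b (Suc i)" for i
    using x_carrier y H_carrier by (simp add: b_def group_norm)
  \<comment> \<open>Conjugation by \<open>x\<close> sends \<open>b i\<close> to
    \<open>b (Suc i)\<close>, and \<open>b\<close> is periodic with period \<open>n\<close>; hence
    this finite set is mapped into itself.\<close>
  define S where "S = (\<lambda>i. b i \<otimes> b i) ` {..<n} \<union>
     (\<lambda>(i, j). group_commutator G (b i) (b j)) ` ({..<n} \<times> {..<n})"
  have SZ: "S \<subseteq> Z" using H_sq H_commutator bH by (auto simp: S_def)
  have SI0: "b i \<otimes> b i \<in> S" "group_commutator G (b i) (b j) \<in> S" if "i < n" "j < n" for i j
    using that unfolding S_def by force+
  have SI: "b i \<otimes> b i \<in> S" "group_commutator G (b i) (b j) \<in> S" for i j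
    using SI0[of "i mod n" "j mod n"] n0 by (simp_all add: b_mod[symmetric])
  have fin: "finite (generate G S)"
  proof (rule finite_generate_commuting_involutions)
    show "finite S" by (simp add: S_def)
    show "S \<subseteq> carrier G" using SZ Z_carrier by blast
    show "s \<otimes> s = \<one>" if "s \<in> S" for s using that SZ Z_sq by blast
    show "s \<otimes> t = t \<otimes> s" if "s \<in> S" "t \<in> S" for s t using that SZ Z_central Z_le_H by blast
  qed
  have SS: "subgroup (generate G S) G" using generate_is_subgroup SZ Z_carrier by blast
  have genZ: "generate G S \<subseteq> Z" using SZ Z_subgroup generate_subgroup_incl by blast
  define V where "V = generate G (generate G S \<union> b ` {..<n})"
  have Vsub: "generate G S \<union> b ` {..<n} \<subseteq> carrier G" using genZ Z_carrier bc by auto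
  have V: "subgroup V G" unfolding V_def using generate_is_subgroup[OF Vsub] .
  have SV: "S \<subseteq> V" unfolding V_def by (auto intro!: generate.incl)
  have bV: "b i \<in> V" for i
    using b_mod[of i] n0 unfolding V_def by (auto intro!: generate.incl)
  have finV: "finite V" unfolding V_def
  proof (rule conjunct1[OF generate_chain_bound[OF SS fin bc]])
    fix i assume "i < n"
    show "b i \<otimes> b i \<in> generate G (generate G S \<union> b ` {..<i})"
      using SI by (auto intro!: generate.incl)
  next
    fix i v assume i: "i < n" and v: "v \<in> generate G S \<union> b ` {..<i}"
    have vc: "v \<in> carrier G" using v genZ Z_carrier bc by auto
    from v show "inv (b i) \<otimes> v \<otimes> b i \<in> generate G (generate G S \<union> b ` {..<i})"
    proof
      assume vS: "v \<in> generate G S"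
      then have "inv (b i) \<otimes> v \<otimes> b i = v"
        using genZ Z_central[of v "b i"] bH bc vc by (intro conj_eq_self) auto
      then show ?thesis using v by (auto intro: generate.incl)
    next
      assume "v \<in> b ` {..<i}"
      then obtain j where j: "v = b j" by auto
      have "v \<otimes> group_commutator G v (b i) \<in> generate G (generate G S \<union> b ` {..<i})"
        using v SI(2) j by (intro generate.eng generate.incl) (auto intro!: generate.incl)
      then show ?thesis using vc bc by (simp add: conjugate_eq_commutator)
    qed
  qed
  have Sconj: "inv x \<otimes> s \<otimes> x \<in> V" if "s \<in> S" for s
  proof -
    interpret cx: group_hom G G "\<lambda>g. inv x \<otimes> g \<otimes> x"
      by unfold_locales (use x_carrier in \<open>auto simp: hom_def group_norm\<close>)
    from that consider i where "s = b i \<otimes> b i" | i j where "s = group_commutator G (b i) (b j)"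
      by (auto simp: S_def)
    then show ?thesis
    proof cases
      case 1
      then have "inv x \<otimes> s \<otimes> x = b (Suc i) \<otimes> b (Suc i)" using cx.hom_mult[OF bc bc] b_conj by simp
      then show ?thesis using SI SV by auto
    next
      case 2
      then have "inv x \<otimes> s \<otimes> x = group_commutator G (b (Suc i)) (b (Suc j))"
        using hom_commutator[OF cx.group_hom_axioms bc bc] b_conj by simp
      then show ?thesis using SI SV by auto
    qed
  qed
  have Vconj: "inv x \<otimes> v \<otimes> x \<in> V" if "v \<in> V" for v
  proof (rule conj_generate[OF x_carrier Vsub V _ that[unfolded V_def]])
    fix s assume "s \<in> generate G S \<union> b ` {..<n}"
    then show "inv x \<otimes> s \<otimes> x \<in> V"
    proof
      assume "s \<in> generate G S"
      then show ?thesis using conj_generate[OF x_carrier _ V Sconj] SZ Z_carrier by blast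
    next
      assume "s \<in> b ` {..<n}"
      then show ?thesis using b_conj bV by auto
    qed
  qed
  have "finite (generate G (insert x V))"
    using generate_two_power_bound[OF V finV x_carrier x Vconj] by blast
  moreover have "generate G {x, y} \<subseteq> generate G (insert x V)"
  proof (rule mono_generate)
    have "y = b 0" using y H_carrier by (simp add: b_def)
    then show "{x, y} \<subseteq> insert x V" using bV by auto
  qed
  ultimately show ?thesis by (rule finite_subset[rotated])
qed

text \<open>One factor \<open>2 ^ n\<close> pays for the powers of \<open>x\<close>, the other for
  the elements \<open>(x - 1)^i y\<close> with \<open>i < n\<close>. Together with \<open>Z\<close>
  these generate a subgroup stable under conjugation by \<open>x\<close>, because
  \<open>(x - 1)^n y\<close> falls into \<open>Z\<close>.\<close>

lemma card_carrier_le: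
  assumes fin: "finite (carrier G)" and gen: "generate G {x, y} = carrier G" and y: "y \<in> H"
    and n: "(ad G x ^^ n) y \<in> Z" and x: "x [^] (2 ^ n :: nat) = \<one>"
  shows "card (carrier G) \<le> 4 ^ n * card Z"
proof -
  have finZ: "finite Z" using fin Z_carrier by (meson finite_subset subsetI)
  define c where "c i = (ad G x ^^ i) y" for i
  have cH: "c i \<in> H" for i unfolding c_def
    by (induction i) (use y normal_commutator_left[OF H_normal _ x_carrier] in auto)
  have cc: "c i \<in> carrier G" for i using cH H_carrier by blast
  define a where "a i = c (n - Suc i)" for i
  define V where "V = generate G (Z \<union> a ` {..<n})"
  have Vsub: "Z \<union> a ` {..<n} \<subseteq> carrier G" using Z_carrier cc by (auto simp: a_def)
  have V: "subgroup V G" unfolding V_def using generate_is_subgroup[OF Vsub] .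
  have bV: "finite V \<and> card V \<le> 2 ^ n * card Z" unfolding V_def
  proof (rule generate_chain_bound[OF Z_subgroup finZ])
    fix i v assume i: "i < n" and v: "v \<in> Z \<union> a ` {..<i}"
    have vH: "v \<in> H" using v Z_le_H cH by (auto simp: a_def)
    have "v \<otimes> group_commutator G v (a i) \<in> generate G (Z \<union> a ` {..<i})"
      using v H_commutator[OF vH cH] by (intro generate.eng generate.incl) (auto simp: a_def)
    then show "inv (a i) \<otimes> v \<otimes> a i \<in> generate G (Z \<union> a ` {..<i})"
      using vH H_carrier cc by (simp add: conjugate_eq_commutator a_def)
  qed (use cc H_sq cH in \<open>auto simp: a_def intro!: generate.incl\<close>)
  have cV: "c i \<in> V" if "i \<le> n" for i
  proof (cases "i = n")
    case True
    then show ?thesis using n by (auto simp: V_def c_def intro!: generate.incl)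
  next
    case False
    then have "c i = a (n - Suc i)" "n - Suc i < n" using that by (auto simp: a_def)
    then show ?thesis by (auto simp: V_def intro!: generate.incl)
  qed
  have Vconj: "inv x \<otimes> v \<otimes> x \<in> V" if "v \<in> V" for v
  proof (rule conj_generate[OF x_carrier Vsub V _ that[unfolded V_def]])
    fix s assume s: "s \<in> Z \<union> a ` {..<n}"
    then show "inv x \<otimes> s \<otimes> x \<in> V"
    proof
      assume "s \<in> Z"
      then show ?thesis using Z.A_conj x_carrier by (auto simp: V_def intro!: generate.incl)
    next
      assume "s \<in> a ` {..<n}"
      then obtain i where i: "i < n" "s = a i" by auto
      have "inv x \<otimes> s \<otimes> x = c (n - Suc i) \<otimes> c (Suc (n - Suc i))"
        using i cc x_carrier by (simp add: a_def conjugate_eq_commutator c_def)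
      then show ?thesis using cV V i by (simp add: subgroup.m_closed)
    qed
  qed
  have b: "finite (generate G (insert x V)) \<and> card (generate G (insert x V)) \<le> 2 ^ n * card V"
    using generate_two_power_bound[OF V _ x_carrier x Vconj] bV by blast
  have "carrier G \<subseteq> generate G (insert x V)"
    unfolding gen[symmetric]
  proof (rule mono_generate)
    have "y = c 0" by (simp add: c_def)
    then show "{x, y} \<subseteq> insert x V" using cV by auto
  qed
  then have "card (carrier G) \<le> 2 ^ n * card V" using b card_mono le_trans by blast
  also have "\<dots> \<le> 2 ^ n * (2 ^ n * card Z)" using bV by simp
  also have "\<dots> = 4 ^ n * card Z" by (simp flip: power_mult_distrib mult.assoc)
  finally show ?thesis .
qed

end


section \<open>A filtration compatible with commutators and squares\<close>

lemma (in group) coset_eq_subgroup_iff: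
  "subgroup S G \<Longrightarrow> g \<in> carrier G \<Longrightarrow> S #> g = S \<longleftrightarrow> g \<in> S"
  by (metis coset_join2 rcos_self)

lemma subgroup_preimage:
  assumes "group_hom G Q q" "subgroup K Q"
  shows "subgroup {g \<in> carrier G. q g \<in> K} G"
proof -
  interpret group_hom G Q q by fact
  interpret K: subgroup K Q by fact
  show ?thesis
  proof (rule G.subgroupI)
    show "{g \<in> carrier G. q g \<in> K} \<noteq> {}" using K.one_closed hom_one by force
  qed auto
qed

lemma normal_preimage:
  assumes "group_hom G Q q" "K \<lhd> Q"
  shows "{g \<in> carrier G. q g \<in> K} \<lhd> G"
proof -
  interpret group_hom G Q q by fact
  interpret K: normal K Q by fact
  show ?thesis
    unfolding G.normal_inv_iff
  proof (intro conjI ballI G.subgroupI)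
    show "{g \<in> carrier G. q g \<in> K} \<noteq> {}" using K.one_closed hom_one by force
  qed (auto intro: K.inv_op_closed2)
qed

text \<open>Replaces commutator expansions: in the quotient, commuting with a fixed element is
  visibly preserved by products and powers.\<close>

lemma (in plain_group) commutator_mem_iff:
  assumes "S \<lhd> G" "u \<in> carrier G" "v \<in> carrier G"
  shows "group_commutator G u v \<in> S \<longleftrightarrow>
    (S #> u) \<otimes>\<^bsub>G Mod S\<^esub> (S #> v) = (S #> v) \<otimes>\<^bsub>G Mod S\<^esub> (S #> u)"
proof -
  interpret q: group_hom G "G Mod S" "(#>) S" using group_hom_FactGroup assms by blast
  interpret Q: plain_group "G Mod S" by unfold_locales
  have "group_commutator G u v \<in> S \<longleftrightarrow> S #> group_commutator G u v = \<one>\<^bsub>G Mod S\<^esub>"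
    using assms by (simp add: coset_eq_subgroup_iff normal_imp_subgroup)
  also have "S #> group_commutator G u v = group_commutator (G Mod S) (S #> u) (S #> v)"
    using hom_commutator[OF q.group_hom_axioms assms(2,3)] .
  finally show ?thesis using Q.commutator_eq_one_iff q.hom_closed assms by metis
qed

lemma (in group) commute_mult:
  assumes "u \<in> carrier G" "v \<in> carrier G" "w \<in> carrier G"
    "u \<otimes> w = w \<otimes> u" "v \<otimes> w = w \<otimes> v"
  shows "(u \<otimes> v) \<otimes> w = w \<otimes> (u \<otimes> v)"
proof -
  have "(u \<otimes> v) \<otimes> w = u \<otimes> (w \<otimes> v)" using assms by (simp only: m_assoc)
  also have "\<dots> = (w \<otimes> u) \<otimes> v" using assms by (simp only: m_assoc flip: assms(4))
  finally show ?thesis using assms by (simp only: m_assoc)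
qed

lemma (in group) commute_mult_mult:
  assumes "u \<in> carrier G" "h \<in> carrier G" "v \<in> carrier G" "k \<in> carrier G"
    "u \<otimes> v = v \<otimes> u" "u \<otimes> k = k \<otimes> u" "h \<otimes> v = v \<otimes> h" "h \<otimes> k = k \<otimes> h"
  shows "(u \<otimes> h) \<otimes> (v \<otimes> k) = (v \<otimes> k) \<otimes> (u \<otimes> h)"
  using assms by (intro commute_mult m_closed) (metis commute_mult)+

context elementary_abelian_normal
begin

text \<open>By \<open>cyc\<close>, \<open>G\<close> acts on \<open>A\<close> through powers of
  \<open>x\<close>. Its action therefore commutes with \<open>ad G x\<close> and preserves the
  images of all iterates.\<close>

lemma ad_funpow_image_normal:
  assumes x: "x \<in> carrier G"
    and cyc: "\<And>g. g \<in> carrier G \<Longrightarrow>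
      \<exists>j::nat. \<exists>h \<in> carrier G. g = x [^] j \<otimes> h \<and> (\<forall>a\<in>A. h \<otimes> a = a \<otimes> h)"
  shows "(ad G x ^^ m) ` A \<lhd> G"
proof -
  have conj_ad: "inv g \<otimes> ad G x a \<otimes> g = ad G x (inv g \<otimes> a \<otimes> g)"
    if a: "a \<in> A" and g: "g \<in> carrier G" for a g
  proof -
    have *: "inv x \<otimes> (inv g \<otimes> b \<otimes> g) \<otimes> x = inv g \<otimes> (inv x \<otimes> b \<otimes> x) \<otimes> g" if b: "b \<in> A" for b
    proof -
      obtain j :: nat and h where h: "h \<in> carrier G" "g = x [^] j \<otimes> h" "\<And>a. a \<in> A \<Longrightarrow> h \<otimes> a = a \<otimes> h"
        using cyc[OF g] by blast
      have g_eq: "inv g \<otimes> c \<otimes> g = inv (x [^] j) \<otimes> c \<otimes> x [^] j" if c: "c \<in> A" for c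
      proof -
        have d: "inv (x [^] j) \<otimes> c \<otimes> x [^] j \<in> A" using c x by (intro A_conj) auto
        have "inv g \<otimes> c \<otimes> g = inv h \<otimes> (inv (x [^] j) \<otimes> c \<otimes> x [^] j) \<otimes> h"
          using h(1,2) x c A_carrier by (simp add: group_norm)
        also have "\<dots> = inv (x [^] j) \<otimes> c \<otimes> x [^] j"
          using h(1) h(3)[OF d] A_carrier[OF d] by (intro conj_eq_self)
        finally show ?thesis .
      qed
      have xx: "x [^] j \<otimes> x = x \<otimes> x [^] j" using x by (metis nat_pow_Suc nat_pow_Suc2)
      have "inv x \<otimes> (inv g \<otimes> b \<otimes> g) \<otimes> x = inv (x [^] j \<otimes> x) \<otimes> b \<otimes> (x [^] j \<otimes> x)"
        unfolding g_eq[OF b] using x b A_carrier by (simp add: group_norm)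
      also have "\<dots> = inv (x [^] j) \<otimes> (inv x \<otimes> b \<otimes> x) \<otimes> x [^] j"
        unfolding xx using x b A_carrier by (simp add: group_norm)
      also have "\<dots> = inv g \<otimes> (inv x \<otimes> b \<otimes> x) \<otimes> g"
        using g_eq[OF A_conj[OF b x]] by simp
      finally show ?thesis .
    qed
    have "inv g \<otimes> ad G x a \<otimes> g = (inv g \<otimes> a \<otimes> g) \<otimes> (inv g \<otimes> (inv x \<otimes> a \<otimes> x) \<otimes> g)"
      using a x g A_carrier A_conj by (simp only: ad_eq conj_mult)
    also have "\<dots> = ad G x (inv g \<otimes> a \<otimes> g)" using *[OF a] a x g A_conj by (simp only: ad_eq)
    finally show ?thesis .
  qed
  have conj_funpow: "inv g \<otimes> (ad G x ^^ m) a \<otimes> g = (ad G x ^^ m) (inv g \<otimes> a \<otimes> g)"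
    if "a \<in> A" "g \<in> carrier G" for a g
    using that x by (induction m) (simp_all add: conj_ad ad_funpow_closed)
  have "subgroup ((ad G x ^^ m) ` A) G"
  proof (rule subgroupI)
    show "(ad G x ^^ m) ` A \<subseteq> carrier G" using ad_funpow_closed x A_carrier by blast
    show "(ad G x ^^ m) ` A \<noteq> {}" using A_subgroup subgroup.one_closed by blast
    show "inv a \<in> (ad G x ^^ m) ` A" if "a \<in> (ad G x ^^ m) ` A" for a
      using that ad_funpow_closed[OF _ x] A_inv by force
    show "a \<otimes> b \<in> (ad G x ^^ m) ` A" if "a \<in> (ad G x ^^ m) ` A" "b \<in> (ad G x ^^ m) ` A" for a b
      using that ad_funpow_mult[OF _ _ x] A_m_closed by (auto simp: image_iff) metis
  qed
  then show ?thesis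
    unfolding normal_inv_iff
  proof (intro conjI ballI)
    fix g v assume g: "g \<in> carrier G" and "v \<in> (ad G x ^^ m) ` A"
    then obtain a where a: "a \<in> A" "v = (ad G x ^^ m) a" by auto
    have "g \<otimes> v \<otimes> inv g = (ad G x ^^ m) (g \<otimes> a \<otimes> inv g)"
      using conj_funpow[OF a(1), of "inv g"] g a(2) by simp
    moreover have "g \<otimes> a \<otimes> inv g \<in> A" using A_conj[OF a(1), of "inv g"] g by simp
    ultimately show "g \<otimes> v \<otimes> inv g \<in> (ad G x ^^ m) ` A" by blast
  qed
qed

lemma ad_funpow_image_antimono:
  assumes x: "x \<in> carrier G" and "m \<le> m'"
  shows "(ad G x ^^ m') ` A \<subseteq> (ad G x ^^ m) ` A"
proof -
  obtain d where d: "m' = m + d" using assms(2) le_Suc_ex by blast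
  show ?thesis unfolding d using ad_funpow_closed[OF _ x] by (auto simp: funpow_add)
qed

end

context tower
begin

text \<open>The weights imitate those of a dimension series. For \<open>j > 0\<close> the weight of
  \<open>x^j\<close> is the largest power of 2 dividing \<open>j\<close>; \<open>H\<close> is
  filtered by \<open>C\<close>, which follows the powers of \<open>x - 1\<close> on
  \<open>H/Z\<close>, rests at \<open>Z\<close>, and then follows the powers of \<open>x - 1\<close>
  on \<open>Z\<close>.\<close>

lemma exists_N_series:
  assumes xk: "x [^] (2 ^ k :: nat) = \<one>"
    and cyc: "\<And>g. g \<in> carrier G \<Longrightarrow> \<exists>j::nat. \<exists>h\<in>H. g = x [^] j \<otimes> h"
  obtains E :: "nat \<Rightarrow> 'a set" where
    "\<And>i. subgroup (E i) G" "E 1 = carrier G" "\<And>i j. i \<le> j \<Longrightarrow> E j \<subseteq> E i"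
    "\<And>i g. 1 \<le> i \<Longrightarrow> g \<in> E i \<Longrightarrow> g \<otimes> g \<in> E (2 * i)"
    "\<And>i j g h. 1 \<le> i \<Longrightarrow> 1 \<le> j \<Longrightarrow> g \<in> E i \<Longrightarrow> h \<in> E j \<Longrightarrow> group_commutator G g h \<in> E (i + j)"
    "E (4 * 2 ^ k) = {\<one>}"
proof -
  define n where "n = (2::nat) ^ k"
  have n0: "n > 0" by (simp add: n_def)
  define q where "q g = Z #> g" for g
  define A where "A = q ` H"
  interpret q: group_hom G "G Mod Z" q unfolding q_def using group_hom_FactGroup[OF Z_normal] .
  interpret A: elementary_abelian_normal "G Mod Z" A
    unfolding A_def q_def using Z_Mod_elementary_abelian .
  have q_one: "q g = \<one>\<^bsub>G Mod Z\<^esub> \<longleftrightarrow> g \<in> Z" if "g \<in> carrier G" for g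
    using that by (simp add: q_def coset_eq_subgroup_iff Z_subgroup)
  have qx: "q x \<in> carrier (G Mod Z)" using x_carrier by simp
  have qxk: "q x [^]\<^bsub>G Mod Z\<^esub> (2 ^ k :: nat) = \<one>\<^bsub>G Mod Z\<^esub>"
    using xk x_carrier by (metis q.hom_nat_pow q.hom_one)
  have ker_pow: "g [^] (2 ^ l :: nat) = \<one>" if "g [^] (2 ^ k :: nat) = \<one>" "k \<le> l" "g \<in> carrier G" for l g
  proof -
    obtain d where "l = k + d" using \<open>k \<le> l\<close> le_Suc_ex by blast
    then show ?thesis using that by (simp add: power_add flip: nat_pow_pow)
  qed
  define B where "B m = (ad (G Mod Z) (q x) ^^ m) ` A" for m
  define P where "P m = (ad G x ^^ m) ` Z" for m
  \<comment> \<open>The offset \<open>i - 1\<close> gives \<open>C 1 = H\<close>. As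
    \<open>(x - 1)^n\<close> kills \<open>H/Z\<close>, \<open>C i = Z\<close> for
    \<open>n < i \<le> 2 * n\<close>. This plateau makes room for \<open>H\<close> not being
    abelian: elements of weight at most \<open>n\<close> have squares and commutators in
    \<open>Z\<close>, hence of weight \<open>2 * n\<close>, while elements of greater weight are
    already central in \<open>H\<close> and of order at most 2.\<close>
  define C where "C i = (if i \<le> 2 * n then {h \<in> H. q h \<in> B (i - 1)} else P (i - 2 * n))" for i
  have B_normal: "B m \<lhd> G Mod Z" for m
    unfolding B_def
  proof (rule A.ad_funpow_image_normal[OF qx])
    fix g assume "g \<in> carrier (G Mod Z)"
    then obtain g' where g': "g' \<in> carrier G" "g = q g'" by (auto simp: carrier_FactGroup q_def)
    then obtain j :: nat and h where h: "h \<in> H" "g' = x [^] j \<otimes> h" using cyc by blast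
    then have "g = q x [^]\<^bsub>G Mod Z\<^esub> j \<otimes>\<^bsub>G Mod Z\<^esub> q h"
      using g' x_carrier H_carrier by (simp only: q.hom_mult q.hom_nat_pow nat_pow_closed)
    moreover have "q h \<in> A" using h by (simp add: A_def)
    ultimately show "\<exists>j::nat. \<exists>h\<in>carrier (G Mod Z). g = q x [^]\<^bsub>G Mod Z\<^esub> j \<otimes>\<^bsub>G Mod Z\<^esub> h \<and>
        (\<forall>a\<in>A. h \<otimes>\<^bsub>G Mod Z\<^esub> a = a \<otimes>\<^bsub>G Mod Z\<^esub> h)"
      using A.A_comm A.A_carrier by blast
  qed
  have P_normal: "P m \<lhd> G" for m
    unfolding P_def
  proof (rule Z.ad_funpow_image_normal[OF x_carrier])
    fix g assume "g \<in> carrier G"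
    then show "\<exists>j::nat. \<exists>h\<in>carrier G. g = x [^] j \<otimes> h \<and> (\<forall>a\<in>Z. h \<otimes> a = a \<otimes> h)"
      using cyc Z_central H_carrier by metis
  qed
  have C_normal: "C i \<lhd> G" for i
  proof (cases "i \<le> 2 * n")
    case True
    have "C i = H \<inter> {g \<in> carrier G. q g \<in> B (i - 1)}" using True H_carrier by (auto simp: C_def)
    then show ?thesis
      using normal_subgroup_intersect[OF H_normal normal_preimage[OF q.group_hom_axioms B_normal]] by simp
  qed (simp add: C_def P_normal)
  have C_sub: "subgroup (C i) G" for i using C_normal normal_imp_subgroup by blast
  have P_Z: "P m \<subseteq> Z" for m using Z.ad_funpow_closed x_carrier by (auto simp: P_def)
  have Z_C: "Z \<subseteq> C i" if "i \<le> 2 * n" for i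
  proof
    fix z assume z: "z \<in> Z"
    then have "q z = \<one>\<^bsub>G Mod Z\<^esub>" using q_one Z_carrier by blast
    then show "z \<in> C i" using that z Z_le_H subgroup.one_closed[OF normal_imp_subgroup[OF B_normal]]
      by (auto simp: C_def)
  qed
  have C_H: "C i \<subseteq> H" for i using P_Z Z_le_H by (auto simp: C_def)
  have C_carrier: "h \<in> C i \<Longrightarrow> h \<in> carrier G" for h i using C_H H_carrier by blast
  have C_Z: "C i \<subseteq> Z" if "n < i" for i
  proof (cases "i \<le> 2 * n")
    case True
    show ?thesis
    proof
      fix h assume "h \<in> C i"
      then obtain a where a: "a \<in> A" "q h = (ad (G Mod Z) (q x) ^^ (i - 1)) a" "h \<in> H"
        using True by (auto simp: C_def B_def)
      then have "q h = \<one>\<^bsub>G Mod Z\<^esub>"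
        using A.ad_funpow_eq_one[OF a(1) qx qxk] that by (simp add: n_def)
      then show "h \<in> Z" using q_one a H_carrier by blast
    qed
  qed (use P_Z in \<open>auto simp: C_def\<close>)
  have C_mono: "C j \<subseteq> C i" if "i \<le> j" for i j
  proof (cases "j \<le> 2 * n")
    case True
    have "B (j - 1) \<subseteq> B (i - 1)"
      unfolding B_def using that by (intro A.ad_funpow_image_antimono qx) auto
    then show ?thesis using True that by (auto simp: C_def)
  next
    case False
    show ?thesis
    proof (cases "i \<le> 2 * n")
      case True
      then show ?thesis using Z_C P_Z False by (auto simp: C_def)
    next
      case False
      have "P (j - 2 * n) \<subseteq> P (i - 2 * n)"
        unfolding P_def using that by (intro Z.ad_funpow_image_antimono x_carrier) auto
      then show ?thesis using False \<open>\<not> j \<le> 2 * n\<close> by (simp add: C_def)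
    qed
  qed
  have C_ad: "ad G (x [^] (2 ^ l :: nat)) h \<in> C (i + 2 ^ l)" if h: "h \<in> C i" and i: "1 \<le> i" for i h l
  proof -
    have hc: "h \<in> carrier G" "h \<in> H" using h C_H H_carrier by auto
    \<comment> \<open>The jump from weight \<open>i\<close> to \<open>i + 2 ^ l\<close> ends no
      later than the plateau, or starts inside \<open>Z\<close>, or passes over the whole plateau;
      in the last case \<open>2 ^ l > n\<close>, so the power of \<open>x\<close> is already
      trivial.\<close>
    consider (small) "i + 2 ^ l \<le> 2 * n" | (big) "n < i" "\<not> i + 2 ^ l \<le> 2 * n"
      | (trivial) "i \<le> n" "\<not> i + 2 ^ l \<le> 2 * n" by linarith
    then show ?thesis
    proof cases
      case small
      then obtain a where a: "a \<in> A" "q h = (ad (G Mod Z) (q x) ^^ (i - 1)) a"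
        using h by (auto simp: C_def B_def)
      have qh: "q h \<in> A" using hc by (auto simp: A_def)
      have "q (ad G (x [^] (2 ^ l :: nat)) h) = ad (G Mod Z) (q x [^]\<^bsub>G Mod Z\<^esub> (2 ^ l :: nat)) (q h)"
        using hom_commutator[OF q.group_hom_axioms] hc x_carrier by (simp add: q.hom_nat_pow)
      also have "\<dots> = (ad (G Mod Z) (q x) ^^ (2 ^ l)) (q h)"
        using A.ad_two_power[OF qh qx] by simp
      also have "\<dots> = (ad (G Mod Z) (q x) ^^ (i + 2 ^ l - 1)) a"
      proof -
        have "i + 2 ^ l - 1 = 2 ^ l + (i - 1)" using i by simp
        then show ?thesis by (simp only: a(2) funpow_add comp_apply)
      qed
      finally have "q (ad G (x [^] (2 ^ l :: nat)) h) \<in> B (i + 2 ^ l - 1)"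
        using a(1) by (auto simp: B_def)
      moreover have "ad G (x [^] (2 ^ l :: nat)) h \<in> H"
        using normal_commutator_left[OF H_normal] hc x_carrier by simp
      ultimately show ?thesis using small by (simp add: C_def)
    next
      case big
      have hZ: "h \<in> Z" using C_Z big h by blast
      have e: "ad G (x [^] (2 ^ l :: nat)) h = (ad G x ^^ (2 ^ l)) h"
        using Z.ad_two_power[OF hZ x_carrier] by simp
      show ?thesis
      proof (cases "i \<le> 2 * n")
        case True
        have "2 ^ l = (i + 2 ^ l - 2 * n) + (2 * n - i)" using True big by simp
        then have "(ad G x ^^ (2 ^ l)) h = (ad G x ^^ (i + 2 ^ l - 2 * n)) ((ad G x ^^ (2 * n - i)) h)"
          by (metis comp_apply funpow_add)
        then show ?thesis
          using big e Z.ad_funpow_closed[OF hZ x_carrier] by (auto simp: C_def P_def)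
      next
        case False
        then obtain z where z: "z \<in> Z" "h = (ad G x ^^ (i - 2 * n)) z" using h by (auto simp: C_def P_def)
        have "i + 2 ^ l - 2 * n = 2 ^ l + (i - 2 * n)" using False by simp
        then have "(ad G x ^^ (2 ^ l)) h = (ad G x ^^ (i + 2 ^ l - 2 * n)) z"
          by (simp only: z(2)) (simp add: funpow_add)
        then show ?thesis using big e z by (auto simp: C_def P_def)
      qed
    next
      case trivial
      then have "2 ^ k \<le> (2 ^ l :: nat)" unfolding n_def by linarith
      then have "k \<le> l" by simp
      then have "x [^] (2 ^ l :: nat) = \<one>" using ker_pow xk x_carrier by blast
      then have "ad G (x [^] (2 ^ l :: nat)) h = \<one>" using hc by (simp add: group_commutator_def)
      then show ?thesis using C_sub subgroup.one_closed by metis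
    qed
  qed
  have C_sq: "h \<otimes> h \<in> C (2 * i)" if "h \<in> C i" "1 \<le> i" for i h
  proof (cases "i \<le> n")
    case True
    then show ?thesis using that C_H H_sq Z_C[of "2 * i"] by auto
  next
    case False
    then have "h \<in> Z" using that C_Z[of i] by auto
    then have "h \<otimes> h = \<one>" using Z_sq by blast
    then show ?thesis using C_sub subgroup.one_closed by metis
  qed
  have C_comm: "group_commutator G h h' \<in> C (i + j)" if "h \<in> C i" "h' \<in> C j" for i j h h'
  proof (cases "i \<le> n \<and> j \<le> n")
    case True
    then have "i + j \<le> 2 * n" by simp
    moreover have "group_commutator G h h' \<in> Z" using H_commutator that C_H by blast
    ultimately show ?thesis using Z_C by blast
  next
    case False
    then have "h \<in> Z \<or> h' \<in> Z" using that C_Z by (meson not_le subsetD)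
    then have "h \<otimes> h' = h' \<otimes> h" using that C_H Z_central by (metis subsetD)
    then have "group_commutator G h h' = \<one>" using that C_carrier commutator_eq_one_iff by blast
    then show ?thesis using C_sub subgroup.one_closed by metis
  qed
  \<comment> \<open>The exponents \<open>j\<close> for which \<open>x [^] j\<close> has weight at
    least \<open>i\<close>, with 0 in every \<open>J i\<close>. The thresholds are powers of 2
    because only for them is \<open>x^m - 1\<close> equal to \<open>(x - 1)^m\<close>.\<close>
  define J where "J i = {j::nat. \<exists>l. i \<le> 2 ^ l \<and> 2 ^ l dvd j}" for i :: nat
  have J_add: "j + j' \<in> J i" if jj': "j \<in> J i" "j' \<in> J i" for i j j'
  proof -
    obtain l l' where l: "i \<le> 2 ^ l" "2 ^ l dvd j" "i \<le> 2 ^ l'" "2 ^ l' dvd j'"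
      using jj' by (auto simp: J_def)
    have "2 ^ min l l' dvd (2::nat) ^ l" "2 ^ min l l' dvd (2::nat) ^ l'" by (auto intro: le_imp_power_dvd)
    then have "2 ^ min l l' dvd j" "2 ^ min l l' dvd j'" using l dvd_trans by blast+
    moreover have "i \<le> 2 ^ min l l'" using l by (simp add: min_def)
    ultimately show ?thesis by (auto simp: J_def)
  qed
  have J_times: "m * j \<in> J i" if "j \<in> J i" for i j m using that by (auto simp: J_def)
  have J_double: "2 * j \<in> J (2 * i)" if j: "j \<in> J i" for i j
  proof -
    obtain l where l: "i \<le> 2 ^ l" "2 ^ l dvd j" using j by (auto simp: J_def)
    then have "2 * i \<le> 2 ^ Suc l" "2 ^ Suc l dvd 2 * j" by auto
    then show ?thesis unfolding J_def by blast
  qed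
  have J_mono: "J j \<subseteq> J i" if "i \<le> j" for i j unfolding J_def using that by (blast intro: le_trans)
  have C_J: "group_commutator G h (x [^] m) \<in> C (i + j)"
    if h: "h \<in> C i" "1 \<le> i" and m: "m \<in> J j" for h i j m
  proof -
    obtain l where l: "j \<le> 2 ^ l" "2 ^ l dvd m" using m by (auto simp: J_def)
    then obtain d where d: "m = 2 ^ l * d" by blast
    \<comment> \<open>Modulo this subgroup \<open>h\<close> commutes with \<open>x^(2^l)\<close>,
      hence with its power \<open>x^m\<close>.\<close>
    let ?S = "C (i + 2 ^ l)"
    interpret s: group_hom G "G Mod ?S" "(#>) ?S" using group_hom_FactGroup[OF C_normal] .
    have hc: "h \<in> carrier G" using h C_carrier by blast
    have "(?S #> x [^] (2 ^ l :: nat)) \<otimes>\<^bsub>G Mod ?S\<^esub> (?S #> h) =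
        (?S #> h) \<otimes>\<^bsub>G Mod ?S\<^esub> (?S #> x [^] (2 ^ l :: nat))"
      using C_ad[OF h, of l] commutator_mem_iff[OF C_normal hc] x_carrier by simp
    then have "((?S #> x [^] (2 ^ l :: nat)) [^]\<^bsub>G Mod ?S\<^esub> d) \<otimes>\<^bsub>G Mod ?S\<^esub> (?S #> h) =
        (?S #> h) \<otimes>\<^bsub>G Mod ?S\<^esub> ((?S #> x [^] (2 ^ l :: nat)) [^]\<^bsub>G Mod ?S\<^esub> d)"
      using s.hom_closed x_carrier hc by (intro s.H.group_commutes_pow) auto
    also have "(?S #> x [^] (2 ^ l :: nat)) [^]\<^bsub>G Mod ?S\<^esub> d = ?S #> x [^] m"
      using x_carrier by (simp add: s.hom_nat_pow[symmetric] nat_pow_pow d)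
    finally have "group_commutator G h (x [^] m) \<in> ?S"
      using commutator_mem_iff[OF C_normal hc] x_carrier by simp
    then show ?thesis using C_mono[of "i + j" "i + 2 ^ l"] l by auto
  qed
  define E where "E i = {x [^] j \<otimes> h | j h. j \<in> J i \<and> h \<in> C i}" for i
  have EI: "x [^] j \<otimes> h \<in> E i" if "j \<in> J i" "h \<in> C i" for i j h using that by (auto simp: E_def)
  have E_carrier: "E i \<subseteq> carrier G" for i using x_carrier C_carrier by (auto simp: E_def)
  have C_conj: "inv g \<otimes> h \<otimes> g \<in> C i" if "h \<in> C i" "g \<in> carrier G" for i h g
    using normal.inv_op_closed1[OF C_normal] that by blast
  have E_mult: "g \<otimes> g' \<in> E i" if gg': "g \<in> E i" "g' \<in> E i" for g g' i
  proof -
    obtain j h j' h' where g: "g = x [^] j \<otimes> h" "j \<in> J i" "h \<in> C i"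
      "g' = x [^] j' \<otimes> h'" "j' \<in> J i" "h' \<in> C i" using gg' by (auto simp: E_def)
    have "g \<otimes> g' = x [^] (j + j') \<otimes> ((inv (x [^] j') \<otimes> h \<otimes> x [^] j') \<otimes> h')"
      using g(1,3,4,6) x_carrier C_carrier by (simp add: group_norm flip: nat_pow_mult)
    moreover have "(inv (x [^] j') \<otimes> h \<otimes> x [^] j') \<otimes> h' \<in> C i"
      using g x_carrier C_conj C_sub by (simp add: subgroup.m_closed)
    ultimately show ?thesis using J_add g EI by simp
  qed
  have E_inv: "inv g \<in> E i" if g: "g \<in> E i" for g i
  proof -
    obtain j h where g: "g = x [^] j \<otimes> h" "j \<in> J i" "h \<in> C i" using g by (auto simp: E_def)
    have xj: "x [^] j \<in> carrier G" "h \<in> carrier G" using x_carrier g C_carrier by auto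
    \<comment> \<open>Exponents are natural numbers, so the inverse of \<open>x [^] j\<close> has to
      be written as a positive power; the multiple \<open>(n - 1) * j\<close> stays in
      \<open>J i\<close>.\<close>
    have "x [^] ((n - 1) * j) \<otimes> x [^] j = x [^] (n * j)"
      using x_carrier n0 by (simp add: nat_pow_mult) (metis Suc_pred mult_Suc add.commute)
    also have "\<dots> = \<one>" using xk x_carrier by (simp add: n_def flip: nat_pow_pow)
    finally have "inv (x [^] j) = x [^] ((n - 1) * j)"
      using x_carrier xj by (intro inv_equality) auto
    then have e: "x [^] ((n - 1) * j) \<in> E i" if "j \<in> J i"
      using that EI[OF J_times] subgroup.one_closed[OF C_sub] x_carrier by (metis nat_pow_closed r_one)
    have "inv g = inv h \<otimes> inv (x [^] j)" using g xj by (simp add: inv_mult_group)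
    moreover have "inv h \<in> E i"
      using EI[of 0 i "inv h"] g C_sub[of i] x_carrier xj by (auto simp: J_def subgroup.m_inv_closed)
    ultimately show ?thesis using E_mult e g \<open>inv (x [^] j) = _\<close> by simp
  qed
  have ex_pow: "\<exists>l. i \<le> 2 ^ l" for i :: nat using less_exp[of i] less_imp_le by blast
  have one_E: "\<one> \<in> E i" for i
    using EI[of 0 i \<one>] C_sub[of i] ex_pow by (auto simp: J_def subgroup.one_closed)
  show thesis
  proof (rule that[of E])
    show "subgroup (E i) G" for i
      using E_carrier one_E[of i] E_inv E_mult by (intro subgroupI) blast+
    show "E 1 = carrier G"
    proof
      show "carrier G \<subseteq> E 1"
      proof
        fix g assume "g \<in> carrier G"
        then obtain j :: nat and h where h: "h \<in> H" "g = x [^] j \<otimes> h" using cyc by blast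
        have "h \<in> C 1" using h n0 by (auto simp: C_def B_def A_def)
        moreover have "j \<in> J 1" by (auto simp: J_def intro!: exI[of _ 0])
        ultimately show "g \<in> E 1" using EI h by blast
      qed
    qed (rule E_carrier)
    show "E j \<subseteq> E i" if "i \<le> j" for i j
      using that J_mono C_mono unfolding E_def by blast
    show "g \<otimes> g \<in> E (2 * i)" if i: "1 \<le> i" and gE: "g \<in> E i" for i g
    proof -
      obtain j h where g: "g = x [^] j \<otimes> h" "j \<in> J i" "h \<in> C i" using gE by (auto simp: E_def)
      define u where "u = x [^] j"
      have c: "u \<in> carrier G" "h \<in> carrier G" using x_carrier g C_carrier by (auto simp: u_def)
      have "g \<otimes> g = u \<otimes> u \<otimes> ((inv u \<otimes> h \<otimes> u) \<otimes> h)"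
        using c by (simp add: g(1) group_norm flip: u_def)
      also have "u \<otimes> u = x [^] (2 * j)" using x_carrier by (simp add: u_def nat_pow_mult mult_2)
      also have "(inv u \<otimes> h \<otimes> u) \<otimes> h = (h \<otimes> h) \<otimes> (inv h \<otimes> group_commutator G h u \<otimes> h)"
        using c by (simp add: group_norm group_commutator_def)
      finally have e: "g \<otimes> g = x [^] (2 * j) \<otimes> ((h \<otimes> h) \<otimes> (inv h \<otimes> group_commutator G h u \<otimes> h))" .
      have "group_commutator G h u \<in> C (2 * i)"
        using C_J[OF g(3) i g(2)] by (simp add: u_def mult_2)
      then have "(h \<otimes> h) \<otimes> (inv h \<otimes> group_commutator G h u \<otimes> h) \<in> C (2 * i)"
        using C_sq[OF g(3) i] C_conj[OF _ c(2)] C_sub by (simp add: subgroup.m_closed)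
      then show ?thesis unfolding e using J_double[OF g(2)] by (intro EI)
    qed
    show "group_commutator G g g' \<in> E (i + j)"
      if i: "1 \<le> i" "1 \<le> j" and gE: "g \<in> E i" "g' \<in> E j" for i j g g'
    proof -
      obtain m h where g: "g = x [^] m \<otimes> h" "m \<in> J i" "h \<in> C i" using gE by (auto simp: E_def)
      obtain m' h' where g': "g' = x [^] m' \<otimes> h'" "m' \<in> J j" "h' \<in> C j" using gE by (auto simp: E_def)
      let ?S = "C (i + j)"
      interpret s: group_hom G "G Mod ?S" "(#>) ?S" using group_hom_FactGroup[OF C_normal] .
      have c: "x [^] m \<in> carrier G" "h \<in> carrier G" "x [^] m' \<in> carrier G" "h' \<in> carrier G"
        using x_carrier g g' C_carrier by auto
      have 1: "group_commutator G h (x [^] m') \<in> ?S" using C_J[OF g(3) i(1) g'(2)] .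
      have 2: "group_commutator G h' (x [^] m) \<in> ?S" using C_J[OF g'(3) i(2) g(2)] by (simp add: add.commute)
      have 3: "group_commutator G h h' \<in> ?S" using C_comm g g' by blast
      have 4: "x [^] m \<otimes> x [^] m' = x [^] m' \<otimes> x [^] m"
        using x_carrier by (simp add: nat_pow_mult add.commute)
      \<comment> \<open>Modulo \<open>C (i + j)\<close> both factors of \<open>g\<close> commute
        with both factors of \<open>g'\<close>, so the commutator even lies in
        \<open>C (i + j)\<close>.\<close>
      have "((?S #> x [^] m) \<otimes>\<^bsub>G Mod ?S\<^esub> (?S #> h)) \<otimes>\<^bsub>G Mod ?S\<^esub> ((?S #> x [^] m') \<otimes>\<^bsub>G Mod ?S\<^esub> (?S #> h')) =
        ((?S #> x [^] m') \<otimes>\<^bsub>G Mod ?S\<^esub> (?S #> h')) \<otimes>\<^bsub>G Mod ?S\<^esub> ((?S #> x [^] m) \<otimes>\<^bsub>G Mod ?S\<^esub> (?S #> h))"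
      proof (rule s.H.commute_mult_mult)
        show "(?S #> x [^] m) \<otimes>\<^bsub>G Mod ?S\<^esub> (?S #> x [^] m') = (?S #> x [^] m') \<otimes>\<^bsub>G Mod ?S\<^esub> (?S #> x [^] m)"
          using 4 c by (metis s.hom_mult)
        show "(?S #> x [^] m) \<otimes>\<^bsub>G Mod ?S\<^esub> (?S #> h') = (?S #> h') \<otimes>\<^bsub>G Mod ?S\<^esub> (?S #> x [^] m)"
          using 2 commutator_mem_iff[OF C_normal] c by simp
        show "(?S #> h) \<otimes>\<^bsub>G Mod ?S\<^esub> (?S #> x [^] m') = (?S #> x [^] m') \<otimes>\<^bsub>G Mod ?S\<^esub> (?S #> h)"
          using 1 commutator_mem_iff[OF C_normal] c by simp
        show "(?S #> h) \<otimes>\<^bsub>G Mod ?S\<^esub> (?S #> h') = (?S #> h') \<otimes>\<^bsub>G Mod ?S\<^esub> (?S #> h)"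
          using 3 commutator_mem_iff[OF C_normal] c by simp
      qed (use c s.hom_closed in auto)
      then have "group_commutator G g g' \<in> ?S"
        using commutator_mem_iff[OF C_normal, of g g' "i + j"] c by (simp only: g g' s.hom_mult m_closed)
      then show ?thesis
        using EI[of 0 "i + j"] ex_pow c E_carrier[of i] C_carrier by (fastforce simp: J_def)
    qed
    \<comment> \<open>\<open>C\<close> is trivial from \<open>3 * n\<close> on, when
      \<open>(x - 1)^n\<close> has also killed \<open>Z\<close>. The next power of 2 is
      \<open>4 * n = 2 ^ (k + 2)\<close>, which suits series whose weights double.\<close>
    show "E (4 * 2 ^ k) = {\<one>}"
    proof -
      have "C (4 * n) \<subseteq> {\<one>}"
        using Z.ad_funpow_eq_one[OF _ x_carrier xk] n0 by (auto simp: C_def P_def n_def)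
      moreover have "x [^] j = \<one>" if jJ: "j \<in> J (4 * n)" for j
      proof -
        obtain l where l: "4 * n \<le> 2 ^ l" "2 ^ l dvd j" using jJ by (auto simp: J_def)
        then obtain d where d: "j = 2 ^ l * d" by blast
        have "2 ^ k \<le> (2 ^ l :: nat)" using l(1) unfolding n_def by linarith
        then have "k \<le> l" by simp
        then have "x [^] (2 ^ l :: nat) = \<one>" using ker_pow xk x_carrier by blast
        then show ?thesis using x_carrier by (simp add: d flip: nat_pow_pow)
      qed
      ultimately have "E (4 * n) \<subseteq> {\<one>}" by (fastforce simp: E_def)
      then show ?thesis using one_E by (auto simp: n_def)
    qed
  qed
qed

end


section \<open>Groups with continuous translations\<close>

text \<open>Translations and inversion descend directly to a quotient topology; joint continuity
  would bring in products of quotient maps.\<close>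

locale semitopological_group = plain_group G for G :: "'a monoid" (structure) +
  fixes T :: "'a topology"
  assumes topspace_eq: "topspace T = carrier G"
    and left_continuous: "g \<in> carrier G \<Longrightarrow> continuous_map T T (\<lambda>h. g \<otimes> h)"
    and right_continuous: "g \<in> carrier G \<Longrightarrow> continuous_map T T (\<lambda>h. h \<otimes> g)"
    and inv_continuous: "continuous_map T T (\<lambda>h. inv h)"
begin

lemma closedin_carrier: "closedin T K \<Longrightarrow> K \<subseteq> carrier G"
  using closedin_subset topspace_eq by fastforce

lemma closedin_carrier_G: "closedin T (carrier G)"
  by (metis closedin_topspace topspace_eq)

lemma closure_of_subgroup:
  assumes K: "subgroup K G"
  shows "subgroup (T closure_of K) G"
proof (rule subgroupI)
  have sub: "K \<subseteq> T closure_of K" using K by (simp add: closure_of_subset topspace_eq subgroup.subset)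
  show clc: "T closure_of K \<subseteq> carrier G" using closure_of_subset_topspace topspace_eq by metis
  show "T closure_of K \<noteq> {}" using sub K subgroup.one_closed by blast
  have preim: "f ` (T closure_of K) \<subseteq> T closure_of K"
    if "continuous_map T T f" "f ` K \<subseteq> T closure_of K" for f
    using continuous_map_image_closure_subset[OF that(1), of K]
      closure_of_minimal[OF that(2) closedin_closure_of] by blast
  show "inv g \<in> T closure_of K" if "g \<in> T closure_of K" for g
  proof -
    have "(\<lambda>h. inv h) ` K \<subseteq> T closure_of K" using sub K subgroup.m_inv_closed by fast
    then show ?thesis using preim[OF inv_continuous] that by blast
  qed
  \<comment> \<open>With separate continuity the product of two limits takes two passes: first with
    the left factor in \<open>K\<close>, then with both factors in the closure.\<close>
  have 1: "g \<otimes> h \<in> T closure_of K" if "g \<in> K" "h \<in> T closure_of K" for g h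
  proof -
    have "g \<in> carrier G" using that K subgroup.mem_carrier by fast
    moreover have "(\<lambda>h. g \<otimes> h) ` K \<subseteq> T closure_of K" using sub that K subgroup.m_closed by fast
    ultimately show ?thesis using preim[OF left_continuous] that by blast
  qed
  show "g \<otimes> h \<in> T closure_of K" if "g \<in> T closure_of K" "h \<in> T closure_of K" for g h
  proof -
    have "h \<in> carrier G" using that clc by blast
    moreover have "(\<lambda>g. g \<otimes> h) ` K \<subseteq> T closure_of K" using 1 that by blast
    ultimately show ?thesis using preim[OF right_continuous] that by blast
  qed
qed

lemma closed_generate_subgroup: "S \<subseteq> carrier G \<Longrightarrow> subgroup (closed_generate G T S) G"
  unfolding closed_generate_def by (intro closure_of_subgroup generate_is_subgroup)

lemma closed_generate_closed: "closedin T (closed_generate G T S)"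
  by (simp add: closed_generate_def)

lemma closed_generate_incl: "S \<subseteq> carrier G \<Longrightarrow> S \<subseteq> closed_generate G T S"
  unfolding closed_generate_def
  by (rule subset_trans[OF _ closure_of_subset]) (auto intro: generate.incl generate_in_carrier simp: topspace_eq)

lemma closed_generate_minimal:
  "subgroup K G \<Longrightarrow> closedin T K \<Longrightarrow> S \<subseteq> K \<Longrightarrow> closed_generate G T S \<subseteq> K"
  unfolding closed_generate_def by (intro closure_of_minimal generate_subgroup_incl)

lemma conj_continuous:
  assumes "g \<in> carrier G"
  shows "continuous_map T T (\<lambda>h. g \<otimes> h \<otimes> inv g)"
  using continuous_map_compose[OF left_continuous[OF assms] right_continuous[of "inv g"]] assms
  by (simp add: o_def)

lemma closure_of_normal:
  assumes K: "K \<lhd> G"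
  shows "T closure_of K \<lhd> G"
  unfolding normal_inv_iff
proof (intro conjI ballI)
  show "subgroup (T closure_of K) G" using closure_of_subgroup K normal_imp_subgroup by blast
  fix g h assume g: "g \<in> carrier G" "h \<in> T closure_of K"
  have "(\<lambda>h. g \<otimes> h \<otimes> inv g) ` K \<subseteq> K" using K g(1) normal_inv_iff by auto
  then have "T closure_of ((\<lambda>h. g \<otimes> h \<otimes> inv g) ` K) \<subseteq> T closure_of K" by (rule closure_of_mono)
  then show "g \<otimes> h \<otimes> inv g \<in> T closure_of K"
    using continuous_map_image_closure_subset[OF conj_continuous[OF g(1)], of K] g(2) by blast
qed

lemma closed_generate_normal:
  assumes "S \<subseteq> carrier G" "\<And>s g. s \<in> S \<Longrightarrow> g \<in> carrier G \<Longrightarrow> g \<otimes> s \<otimes> inv g \<in> S"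
  shows "closed_generate G T S \<lhd> G"
  unfolding closed_generate_def by (intro closure_of_normal normal_generateI assms)

lemma power_subgroup_normal:
  assumes K: "K \<lhd> G"
  shows "power_subgroup G T K m \<lhd> G"
  unfolding power_subgroup_def
proof (rule closed_generate_normal)
  interpret K: normal K G by fact
  show "{g [^] m | g. g \<in> K} \<subseteq> carrier G" by auto
  fix s g assume "s \<in> {g [^] m | g. g \<in> K}" and g: "g \<in> carrier G"
  then obtain k where k: "k \<in> K" "s = k [^] m" by auto
  have kc: "k \<in> carrier G" using k by simp
  have "(g \<otimes> k \<otimes> inv g) [^] m = g \<otimes> k [^] m \<otimes> inv g"
    using kc g by (induction m) (auto simp: group_norm)
  then show "g \<otimes> s \<otimes> inv g \<in> {g [^] m | g. g \<in> K}"
    using k K.inv_op_closed2[OF g k(1)] by force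
qed

lemma conj_commutator:
  assumes "u \<in> carrier G" "v \<in> carrier G" "g \<in> carrier G"
  shows "g \<otimes> group_commutator G u v \<otimes> inv g =
    group_commutator G (g \<otimes> u \<otimes> inv g) (g \<otimes> v \<otimes> inv g)"
  using assms by (simp add: group_commutator_def group_norm)

lemma commutator_subgroup_normal:
  assumes H: "H \<lhd> G" and K: "K \<lhd> G"
  shows "commutator_subgroup G T H K \<lhd> G"
  unfolding commutator_subgroup_def
proof (rule closed_generate_normal)
  interpret H: normal H G by fact
  interpret K: normal K G by fact
  show "{group_commutator G u v | u v. u \<in> H \<and> v \<in> K} \<subseteq> carrier G" by auto
  fix s g assume "s \<in> {group_commutator G u v | u v. u \<in> H \<and> v \<in> K}" and g: "g \<in> carrier G"
  then obtain u v where uv: "u \<in> H" "v \<in> K" "s = group_commutator G u v" by auto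
  then have "g \<otimes> s \<otimes> inv g = group_commutator G (g \<otimes> u \<otimes> inv g) (g \<otimes> v \<otimes> inv g)"
    using g conj_commutator by simp
  then show "g \<otimes> s \<otimes> inv g \<in> {group_commutator G u v | u v. u \<in> H \<and> v \<in> K}"
    using H.inv_op_closed2[OF g uv(1)] K.inv_op_closed2[OF g uv(2)] by blast
qed

lemma power_mem_power_subgroup:
  "K \<subseteq> carrier G \<Longrightarrow> g \<in> K \<Longrightarrow> g [^] m \<in> power_subgroup G T K m"
  unfolding power_subgroup_def by (rule closed_generate_incl[THEN subsetD]) auto

lemma commutator_mem_commutator_subgroup:
  "H \<subseteq> carrier G \<Longrightarrow> K \<subseteq> carrier G \<Longrightarrow> u \<in> H \<Longrightarrow> v \<in> K \<Longrightarrow>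
    group_commutator G u v \<in> commutator_subgroup G T H K"
  unfolding commutator_subgroup_def
  by (rule closed_generate_incl[THEN subsetD]) (auto simp: subset_iff)

lemma power_subgroup_minimal:
  "subgroup L G \<Longrightarrow> closedin T L \<Longrightarrow> (\<And>g. g \<in> K \<Longrightarrow> g [^] m \<in> L) \<Longrightarrow> power_subgroup G T K m \<subseteq> L"
  unfolding power_subgroup_def by (rule closed_generate_minimal) auto

lemma commutator_subgroup_minimal:
  "subgroup L G \<Longrightarrow> closedin T L \<Longrightarrow> (\<And>u v. u \<in> H \<Longrightarrow> v \<in> K \<Longrightarrow> group_commutator G u v \<in> L) \<Longrightarrow>
    commutator_subgroup G T H K \<subseteq> L"
  unfolding commutator_subgroup_def by (rule closed_generate_minimal) auto

lemma power_subgroup_closed: "closedin T (power_subgroup G T K m)"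
  by (simp add: power_subgroup_def closed_generate_closed)

lemma commutator_subgroup_closed: "closedin T (commutator_subgroup G T H K)"
  by (simp add: commutator_subgroup_def closed_generate_closed)

lemma set_mult_normal:
  assumes H: "H \<lhd> G" and K: "K \<lhd> G"
  shows "H <#> K \<lhd> G"
proof -
  interpret H: normal H G by fact
  interpret K: normal K G by fact
  have mem: "h \<otimes> k \<in> H <#> K" if "h \<in> H" "k \<in> K" for h k using that by (auto simp: set_mult_def)
  have dest: "\<exists>h\<in>H. \<exists>k\<in>K. g = h \<otimes> k" if "g \<in> H <#> K" for g using that by (auto simp: set_mult_def)
  have "subgroup (H <#> K) G"
  proof (rule subgroupI)
    show "H <#> K \<subseteq> carrier G" by (simp add: set_mult_closed H.subset K.subset)
    show "H <#> K \<noteq> {}" using mem[OF H.one_closed K.one_closed] by blast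
  next
    fix g assume "g \<in> H <#> K"
    then obtain h k where g: "h \<in> H" "k \<in> K" "g = h \<otimes> k" using dest by blast
    then have "inv g = inv h \<otimes> (h \<otimes> inv k \<otimes> inv h)"
      by (simp add: group_norm)
    then show "inv g \<in> H <#> K" using g K.inv_op_closed2 by (simp add: mem)
  next
    fix g g' assume "g \<in> H <#> K" "g' \<in> H <#> K"
    then obtain h k h' k' where g: "h \<in> H" "k \<in> K" "g = h \<otimes> k" "h' \<in> H" "k' \<in> K" "g' = h' \<otimes> k'"
      using dest by meson
    then have "g \<otimes> g' = (h \<otimes> h') \<otimes> ((inv h' \<otimes> k \<otimes> h') \<otimes> k')" by (simp add: group_norm)
    then show "g \<otimes> g' \<in> H <#> K" using g K.inv_op_closed1 by (simp add: mem)
  qed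
  then show ?thesis
    unfolding normal_inv_iff
  proof (intro conjI ballI)
    fix g l assume g: "g \<in> carrier G" "l \<in> H <#> K"
    then obtain h k where l: "h \<in> H" "k \<in> K" "l = h \<otimes> k" using dest by blast
    then have "g \<otimes> l \<otimes> inv g = (g \<otimes> h \<otimes> inv g) \<otimes> (g \<otimes> k \<otimes> inv g)" using g by (simp add: group_norm)
    then show "g \<otimes> l \<otimes> inv g \<in> H <#> K" using g l H.inv_op_closed2 K.inv_op_closed2 by (simp add: mem)
  qed
qed

lemma set_mult_subset: "subgroup L G \<Longrightarrow> H \<subseteq> L \<Longrightarrow> K \<subseteq> L \<Longrightarrow> H <#> K \<subseteq> L"
  unfolding set_mult_def using subgroup.m_closed by fast

lemma subset_set_mult_left: "H \<subseteq> carrier G \<Longrightarrow> subgroup K G \<Longrightarrow> H \<subseteq> H <#> K"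
  unfolding set_mult_def using subgroup.one_closed by (fastforce intro: r_one[symmetric])

lemma subset_set_mult_right: "K \<subseteq> carrier G \<Longrightarrow> subgroup H G \<Longrightarrow> K \<subseteq> H <#> K"
  unfolding set_mult_def using subgroup.one_closed by (fastforce intro: l_one[symmetric])

lemma closedin_rcos:
  assumes K: "closedin T K" and g: "g \<in> carrier G"
  shows "closedin T (K #> g)"
proof -
  have "K #> g = {h \<in> topspace T. h \<otimes> inv g \<in> K}"
  proof
    show "K #> g \<subseteq> {h \<in> topspace T. h \<otimes> inv g \<in> K}"
      using closedin_carrier[OF K] g by (auto simp: r_coset_def topspace_eq group_norm)
    show "{h \<in> topspace T. h \<otimes> inv g \<in> K} \<subseteq> K #> g"
    proof
      fix h assume h: "h \<in> {h \<in> topspace T. h \<otimes> inv g \<in> K}"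
      then have "h = (h \<otimes> inv g) \<otimes> g" using g by (simp add: topspace_eq m_assoc)
      then show "h \<in> K #> g" using h by (auto simp: r_coset_def)
    qed
  qed
  then show ?thesis
    using closedin_continuous_map_preimage[OF right_continuous[of "inv g"] K] g by simp
qed

text \<open>A finite union of cosets of a closed subgroup is closed. This is the source of closed
  subgroups wherever only translations are known to be continuous.\<close>

lemma closedin_finite_index:
  assumes S: "subgroup S G" "closedin T S" and K: "subgroup K G" "S \<subseteq> K"
    and fin: "finite ((#>) S ` K)"
  shows "closedin T K"
proof -
  have Kc: "K \<subseteq> carrier G" using K subgroup.subset by blast
  have "K = \<Union> ((#>) S ` K)"
  proof
    show "K \<subseteq> \<Union> ((#>) S ` K)" using rcos_self S Kc by blast
    show "\<Union> ((#>) S ` K) \<subseteq> K"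
      using K by (auto simp: r_coset_def intro: subgroup.m_closed)
  qed
  moreover have "closedin T (\<Union> ((#>) S ` K))"
    using fin S closedin_rcos Kc by (intro closedin_Union) auto
  ultimately show ?thesis by simp
qed

end

lemma topological_group_semitopological:
  assumes "topological_group G T"
  shows "semitopological_group G T"
proof -
  have G: "group G" and top: "topspace T = carrier G"
    and m: "continuous_map (prod_topology T T) T (\<lambda>(x, y). x \<otimes>\<^bsub>G\<^esub> y)"
    and i: "continuous_map T T (\<lambda>x. inv\<^bsub>G\<^esub> x)"
    using assms by (auto simp: topological_group_def)
  show ?thesis
  proof (intro semitopological_group.intro semitopological_group_axioms.intro plain_group.intro G top i)
    fix g assume g: "g \<in> carrier G"
    have "continuous_map T (prod_topology T T) (\<lambda>h. (g, h))"
      "continuous_map T (prod_topology T T) (\<lambda>h. (h, g))"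
      using g top by (auto simp: continuous_map_pairwise o_def)
    from this[THEN continuous_map_compose, OF m]
    show "continuous_map T T (\<lambda>h. g \<otimes>\<^bsub>G\<^esub> h)" "continuous_map T T (\<lambda>h. h \<otimes>\<^bsub>G\<^esub> g)"
      by (simp_all add: o_def)
  qed
qed

text \<open>For the free group itself, where joint continuity is available: the product set is the
  image of a compact set.\<close>

lemma topological_group_set_mult_closed:
  assumes "topological_group G T" "compact_space T" "Hausdorff_space T" "closedin T H" "closedin T K"
  shows "closedin T (H <#>\<^bsub>G\<^esub> K)"
proof -
  have m: "continuous_map (prod_topology T T) T (\<lambda>(x, y). x \<otimes>\<^bsub>G\<^esub> y)"
    using assms by (auto simp: topological_group_def)
  have "compactin (prod_topology T T) (H \<times> K)"
    using assms by (simp add: compactin_Times closedin_compact_space)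
  then have "compactin T ((\<lambda>(x, y). x \<otimes>\<^bsub>G\<^esub> y) ` (H \<times> K))" using image_compactin m by blast
  moreover have "(\<lambda>(x, y). x \<otimes>\<^bsub>G\<^esub> y) ` (H \<times> K) = H <#>\<^bsub>G\<^esub> K" by (auto simp: set_mult_def)
  ultimately show ?thesis using compactin_imp_closedin assms by metis
qed

section \<open>Quotients by closed normal subgroups\<close>

locale dense_tower = semitopological_group G T + tower G x H Z
  for G :: "'a monoid" (structure) and T x H Z +
  fixes y :: 'a
  assumes compact: "compact_space T"
    and y_H: "y \<in> H"
    and dense: "closed_generate G T {x, y} = carrier G"
    and Z_closed: "closedin T Z"
begin

lemma y_carrier: "y \<in> carrier G" using y_H H_carrier by blast

text \<open>The subgroup \<open>D\<close> generated by the images of \<open>x\<close> and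
  \<open>y\<close> is finite, so its preimage is closed; it contains \<open>x\<close> and
  \<open>y\<close> and is everything by density. Thus a closed normal subgroup containing some
  \<open>x^(2^k)\<close> has finite index.\<close>

lemma Mod_finite_generated:
  assumes S: "S \<lhd> G" "closedin T S" and x: "x [^] (2 ^ k :: nat) \<in> S"
  shows "finite (carrier (G Mod S))" "generate (G Mod S) {S #> x, S #> y} = carrier (G Mod S)"
proof -
  interpret q: group_hom G "G Mod S" "(#>) S" using group_hom_FactGroup[OF S(1)] .
  interpret Q: tower "G Mod S" "S #> x" "(#>) S ` H" "(#>) S ` Z"
    using tower_Mod[OF S(1)] .
  have Ssub: "subgroup S G" using S(1) normal_imp_subgroup by blast
  define D where "D = generate (G Mod S) {S #> x, S #> y}"
  have xk: "(S #> x) [^]\<^bsub>G Mod S\<^esub> (2 ^ k :: nat) = \<one>\<^bsub>G Mod S\<^esub>"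
    using x x_carrier Ssub by (simp add: q.hom_nat_pow[symmetric] coset_eq_subgroup_iff)
  have fin: "finite D" unfolding D_def
    using y_H by (intro Q.finite_generate_pair[OF _ xk]) auto
  have xy: "{S #> x, S #> y} \<subseteq> carrier (G Mod S)" using x_carrier y_carrier q.hom_closed by auto
  have D: "subgroup D (G Mod S)" unfolding D_def using xy by (rule q.H.generate_is_subgroup)
  define D' where "D' = {g \<in> carrier G. S #> g \<in> D}"
  have D': "subgroup D' G"
    unfolding D'_def using subgroup_preimage[OF q.group_hom_axioms D] .
  have "S \<subseteq> D'"
    using Ssub subgroup.one_closed[OF D] by (auto simp: D'_def coset_join2 subgroup.mem_carrier)
  moreover have "finite ((#>) S ` D')" by (rule finite_subset[OF _ fin]) (auto simp: D'_def)
  ultimately have "closedin T D'" using closedin_finite_index[OF Ssub S(2) D'] by blast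
  moreover have "{x, y} \<subseteq> D'" using x_carrier y_carrier by (auto simp: D'_def D_def intro: generate.incl)
  ultimately have "carrier G \<subseteq> D'" using closed_generate_minimal[OF D'] dense by metis
  then have "carrier (G Mod S) \<subseteq> D" by (auto simp: carrier_FactGroup D'_def)
  then show "generate (G Mod S) {S #> x, S #> y} = carrier (G Mod S)"
    using subgroup.subset[OF D] by (auto simp: D_def)
  with fin show "finite (carrier (G Mod S))" by (simp add: D_def)
qed

text \<open>In \<open>G\<close> itself 2-adic powers of \<open>x\<close> would occur. Modulo
  \<open>S\<close> the order of \<open>x\<close> is finite, natural exponents suffice, and the
  inverse of \<open>x\<close> becomes \<open>x^(n - 1)\<close>.\<close>

lemma Mod_cyclic:
  assumes S: "S \<lhd> G" "closedin T S" and x: "x [^] (2 ^ k :: nat) \<in> S" and g: "g \<in> carrier G"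
  shows "\<exists>j::nat. \<exists>h\<in>H. S #> g = S #> (x [^] j \<otimes> h)"
proof -
  interpret q: group_hom G "G Mod S" "(#>) S" using group_hom_FactGroup[OF S(1)] .
  have Ssub: "subgroup S G" using S(1) normal_imp_subgroup by blast
  define n where "n = (2::nat) ^ k"
  have n0: "n > 0" by (simp add: n_def)
  define D where "D = {g \<in> carrier G. \<exists>j::nat. \<exists>h\<in>H. S #> g = S #> (x [^] j \<otimes> h)}"
  have DI: "u \<in> D" if "u \<in> carrier G" "h \<in> H" "S #> u = S #> (x [^] j \<otimes> h)" for u h and j :: nat
    using that by (auto simp: D_def)
  note H1 = subgroup.one_closed[OF H_subgroup]
  have Dm: "u \<otimes> v \<in> D" if uv: "u \<in> D" "v \<in> D" for u v
  proof -
    obtain j j' :: nat and h h' where h: "h \<in> H" "h' \<in> H" "S #> u = S #> (x [^] j \<otimes> h)"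
      "S #> v = S #> (x [^] j' \<otimes> h')" "u \<in> carrier G" "v \<in> carrier G" using uv by (auto simp: D_def)
    have "S #> (u \<otimes> v) = S #> ((x [^] j \<otimes> h) \<otimes> (x [^] j' \<otimes> h'))"
      using h x_carrier H_carrier q.hom_mult by (metis m_closed nat_pow_closed)
    also have "(x [^] j \<otimes> h) \<otimes> (x [^] j' \<otimes> h') =
        x [^] (j + j') \<otimes> ((inv (x [^] j') \<otimes> h \<otimes> x [^] j') \<otimes> h')"
      using h(1,2) x_carrier H_carrier by (simp add: group_norm flip: nat_pow_mult)
    finally have "S #> (u \<otimes> v) = S #> (x [^] (j + j') \<otimes> ((inv (x [^] j') \<otimes> h \<otimes> x [^] j') \<otimes> h'))" .
    moreover have "(inv (x [^] j') \<otimes> h \<otimes> x [^] j') \<otimes> h' \<in> H"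
      using h x_carrier normal.inv_op_closed1[OF H_normal] H_subgroup by (simp add: subgroup.m_closed)
    ultimately show ?thesis using h by (auto simp: D_def)
  qed
  have "S #> u \<in> (#>) S ` D" if "u \<in> carrier G" for u
  proof -
    have c: "{S #> x, S #> y} \<subseteq> carrier (G Mod S)" using x_carrier y_carrier q.hom_closed by auto
    have "S #> u \<in> generate (G Mod S) {S #> x, S #> y}"
      using Mod_finite_generated(2)[OF S x] that by (auto simp: carrier_FactGroup)
    then show ?thesis
    proof (induction rule: generate.induct)
      case one
      have "\<one> \<in> D" by (rule DI[OF _ H1, of _ 0]) auto
      then show ?case using q.hom_one by force
    next
      case (incl h)
      have "x \<in> D" using x_carrier by (intro DI[OF _ H1, of _ 1]) auto
      moreover have "y \<in> D" using y_carrier by (intro DI[OF _ y_H, of _ 0]) auto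
      ultimately show ?case using incl by auto
    next
      case (inv h)
      have "inv y \<in> D" using y_carrier
        by (intro DI[OF _ subgroup.m_inv_closed[OF H_subgroup y_H], of _ 0]) auto
      moreover have "inv x \<in> D"
      proof -
        have "x [^] (n - 1) = x [^] n \<otimes> inv x"
          using x_carrier n0 by (cases n) (auto simp: m_assoc)
        then have "S #> (x [^] (n - 1)) = (S #> x [^] n) \<otimes>\<^bsub>G Mod S\<^esub> (S #> inv x)"
          using x_carrier q.hom_mult by (metis inv_closed nat_pow_closed)
        also have "S #> x [^] n = \<one>\<^bsub>G Mod S\<^esub>"
          using x x_carrier Ssub by (simp add: n_def coset_join2)
        finally have "S #> (x [^] (n - 1)) = S #> inv x"
          using x_carrier q.hom_closed q.H.l_one by (metis inv_closed)
        then show ?thesis using x_carrier by (intro DI[OF _ H1, of _ "n - 1"]) auto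
      qed
      ultimately show ?case using inv x_carrier y_carrier
        by (auto simp: q.hom_inv[symmetric] simp del: q.hom_inv)
    next
      case (eng h1 h2)
      then obtain d1 d2 where d: "d1 \<in> D" "d2 \<in> D" "h1 = S #> d1" "h2 = S #> d2" by auto
      then have "h1 \<otimes>\<^bsub>G Mod S\<^esub> h2 = S #> (d1 \<otimes> d2)" using q.hom_mult by (auto simp: D_def)
      then show ?case using Dm d by blast
    qed
  qed
  from this[OF g] show ?thesis by (auto simp: D_def)
qed

lemma Mod_card_le:
  assumes S: "S \<lhd> G" "closedin T S" and x: "x [^] (2 ^ n :: nat) \<in> S"
    and y: "S #> (ad G x ^^ n) y \<in> (#>) S ` Z"
  shows "card (carrier (G Mod S)) \<le> 4 ^ n * card ((#>) S ` Z)"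
proof -
  interpret q: group_hom G "G Mod S" "(#>) S" using group_hom_FactGroup[OF S(1)] .
  interpret Q: tower "G Mod S" "S #> x" "(#>) S ` H" "(#>) S ` Z"
    using tower_Mod[OF S(1)] .
  have Ssub: "subgroup S G" using S(1) normal_imp_subgroup by blast
  show ?thesis
  proof (rule Q.card_carrier_le)
    show "finite (carrier (G Mod S))" "generate (G Mod S) {S #> x, S #> y} = carrier (G Mod S)"
      using Mod_finite_generated[OF S x] by auto
    show "S #> y \<in> (#>) S ` H" using y_H by blast
    show "(ad (G Mod S) (S #> x) ^^ n) (S #> y) \<in> (#>) S ` Z"
      using hom_ad_funpow[OF q.group_hom_axioms y_carrier x_carrier] y by simp
    show "(S #> x) [^]\<^bsub>G Mod S\<^esub> (2 ^ n :: nat) = \<one>\<^bsub>G Mod S\<^esub>"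
      using x x_carrier Ssub by (simp add: q.hom_nat_pow[symmetric] coset_join2)
  qed
qed

end


section \<open>Prescribing the Hausdorff dimension of a normal subgroup\<close>

text \<open>\<open>ad_Z\<close> bounds cyclic submodules of \<open>Z\<close> modulo
  \<open>S i\<close> by \<open>n i\<close> dimensions; \<open>x_pow\<close> and \<open>ad_y\<close>
  bound \<open>G/Z\<close> by \<open>2 * n i\<close>. The condition \<open>ad_y\<close> asks for the
  image of \<open>Z\<close> and not for \<open>S i\<close>, because powers of \<open>x - 1\<close>
  are under control on \<open>H/Z\<close> and on \<open>Z\<close> but not on
  \<open>H\<close>.\<close>

locale filtered_tower = dense_tower G T x H Z y
  for G :: "'a monoid" (structure) and T x H Z y +
  fixes S :: "nat \<Rightarrow> 'a set" and n :: "nat \<Rightarrow> nat"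
  assumes S_normal: "S i \<lhd> G" and S_closed: "closedin T (S i)"
    and ad_Z: "z \<in> Z \<Longrightarrow> (ad G x ^^ n i) z \<in> S i"
    and ad_y: "S i #> (ad G x ^^ n i) y \<in> (#>) (S i) ` Z"
    and x_pow: "x [^] (2 ^ n i :: nat) \<in> S i"
    and index_top: "filterlim (\<lambda>i. ln (real (card ((#>) (S i) ` carrier G)))) at_top sequentially"
    and ratio: "(\<lambda>i. real (n i) / ln (real (card ((#>) (S i) ` carrier G)))) \<longlonglongrightarrow> 0"
begin

section \<open>Indices and their logarithms at a single level\<close>

definition idx :: "nat \<Rightarrow> 'a set \<Rightarrow> nat" where "idx i K = card ((#>) (S i) ` K)"
definition ldim :: "nat \<Rightarrow> 'a set \<Rightarrow> real" where "ldim i K = ln (real (idx i K))"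
abbreviation gdim :: "nat \<Rightarrow> real" where "gdim i \<equiv> ldim i (carrier G)"

lemma S_subgroup: "subgroup (S i) G" using S_normal normal_imp_subgroup by blast

lemma finite_image_Mod: "K \<subseteq> carrier G \<Longrightarrow> finite ((#>) (S i) ` K)"
  using Mod_finite_generated(1)[OF S_normal S_closed x_pow]
  by (rule finite_subset[rotated]) (auto simp: carrier_FactGroup)

lemma idx_mono: "K \<subseteq> L \<Longrightarrow> L \<subseteq> carrier G \<Longrightarrow> idx i K \<le> idx i L"
  unfolding idx_def by (intro card_mono finite_image_Mod image_mono)

lemma idx_pos: "subgroup K G \<Longrightarrow> idx i K > 0"
  unfolding idx_def using finite_image_Mod[OF subgroup.subset] subgroup.one_closed
  by (metis card_gt_0_iff empty_iff image_is_empty)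

lemma ldim_mono: "subgroup K G \<Longrightarrow> K \<subseteq> L \<Longrightarrow> L \<subseteq> carrier G \<Longrightarrow> ldim i K \<le> ldim i L"
  unfolding ldim_def using idx_mono[of K L i] idx_pos[of K i] by simp

lemma ldim_nonneg: "subgroup K G \<Longrightarrow> 0 \<le> ldim i K"
  unfolding ldim_def using idx_pos[of K i] by (simp add: ln_ge_zero Suc_leI)

lemma coset_mult_S: "k \<in> carrier G \<Longrightarrow> s \<in> S i \<Longrightarrow> S i #> (k \<otimes> s) = S i #> k"
proof -
  assume k: "k \<in> carrier G" "s \<in> S i"
  interpret normal "S i" G by (rule S_normal)
  have "k \<otimes> s = (k \<otimes> s \<otimes> inv k) \<otimes> k" using k by (simp add: group_norm)
  then have "k \<otimes> s \<in> S i #> k" using inv_op_closed2[OF k] by (auto simp: r_coset_def)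
  then show ?thesis using repr_independence k is_subgroup by metis
qed

lemma subgroup_index_eq:
  assumes "subgroup K G"
  shows "subgroup_index G (K <#> S i) (S i) = idx i K"
proof -
  have "(#>) (S i) ` (K <#> S i) = (#>) (S i) ` K"
  proof
    show "(#>) (S i) ` (K <#> S i) \<subseteq> (#>) (S i) ` K"
      using coset_mult_S subgroup.mem_carrier[OF assms] by (auto simp: set_mult_def)
    show "(#>) (S i) ` K \<subseteq> (#>) (S i) ` (K <#> S i)"
      using subset_set_mult_left[OF subgroup.subset[OF assms] S_subgroup] by (intro image_mono)
  qed
  then show ?thesis by (simp add: subgroup_index_def idx_def)
qed

lemma hdim_eq: "subgroup K G \<Longrightarrow> hdim G S K = liminf (\<lambda>i. ereal (ldim i K / gdim i))"
  by (simp add: hdim_def subgroup_index_eq ldim_def) (simp add: subgroup_index_def idx_def)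

lemma hdim_bounds:
  assumes "subgroup K G"
  shows "0 \<le> hdim G S K" "hdim G S K \<le> 1"
proof -
  \<comment> \<open>Division by zero yields 0, so a level with trivial index obeys the same
    bounds.\<close>
  have *: "0 \<le> ldim i K / gdim i" "ldim i K / gdim i \<le> 1" for i
  proof -
    have "ldim i K \<le> gdim i" using ldim_mono[OF assms subgroup.subset[OF assms]] by simp
    then show "0 \<le> ldim i K / gdim i" "ldim i K / gdim i \<le> 1"
      using ldim_nonneg[OF assms, of i] by (auto simp: divide_le_eq_1)
  qed
  show "0 \<le> hdim G S K" unfolding hdim_eq[OF assms]
    using * by (intro Liminf_bounded) (auto simp: zero_ereal_def)
  show "hdim G S K \<le> 1" unfolding hdim_eq[OF assms]
    using * by (intro Liminf_le) (auto simp: one_ereal_def)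
qed

lemma gdim_top: "filterlim gdim at_top sequentially"
  using index_top by (simp add: ldim_def[abs_def] idx_def)

lemma ratio_gdim: "(\<lambda>i. real (n i) / gdim i) \<longlonglongrightarrow> 0"
  using ratio by (simp add: ldim_def[abs_def] idx_def)

lemma gdim_le: "gdim i \<le> ldim i Z + 2 * real (n i) * ln 2"
proof -
  have "idx i (carrier G) \<le> 4 ^ n i * idx i Z"
    using Mod_card_le[OF S_normal S_closed x_pow ad_y] by (simp add: idx_def carrier_FactGroup)
  then have "real (idx i (carrier G)) \<le> real (4 ^ n i * idx i Z)" by (rule of_nat_mono)
  then have "real (idx i (carrier G)) \<le> 4 ^ n i * real (idx i Z)" by simp
  moreover have "idx i (carrier G) > 0" "idx i Z > 0"
    using idx_pos[OF Z_subgroup] idx_pos[OF subgroup_self] by auto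
  ultimately have "gdim i \<le> ln (4 ^ n i * real (idx i Z))"
    unfolding ldim_def by simp
  also have "\<dots> = real (n i) * ln 4 + ldim i Z"
    using \<open>idx i Z > 0\<close> by (simp add: ldim_def ln_mult ln_realpow)
  also have "ln (4::real) = 2 * ln 2" using ln_realpow[of 2 2] by simp
  finally show ?thesis by simp
qed

text \<open>The slack \<open>2 n\<^sub>i log 2\<close> makes room for \<open>Z\<close> itself and disappears in the limit.\<close>

definition large :: "real \<Rightarrow> 'a set set" where
  "large \<eta> = {K. K \<lhd> G \<and> closedin T K \<and> K \<subseteq> Z \<and> (\<forall>i. \<eta> * gdim i - 2 * real (n i) * ln 2 \<le> ldim i K)}"

lemma Z_large:
  assumes "\<eta> \<le> 1"
  shows "Z \<in> large \<eta>"
proof -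
  have "\<eta> * gdim i \<le> gdim i" for i
    using assms ldim_nonneg[OF subgroup_self, of i] mult_right_mono[of \<eta> 1 "gdim i"] by simp
  then show ?thesis using Z_normal Z_closed gdim_le by (auto simp: large_def) (smt (verit))
qed

text \<open>At a fixed level the index is a natural number, hence minimal at some \<open>L\<close>
  in the chain, and the image of \<open>L\<close> lies in that of every member. Each coset in this
  image meets all members and so, by compactness, their intersection; no index is lost in the
  limit.\<close>

lemma large_Inter:
  assumes \<C>: "\<C> \<noteq> {}" "\<C> \<subseteq> large \<eta>" and chain: "\<And>K L. K \<in> \<C> \<Longrightarrow> L \<in> \<C> \<Longrightarrow> K \<subseteq> L \<or> L \<subseteq> K"
  shows "\<Inter>\<C> \<in> large \<eta>"
proof -
  have N: "\<Inter>\<C> \<lhd> G" using \<C> by (intro normal_Inter) (auto simp: large_def)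
  have closed: "closedin T K" and norm: "K \<lhd> G" if "K \<in> \<C>" for K
    using that \<C> by (auto simp: large_def)
  have sub: "subgroup K G" if "K \<in> \<C>" for K using norm[OF that] by (rule normal_imp_subgroup)
  have c: "closedin T (\<Inter>\<C>)" using \<C>(1) closed by (intro closedin_Inter) auto
  have "\<eta> * gdim i - 2 * real (n i) * ln 2 \<le> ldim i (\<Inter>\<C>)" for i
  proof -
    obtain K0 where "K0 \<in> \<C>" using \<C>(1) by blast
    then obtain L where L: "L \<in> \<C>" "\<And>K. K \<in> \<C> \<Longrightarrow> idx i L \<le> idx i K"
      using ex_has_least_nat[of "\<lambda>K. K \<in> \<C>" K0 "idx i"] by blast
    have *: "(#>) (S i) ` L \<subseteq> (#>) (S i) ` K" if K: "K \<in> \<C>" for K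
    proof (cases "L \<subseteq> K")
      case False
      then have "K \<subseteq> L" using chain K L(1) by blast
      then have "(#>) (S i) ` K = (#>) (S i) ` L"
        using L(2)[OF K] finite_image_Mod[OF subgroup.subset[OF sub[OF L(1)]], of i]
        by (intro card_seteq image_mono) (auto simp: idx_def)
      then show ?thesis by simp
    qed auto
    have "(#>) (S i) ` L \<subseteq> (#>) (S i) ` (\<Inter>\<C>)"
    proof
      fix w assume "w \<in> (#>) (S i) ` L"
      then obtain l where l: "l \<in> L" "w = S i #> l" by blast
      have lc: "l \<in> carrier G" using l(1) sub[OF L(1)] subgroup.mem_carrier by fast
      let ?U = "(\<lambda>K. K \<inter> (S i #> l)) ` \<C>"
      have "\<Inter>?U \<noteq> {}"
      proof (rule compact[unfolded compact_space_fip, rule_format], intro conjI ballI allI impI)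
        fix C assume "C \<in> ?U"
        then show "closedin T C" using closed closedin_rcos[OF S_closed lc] by auto
      next
        fix F assume "finite F \<and> F \<subseteq> ?U"
        then obtain D where D: "D \<subseteq> \<C>" "finite D" "F = (\<lambda>K. K \<inter> (S i #> l)) ` D"
          using finite_subset_image by metis
        show "\<Inter>F \<noteq> {}"
        proof (cases "D = {}")
          case False
          have "\<exists>K\<in>D. \<forall>K'\<in>D. K \<subseteq> K'"
            using D(2) False D(1)
          proof (induction D rule: finite_ne_induct)
            case (insert K D)
            then obtain K0 where K0: "K0 \<in> D" "\<And>K'. K' \<in> D \<Longrightarrow> K0 \<subseteq> K'" by auto
            from K0(1) insert.prems have "K \<in> \<C>" "K0 \<in> \<C>" by auto
            from chain[OF this] show ?case
            proof
              assume "K \<subseteq> K0"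
              then have "\<forall>K'\<in>insert K D. K \<subseteq> K'" using K0(2) by blast
              then show ?thesis by blast
            next
              assume "K0 \<subseteq> K"
              then have "\<forall>K'\<in>insert K D. K0 \<subseteq> K'" using K0(2) by blast
              then show ?thesis using K0(1) by blast
            qed
          qed simp
          then obtain K where K: "K \<in> D" "\<And>K'. K' \<in> D \<Longrightarrow> K \<subseteq> K'" by blast
          have "w \<in> (#>) (S i) ` K" using * K(1) D(1) l by blast
          then obtain k where k: "k \<in> K" "S i #> l = S i #> k" using l by blast
          have "k \<in> carrier G" using k(1) K(1) D(1) sub subgroup.mem_carrier by fast
          then have "k \<in> S i #> l" using k(2) rcos_self S_subgroup by metis
          then have "k \<in> \<Inter>F" unfolding D(3) using k(1) K(2) by blast
          then show ?thesis by blast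
        qed (use D in simp)
      qed
      then obtain g where g: "g \<in> \<Inter>?U" by blast
      then have "g \<in> \<Inter>\<C>" "g \<in> S i #> l" using \<C>(1) by auto
      then show "w \<in> (#>) (S i) ` (\<Inter>\<C>)"
        using repr_independence[OF _ lc S_subgroup] l(2) by (intro image_eqI[of _ _ g]) auto
    qed
    then have "idx i L \<le> idx i (\<Inter>\<C>)"
      unfolding idx_def using subgroup.subset[OF normal_imp_subgroup[OF N]]
      by (intro card_mono finite_image_Mod)
    then have "ldim i L \<le> ldim i (\<Inter>\<C>)"
      unfolding ldim_def using idx_pos[OF sub[OF L(1)], of i] by simp
    moreover have "\<eta> * gdim i - 2 * real (n i) * ln 2 \<le> ldim i L" using L(1) \<C>(2) by (auto simp: large_def)
    ultimately show ?thesis by simp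
  qed
  moreover have "\<Inter>\<C> \<subseteq> Z" using \<C> by (auto simp: large_def)
  ultimately show ?thesis using N c by (auto simp: large_def)
qed

lemma large_minimal:
  assumes "\<eta> \<le> 1"
  obtains K where "K \<in> large \<eta>" "\<And>L. L \<in> large \<eta> \<Longrightarrow> L \<subseteq> K \<Longrightarrow> L = K"
proof -
  have "\<exists>K\<in>large \<eta>. \<forall>L\<in>large \<eta>. K \<supseteq> L \<longrightarrow> L = K"
  proof (rule predicate_Zorn)
    show "partial_order_on (large \<eta>) (relation_of (\<supseteq>) (large \<eta>))"
      by (rule partial_order_on_relation_ofI) auto
    fix C assume C: "C \<in> Chains (relation_of (\<supseteq>) (large \<eta>))"
    show "\<exists>u\<in>large \<eta>. \<forall>a\<in>C. a \<supseteq> u"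
    proof (cases "C = {}")
      case True
      then show ?thesis using Z_large[OF assms] by blast
    next
      case False
      have "K \<subseteq> L \<or> L \<subseteq> K" if "K \<in> C" "L \<in> C" for K L
        using C that unfolding Chains_def relation_of_def by auto
      then have "\<Inter>C \<in> large \<eta>" using False Chains_relation_of[OF C] by (intro large_Inter) auto
      then show ?thesis by blast
    qed
  qed
  then show thesis using that by blast
qed

section \<open>Submodules, generation modulo \<open>x - 1\<close>, and subgroups of index 2\<close>

lemma ad_image_subgroup:
  assumes K: "K \<lhd> G" "K \<subseteq> Z"
  shows "subgroup (ad G x ` K) G" "ad G x ` K \<subseteq> K"
proof -
  have Ks: "subgroup K G" using K normal_imp_subgroup by blast
  show adK: "ad G x ` K \<subseteq> K" using normal_commutator_left[OF K(1) _ x_carrier] by blast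
  show "subgroup (ad G x ` K) G"
  proof (rule subgroupI)
    show "ad G x ` K \<subseteq> carrier G" using adK subgroup.subset[OF Ks] by blast
    show "ad G x ` K \<noteq> {}" using subgroup.one_closed[OF Ks] by blast
    show "inv a \<in> ad G x ` K" if "a \<in> ad G x ` K" for a
      using that adK K(2) Z.A_inv by (metis subsetD)
    show "a \<otimes> b \<in> ad G x ` K" if ab: "a \<in> ad G x ` K" "b \<in> ad G x ` K" for a b
    proof -
      obtain k l where "k \<in> K" "l \<in> K" "a = ad G x k" "b = ad G x l" using ab by blast
      moreover from this have "k \<in> Z" "l \<in> Z" using K(2) by auto
      ultimately have "a \<otimes> b = ad G x (k \<otimes> l)" "k \<otimes> l \<in> K"
        using Z.ad_mult x_carrier subgroup.m_closed[OF Ks] by auto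
      then show ?thesis by blast
    qed
  qed
qed

text \<open>\<open>x^j - 1\<close> is a multiple of \<open>x - 1\<close>; the induction peels off
  one factor \<open>x\<close> at a time.\<close>

lemma commutator_x_pow:
  assumes K: "K \<lhd> G" "K \<subseteq> Z" and k: "k \<in> K"
  shows "group_commutator G k (x [^] (j::nat)) \<in> ad G x ` K"
  using k
proof (induction j arbitrary: k)
  case 0
  then have "k \<in> carrier G" "ad G x \<one> = \<one>" using K Z_carrier x_carrier by (auto simp: group_commutator_def)
  moreover have "\<one> \<in> K" using K normal_imp_subgroup subgroup.one_closed by fast
  ultimately show ?case by (force simp: group_commutator_def)
next
  case (Suc j)
  let ?k = "inv x \<otimes> k \<otimes> x"
  have kc: "k \<in> carrier G" "k \<in> Z" using K Suc.prems Z_carrier by auto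
  have kk: "?k \<in> K" by (rule normal.inv_op_closed1[OF K(1) x_carrier Suc.prems])
  then have kZ: "?k \<in> Z" using K by blast
  have xs: "x [^] Suc j = x \<otimes> x [^] j" using x_carrier by (rule nat_pow_Suc2)
  have "group_commutator G k (x [^] Suc j) = inv k \<otimes> (inv (x [^] j) \<otimes> ?k \<otimes> x [^] j)"
    using kc x_carrier by (simp only: xs) (simp add: group_commutator_def group_norm)
  also have "\<dots> = (inv k \<otimes> ?k) \<otimes> (inv ?k \<otimes> (inv (x [^] j) \<otimes> ?k \<otimes> x [^] j))"
    using kc x_carrier by (simp add: group_norm)
  also have "inv k \<otimes> ?k = ad G x k" using kc x_carrier by (simp add: group_commutator_def group_norm)
  also have "inv ?k \<otimes> (inv (x [^] j) \<otimes> ?k \<otimes> x [^] j) = group_commutator G ?k (x [^] j)"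
    using kc x_carrier by (simp add: group_commutator_def group_norm)
  finally show ?case
    using Suc.IH[OF kk] Suc.prems subgroup.m_closed[OF ad_image_subgroup(1)[OF K]] by auto
qed

text \<open>Modulo \<open>S i\<close> the group acts on \<open>K\<close> through powers of
  \<open>x\<close>. Consequently a subgroup of \<open>K\<close> containing everything that lies in
  \<open>(x - 1) K\<close> modulo \<open>S i\<close> is normal.\<close>

lemma Mod_commutator:
  assumes K: "K \<lhd> G" "K \<subseteq> Z" and k: "k \<in> K" and g: "g \<in> carrier G"
  shows "S i #> group_commutator G k g \<in> (#>) (S i) ` ad G x ` K"
proof -
  interpret q: group_hom G "G Mod S i" "(#>) (S i)" using group_hom_FactGroup[OF S_normal] .
  obtain j :: nat and h where h: "h \<in> H" "S i #> g = S i #> (x [^] j \<otimes> h)"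
    using Mod_cyclic[OF S_normal S_closed x_pow g] by blast
  have kc: "k \<in> carrier G" "k \<in> Z" using K k Z_carrier by auto
  have hc: "h \<in> carrier G" using h H_carrier by blast
  let ?k = "inv (x [^] j) \<otimes> k \<otimes> x [^] j"
  have kZ: "?k \<in> Z" using kc x_carrier Z.A_conj by simp
  have "S i #> group_commutator G k g = S i #> group_commutator G k (x [^] j \<otimes> h)"
    using hom_commutator[OF q.group_hom_axioms kc(1)] g hc x_carrier h(2) by simp
  also have "group_commutator G k (x [^] j \<otimes> h) = inv k \<otimes> (inv h \<otimes> ?k \<otimes> h)"
    using kc hc x_carrier by (simp add: group_commutator_def group_norm)
  also have "inv h \<otimes> ?k \<otimes> h = ?k"
    using Z_central[OF kZ h(1)] hc kZ Z_carrier by (intro conj_eq_self) auto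
  also have "inv k \<otimes> ?k = group_commutator G k (x [^] j)"
    using kc x_carrier by (simp add: group_commutator_def group_norm)
  finally show ?thesis using commutator_x_pow[OF K k] by simp
qed

text \<open>Nakayama style: substituting \<open>gen\<close> into itself writes each element modulo
  \<open>S i\<close> as a product of terms \<open>(x - 1)^m f\<close> with \<open>f\<close> in
  \<open>F\<close>, one for each \<open>m < n i\<close>; the remainder
  \<open>(x - 1)^(n i) l\<close> lies in \<open>S i\<close>.\<close>

lemma idx_le_power:
  assumes K: "K \<lhd> G" "K \<subseteq> Z" and F: "finite F" "F \<subseteq> K"
    and gen: "\<And>k. k \<in> K \<Longrightarrow> \<exists>f\<in>F. \<exists>l\<in>K. S i #> k = S i #> (f \<otimes> ad G x l)"
  shows "idx i K \<le> card F ^ n i"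
proof -
  interpret q: group_hom G "G Mod S i" "(#>) (S i)" using group_hom_FactGroup[OF S_normal] .
  have Ks: "subgroup K G" using K normal_imp_subgroup by blast
  have KZ: "k \<in> K \<Longrightarrow> k \<in> Z" and Kc: "k \<in> K \<Longrightarrow> k \<in> carrier G" for k
    using K Z_carrier by auto
  have ad_K: "(ad G x ^^ m) k \<in> K" if "k \<in> K" for m k
    using that normal_commutator_left[OF K(1) _ x_carrier] by (induction m) auto
  have ex: "\<exists>W \<subseteq> K. finite W \<and> card W \<le> card F ^ m \<and>
      (\<forall>k\<in>K. \<exists>w\<in>W. \<exists>l\<in>K. S i #> k = S i #> (w \<otimes> (ad G x ^^ m) l))" for m
  proof (induction m)
    case 0
    show ?case
      by (rule exI[of _ "{\<one>}"]) (use subgroup.one_closed[OF Ks] Kc in \<open>auto intro!: bexI\<close>)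
  next
    case (Suc m)
    then obtain W where W: "W \<subseteq> K" "finite W" "card W \<le> card F ^ m"
      "\<And>k. k \<in> K \<Longrightarrow> \<exists>w\<in>W. \<exists>l\<in>K. S i #> k = S i #> (w \<otimes> (ad G x ^^ m) l)" by blast
    let ?W = "(\<lambda>(f, w). f \<otimes> ad G x w) ` (F \<times> W)"
    have "card ?W \<le> card (F \<times> W)" using F W by (intro card_image_le) auto
    also have "\<dots> \<le> card F ^ Suc m" using W by (simp add: card_cartesian_product)
    finally have "card ?W \<le> card F ^ Suc m" .
    moreover have "?W \<subseteq> K"
      using F W ad_K[of _ 1] subgroup.m_closed[OF Ks] by (auto simp: subset_iff)
    moreover have "finite ?W" using F W by simp
    moreover have "\<exists>w\<in>?W. \<exists>l\<in>K. S i #> k = S i #> (w \<otimes> (ad G x ^^ Suc m) l)" if k: "k \<in> K" for k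
    proof -
      obtain f l where fl: "f \<in> F" "l \<in> K" "S i #> k = S i #> (f \<otimes> ad G x l)" using gen[OF k] by blast
      obtain w l' where w: "w \<in> W" "l' \<in> K" "S i #> l = S i #> (w \<otimes> (ad G x ^^ m) l')"
        using W(4)[OF fl(2)] by blast
      let ?l = "(ad G x ^^ m) l'"
      have c: "f \<in> carrier G" "w \<in> Z" "?l \<in> Z" "w \<in> carrier G" "?l \<in> carrier G" "l \<in> carrier G"
        using fl w F W ad_K KZ Kc by (auto simp: subset_iff)
      have "S i #> ad G x l = ad (G Mod S i) (S i #> x) (S i #> l)"
        using hom_commutator[OF q.group_hom_axioms c(6) x_carrier] .
      also have "\<dots> = S i #> ad G x (w \<otimes> ?l)"
        unfolding w(3) using hom_commutator[OF q.group_hom_axioms _ x_carrier, of "w \<otimes> ?l"] c by simp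
      also have "ad G x (w \<otimes> ?l) = ad G x w \<otimes> ad G x ?l" using c x_carrier Z.ad_mult by blast
      finally have "S i #> (f \<otimes> ad G x l) = S i #> (f \<otimes> (ad G x w \<otimes> ad G x ?l))"
        using c x_carrier q.hom_mult by (metis commutator_closed m_closed)
      then have e: "S i #> k = S i #> ((f \<otimes> ad G x w) \<otimes> (ad G x ^^ Suc m) l')"
        using fl(3) c x_carrier by (simp add: m_assoc)
      have W: "f \<otimes> ad G x w \<in> ?W" using fl(1) w(1) by force
      show ?thesis by (intro bexI[of _ "f \<otimes> ad G x w"] bexI[of _ l'] e w(2) W)
    qed
    ultimately show ?case by (intro exI[of _ ?W] conjI ballI)
  qed
  obtain W where "W \<subseteq> K \<and> finite W \<and> card W \<le> card F ^ n i \<and>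
      (\<forall>k\<in>K. \<exists>w\<in>W. \<exists>l\<in>K. S i #> k = S i #> (w \<otimes> (ad G x ^^ n i) l))"
    using ex[of "n i"] by (elim exE)
  then have W: "W \<subseteq> K" "finite W" "card W \<le> card F ^ n i"
    "\<And>k. k \<in> K \<Longrightarrow> \<exists>w\<in>W. \<exists>l\<in>K. S i #> k = S i #> (w \<otimes> (ad G x ^^ n i) l)" by auto
  have "(#>) (S i) ` K \<subseteq> (#>) (S i) ` W"
  proof
    fix v assume "v \<in> (#>) (S i) ` K"
    then obtain w l where w: "w \<in> W" "l \<in> K" "v = S i #> (w \<otimes> (ad G x ^^ n i) l)" using W(4) by blast
    then have "v = S i #> w" using coset_mult_S[OF _ ad_Z] W Kc KZ by auto
    then show "v \<in> (#>) (S i) ` W" using w by blast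
  qed
  then have "idx i K \<le> card ((#>) (S i) ` W)" unfolding idx_def using W by (intro card_mono) auto
  also have "\<dots> \<le> card W" using W by (intro card_image_le)
  finally show ?thesis using W by simp
qed

text \<open>The cosets at all levels below \<open>j\<close> are recorded as one tuple, padded with
  \<open>{}\<close>. In effect, the intersection of \<open>K\<close> with these \<open>S i\<close>
  has finite index in \<open>K\<close>.\<close>

lemma finite_index_Int:
  assumes K: "subgroup K G"
  shows "finite ((\<lambda>k. (\<lambda>i. if i < (j::nat) then S i #> k else {})) ` K)"
proof -
  have "(\<lambda>k. (\<lambda>i. if i < j then S i #> k else {})) ` K \<subseteq>
      {f. \<forall>i. (i \<in> {..<j} \<longrightarrow> f i \<in> (\<Union>i<j. (#>) (S i) ` K)) \<and> (i \<notin> {..<j} \<longrightarrow> f i = {})}"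
    by (auto, blast)
  moreover have "finite \<dots>"
    using finite_image_Mod[OF subgroup.subset[OF K]] by (intro finite_set_of_finite_funs) auto
  ultimately show ?thesis by (rule finite_subset)
qed

lemma Mod_diff:
  assumes "f \<in> carrier G" "k \<in> carrier G" "S i #> f = S i #> k"
  shows "inv f \<otimes> k \<in> S i"
proof -
  interpret q: group_hom G "G Mod S i" "(#>) (S i)" using group_hom_FactGroup[OF S_normal] .
  have "S i #> (inv f \<otimes> k) = inv\<^bsub>G Mod S i\<^esub> (S i #> f) \<otimes>\<^bsub>G Mod S i\<^esub> (S i #> k)"
    using assms(1,2) by (simp only: q.hom_mult q.hom_inv inv_closed)
  also have "\<dots> = S i" unfolding assms(3) using q.hom_closed[OF assms(2)] q.H.l_inv one_FactGroup by metis
  finally show ?thesis using coset_eq_subgroup_iff[OF S_subgroup, of "inv f \<otimes> k" i] assms by simp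
qed

text \<open>Since \<open>K\<close> has exponent 2, a subgroup maximal among those avoiding
  \<open>u\<close> has index 2, and \<open>K = M \<union> (M #> u)\<close>. Forcing \<open>M\<close>
  to contain \<open>(x - 1) K\<close> and \<open>K \<inter> S i0\<close> makes it normal and closed.
  At a level with \<open>u \<in> S i\<close> both cosets of \<open>M\<close> have the same image, so
  the index does not change.\<close>

lemma index_two_subgroup:
  assumes K: "K \<lhd> G" "closedin T K" "K \<subseteq> Z" and u: "u \<in> K"
    and u_notin: "S i0 #> u \<notin> (#>) (S i0) ` ad G x ` K"
  obtains M where "M \<lhd> G" "closedin T M" "M \<subseteq> K" "u \<notin> M"
    "\<And>i. u \<in> S i \<Longrightarrow> idx i M = idx i K" "\<And>i. idx i K \<le> 2 * idx i M"
proof -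
  interpret q: group_hom G "G Mod S i0" "(#>) (S i0)" using group_hom_FactGroup[OF S_normal] .
  have Ks: "subgroup K G" using K normal_imp_subgroup by blast
  have KZ: "k \<in> K \<Longrightarrow> k \<in> Z" and Kc: "k \<in> K \<Longrightarrow> k \<in> carrier G" for k
    using K Z_carrier by auto
  define L where "L = K \<inter> {g \<in> carrier G. S i0 #> g \<in> (#>) (S i0) ` ad G x ` K}"
  have "subgroup ((#>) (S i0) ` ad G x ` K) (G Mod S i0)"
    using q.subgroup_img_is_subgroup[OF ad_image_subgroup(1)[OF K(1,3)]] .
  then have Ls: "subgroup L G"
    unfolding L_def by (intro subgroups_Inter_pair Ks subgroup_preimage[OF q.group_hom_axioms])
  define \<M> where "\<M> = {M. subgroup M G \<and> L \<subseteq> M \<and> M \<subseteq> K \<and> u \<notin> M}"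
  \<comment> \<open>Maximality is measured by the index modulo \<open>S i0\<close>, which is
    bounded. All members contain \<open>K \<inter> S i0\<close>, so nested members with the same
    index coincide.\<close>
  have "L \<in> \<M>" using Ls u_notin by (auto simp: \<M>_def L_def)
  moreover have "idx i0 M \<le> idx i0 K" if "M \<in> \<M>" for M
    using that subgroup.subset[OF Ks] by (intro idx_mono) (auto simp: \<M>_def)
  ultimately obtain M where M: "M \<in> \<M>" "\<And>N. N \<in> \<M> \<Longrightarrow> idx i0 N \<le> idx i0 M"
    using ex_has_greatest_nat[of "\<lambda>M. M \<in> \<M>" L "idx i0" "Suc (idx i0 K)"] by (auto simp: less_Suc_eq_le)
  have Ms: "subgroup M G" and LM: "L \<subseteq> M" and MK: "M \<subseteq> K" and uM: "u \<notin> M" using M by (auto simp: \<M>_def)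
  have KS: "K \<inter> S i0 \<subseteq> M"
  proof
    fix k assume k: "k \<in> K \<inter> S i0"
    then have "S i0 #> k = S i0 #> \<one>" using S_subgroup Kc by (simp add: coset_join2 subgroup.subset)
    moreover have "\<one> \<in> ad G x ` K" using subgroup.one_closed[OF ad_image_subgroup(1)[OF K(1,3)]] .
    ultimately have "k \<in> L" using k Kc unfolding L_def by blast
    then show "k \<in> M" using LM by blast
  qed
  have split: "k \<in> M \<or> k \<in> M #> u" if k: "k \<in> K" for k
  proof (rule ccontr)
    assume "\<not> ?thesis"
    then have kM: "k \<notin> M" "k \<notin> M #> u" by auto
    define N where "N = M \<union> (M #> k)"
    have Ns: "subgroup N G" unfolding N_def
    proof (rule subgroup_union_rcos[OF Ms Kc[OF k]])
      show "k \<otimes> k \<in> M" using Z_sq KZ[OF k] subgroup.one_closed[OF Ms] by simp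
      fix v assume v: "v \<in> M"
      then have "v \<in> Z" "v \<in> carrier G" using MK KZ Kc by auto
      moreover have "k \<otimes> v = v \<otimes> k" using Z_central KZ[OF k] \<open>v \<in> Z\<close> Z_le_H by auto
      ultimately have "inv k \<otimes> v \<otimes> k = v" using conj_eq_self[OF Kc[OF k]] by blast
      then show "inv k \<otimes> v \<otimes> k \<in> M" using v by simp
    qed
    have kN: "k \<in> N" using rcos_self[OF Kc[OF k] Ms] by (simp add: N_def)
    have NK: "N \<subseteq> K" using MK k subgroup.m_closed[OF Ks] by (auto simp: N_def r_coset_def)
    have uN: "u \<notin> N"
    proof
      assume "u \<in> N"
      then obtain m where m: "m \<in> M" "u = m \<otimes> k" using uM by (auto simp: N_def r_coset_def)
      then have "k = inv m \<otimes> u" using MK Kc k by (auto simp: mult_inv_cancel)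
      then have "k \<in> M #> u" using m subgroup.m_inv_closed[OF Ms] by (auto simp: r_coset_def)
      then show False using kM by blast
    qed
    have "N \<in> \<M>" using Ns NK uN LM by (auto simp: \<M>_def N_def)
    then have "idx i0 N \<le> idx i0 M" using M(2) by blast
    moreover have "(#>) (S i0) ` M \<subseteq> (#>) (S i0) ` N" by (auto simp: N_def)
    moreover have "finite ((#>) (S i0) ` N)" using finite_image_Mod[OF subgroup.subset[OF Ns]] .
    ultimately have "(#>) (S i0) ` M = (#>) (S i0) ` N"
      unfolding idx_def by (intro card_seteq) auto
    then obtain m where m: "m \<in> M" "S i0 #> m = S i0 #> k" using kN by (metis (no_types, lifting) imageE imageI)
    have mc: "m \<in> K" "m \<in> carrier G" using m MK Kc by auto
    have "inv m \<otimes> k \<in> K \<inter> S i0"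
      using Mod_diff[OF mc(2) Kc[OF k] m(2)] mc(1) k subgroup.m_closed[OF Ks] subgroup.m_inv_closed[OF Ks] by blast
    then have "m \<otimes> (inv m \<otimes> k) \<in> M" using KS m(1) subgroup.m_closed[OF Ms] by blast
    then show False using kM mc Kc[OF k] by (simp add: mult_inv_cancel)
  qed
  have Mn: "M \<lhd> G"
    unfolding normal_inv_iff
  proof (intro conjI ballI Ms)
    fix g m assume g: "g \<in> carrier G" and m: "m \<in> M"
    have mK: "m \<in> K" "m \<in> carrier G" using m MK Kc by auto
    have ig: "inv g \<in> carrier G" using g by simp
    have "group_commutator G m (inv g) \<in> L"
      using Mod_commutator[OF K(1,3) mK(1) ig] normal_commutator_left[OF K(1) mK(1) ig] mK g
      by (simp add: L_def)
    then have "m \<otimes> group_commutator G m (inv g) \<in> M" using LM m subgroup.m_closed[OF Ms] by blast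
    then show "g \<otimes> m \<otimes> inv g \<in> M" using conjugate_eq_commutator[OF mK(2) ig] g by simp
  qed
  have "closedin T M"
  proof -
    obtain F where F: "F \<subseteq> M" "finite F" "(#>) (S i0) ` M = (#>) (S i0) ` F"
      using finite_subset_image[OF finite_image_Mod[OF subgroup.subset[OF Ms]] subset_refl] by metis
    have KSs: "subgroup (K \<inter> S i0) G" using Ks S_subgroup by (rule subgroups_Inter_pair)
    have "M = (\<Union>f\<in>F. (K \<inter> S i0) #> f)"
    proof
      show "M \<subseteq> (\<Union>f\<in>F. (K \<inter> S i0) #> f)"
      proof
        fix m assume m: "m \<in> M"
        then obtain f where f: "f \<in> F" "S i0 #> m = S i0 #> f" using F(3) by (metis (no_types, lifting) imageE imageI)
        have c: "m \<in> K" "f \<in> K" "m \<in> carrier G" "f \<in> carrier G" using m f F MK Kc by auto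
        have "m \<in> S i0 #> f" using rcos_self[OF c(3) S_subgroup] f(2) by metis
        then have "m \<otimes> inv f \<in> S i0" using subgroup.rcos_module_imp[OF S_subgroup group_axioms c(4)] by blast
        then have "m \<otimes> inv f \<in> K \<inter> S i0"
          using c subgroup.m_closed[OF Ks] subgroup.m_inv_closed[OF Ks] by blast
        then show "m \<in> (\<Union>f\<in>F. (K \<inter> S i0) #> f)"
          using subgroup.rcos_module_rev[OF KSs group_axioms c(4,3)] f(1) by blast
      qed
      show "(\<Union>f\<in>F. (K \<inter> S i0) #> f) \<subseteq> M"
        using KS F(1) subgroup.m_closed[OF Ms] by (auto simp: r_coset_def)
    qed
    moreover have "closedin T (\<Union>f\<in>F. (K \<inter> S i0) #> f)"
      using F K(2) S_closed MK Kc by (intro closedin_Union finite_imageI) (auto intro!: closedin_rcos)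
    ultimately show ?thesis by simp
  qed
  moreover have "idx i M = idx i K" if ui: "u \<in> S i" for i
  proof -
    have "(#>) (S i) ` K = (#>) (S i) ` M"
    proof
      show "(#>) (S i) ` K \<subseteq> (#>) (S i) ` M"
      proof
        fix v assume "v \<in> (#>) (S i) ` K"
        then obtain k where k: "k \<in> K" "v = S i #> k" by blast
        from split[OF k(1)] show "v \<in> (#>) (S i) ` M"
        proof
          assume "k \<in> M #> u"
          then obtain m where m: "m \<in> M" "k = m \<otimes> u" by (auto simp: r_coset_def)
          then have "v = S i #> m" using k ui coset_mult_S MK Kc by auto
          then show ?thesis using m by blast
        qed (use k in blast)
      qed
    qed (use MK in auto)
    then show ?thesis by (simp add: idx_def)
  qed
  moreover have "idx i K \<le> 2 * idx i M" for i
  proof -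
    interpret qi: group_hom G "G Mod S i" "(#>) (S i)" using group_hom_FactGroup[OF S_normal] .
    have "(#>) (S i) ` K \<subseteq> (#>) (S i) ` M \<union> (\<lambda>C. C \<otimes>\<^bsub>G Mod S i\<^esub> (S i #> u)) ` (#>) (S i) ` M"
    proof
      fix v assume "v \<in> (#>) (S i) ` K"
      then obtain k where k: "k \<in> K" "v = S i #> k" by blast
      from split[OF k(1)] show "v \<in> (#>) (S i) ` M \<union> (\<lambda>C. C \<otimes>\<^bsub>G Mod S i\<^esub> (S i #> u)) ` (#>) (S i) ` M"
      proof
        assume "k \<in> M #> u"
        then obtain m where m: "m \<in> M" "k = m \<otimes> u" by (auto simp: r_coset_def)
        then have "v = (S i #> m) \<otimes>\<^bsub>G Mod S i\<^esub> (S i #> u)"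
          using k u MK Kc qi.hom_mult[of m u] by auto
        then show ?thesis using m by blast
      qed (use k in blast)
    qed
    moreover have fin: "finite ((#>) (S i) ` M)" using finite_image_Mod[OF subgroup.subset[OF Ms]] .
    ultimately have "idx i K \<le> card ((#>) (S i) ` M \<union> (\<lambda>C. C \<otimes>\<^bsub>G Mod S i\<^esub> (S i #> u)) ` (#>) (S i) ` M)"
      unfolding idx_def by (intro card_mono) auto
    also have "\<dots> \<le> idx i M + card ((\<lambda>C. C \<otimes>\<^bsub>G Mod S i\<^esub> (S i #> u)) ` (#>) (S i) ` M)"
      unfolding idx_def by (rule card_Un_le)
    also have "\<dots> \<le> idx i M + idx i M"
      unfolding idx_def using fin by (intro add_left_mono card_image_le)
    finally show ?thesis by simp
  qed
  ultimately show thesis using that Mn MK uM by blast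
qed

lemma minimal_hdim:
  assumes \<eta>: "0 \<le> \<eta>" and K: "K \<in> large \<eta>" and min: "\<And>L. L \<in> large \<eta> \<Longrightarrow> L \<subseteq> K \<Longrightarrow> L = K"
  shows "hdim G S K = ereal \<eta>"
proof (rule antisym)
  have Kn: "K \<lhd> G" "closedin T K" "K \<subseteq> Z" and Kl: "\<And>i. \<eta> * gdim i - 2 * real (n i) * ln 2 \<le> ldim i K"
    using K by (auto simp: large_def)
  have Ks: "subgroup K G" using Kn normal_imp_subgroup by blast
  have Kc: "k \<in> K \<Longrightarrow> k \<in> carrier G" for k using Ks subgroup.mem_carrier by fast
  have gpos: "eventually (\<lambda>i. gdim i > c) sequentially" for c
    using gdim_top by (simp add: filterlim_at_top_dense)
  show "ereal \<eta> \<le> hdim G S K"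
  proof -
    have "(\<lambda>i. \<eta> - 2 * ln 2 * (real (n i) / gdim i)) \<longlonglongrightarrow> \<eta> - 2 * ln 2 * 0"
      by (intro tendsto_intros ratio_gdim)
    then have 1: "liminf (\<lambda>i. ereal (\<eta> - 2 * ln 2 * (real (n i) / gdim i))) = ereal \<eta>"
      by (intro lim_imp_Liminf) auto
    have 2: "eventually (\<lambda>i. ereal (\<eta> - 2 * ln 2 * (real (n i) / gdim i)) \<le> ereal (ldim i K / gdim i)) sequentially"
      using gpos[of 0]
    proof eventually_elim
      case (elim i)
      then have "\<eta> - 2 * ln 2 * (real (n i) / gdim i) = (\<eta> * gdim i - 2 * real (n i) * ln 2) / gdim i"
        by (simp add: field_simps)
      also have "\<dots> \<le> ldim i K / gdim i" using Kl[of i] elim by (simp add: divide_right_mono)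
      finally show ?case by simp
    qed
    show ?thesis unfolding hdim_eq[OF Ks] using Liminf_mono[OF 2] unfolding 1 .
  qed
  show "hdim G S K \<le> ereal \<eta>"
  proof (rule ccontr)
    assume "\<not> ?thesis"
    then have "ereal \<eta> < liminf (\<lambda>i. ereal (ldim i K / gdim i))" by (simp add: hdim_eq[OF Ks])
    then obtain \<eta>' where \<eta>': "\<eta> < \<eta>'" "ereal \<eta>' < liminf (\<lambda>i. ereal (ldim i K / gdim i))"
      using ereal_dense2 by force
    have "eventually (\<lambda>i. \<eta>' < ldim i K / gdim i) sequentially"
      using less_LiminfD[OF \<eta>'(2)] by simp
    \<comment> \<open>From \<open>j0\<close> on, the loss of \<open>ln 2\<close> caused by halving
      the index keeps the dimension above \<open>\<eta> * gdim i\<close>; below \<open>j0\<close>,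
      choosing \<open>u \<in> S i\<close> leaves the dimension unchanged.\<close>
    then have "eventually (\<lambda>i. \<eta>' * gdim i < ldim i K \<and> ln 2 < (\<eta>' - \<eta>) * gdim i \<and> 0 < gdim i) sequentially"
      using gpos[of 0] gpos[of "ln 2 / (\<eta>' - \<eta>)"]
    proof eventually_elim
      case (elim i)
      then show ?case using \<eta>'(1) by (auto simp: field_simps)
    qed
    then obtain j0 where j0: "\<And>i. j0 \<le> i \<Longrightarrow> \<eta>' * gdim i < ldim i K"
      "\<And>i. j0 \<le> i \<Longrightarrow> ln 2 < (\<eta>' - \<eta>) * gdim i" by (auto simp: eventually_sequentially)
    show False
    proof (cases "\<exists>u\<in>K. (\<forall>i<j0. u \<in> S i) \<and> (\<exists>i0. S i0 #> u \<notin> (#>) (S i0) ` ad G x ` K)")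
      case True
      then obtain u i0 where u: "u \<in> K" "\<And>i. i < j0 \<Longrightarrow> u \<in> S i"
        "S i0 #> u \<notin> (#>) (S i0) ` ad G x ` K" by blast
      obtain M where M: "M \<lhd> G" "closedin T M" "M \<subseteq> K" "u \<notin> M"
        "\<And>i. u \<in> S i \<Longrightarrow> idx i M = idx i K" "\<And>i. idx i K \<le> 2 * idx i M"
        using index_two_subgroup[OF Kn u(1) u(3)] by blast
      have "\<eta> * gdim i - 2 * real (n i) * ln 2 \<le> ldim i M" for i
      proof (cases "i < j0")
        case True
        then show ?thesis using M(5)[OF u(2)] Kl[of i] by (simp add: ldim_def)
      next
        case False
        have "idx i M > 0" "idx i K > 0"
          using idx_pos[OF normal_imp_subgroup[OF M(1)]] idx_pos[OF Ks] by auto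
        moreover have "real (idx i K) \<le> 2 * real (idx i M)" using M(6)[of i] by linarith
        ultimately have "ldim i K \<le> ln (2 * real (idx i M))"
          unfolding ldim_def by (subst ln_le_cancel_iff) auto
        also have "\<dots> = ln 2 + ldim i M" using \<open>idx i M > 0\<close> by (simp add: ldim_def ln_mult)
        finally have "\<eta>' * gdim i < ln 2 + ldim i M" using j0(1)[of i] False by simp
        moreover have "ln 2 < \<eta>' * gdim i - \<eta> * gdim i"
          using j0(2)[of i] False by (simp add: left_diff_distrib)
        moreover have "0 \<le> 2 * real (n i) * ln 2" by simp
        ultimately show ?thesis by linarith
      qed
      then have "M \<in> large \<eta>" using M Kn by (auto simp: large_def)
      then have "M = K" using min M(3) by blast
      then show False using M(4) u(1) by blast
    next
      case False
      \<comment> \<open>Elements with equal \<open>\<kappa>\<close> differ by an element of all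
        \<open>S i\<close> with \<open>i < j0\<close>, which in the present case lies in
        \<open>(x - 1) K\<close> modulo every \<open>S i\<close>. Hence one finite set
        \<open>F\<close> generates at all levels, and the dimension of \<open>K\<close> is linear in
        \<open>n i\<close>, against the quadratic growth of \<open>gdim\<close>.\<close>
      define \<kappa> where "\<kappa> = (\<lambda>k i. if i < j0 then S i #> k else {})"
      have "finite (\<kappa> ` K)" unfolding \<kappa>_def using finite_index_Int[OF Ks] by simp
      then obtain F where F: "F \<subseteq> K" "finite F" "\<kappa> ` K = \<kappa> ` F"
        using finite_subset_image[of "\<kappa> ` K" \<kappa> K] by blast
      have "F \<noteq> {}" using F(3) subgroup.one_closed[OF Ks] by auto
      have bound: "idx i K \<le> card F ^ n i" for i
      proof (rule idx_le_power[OF Kn(1,3) F(2,1)])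
        fix k assume k: "k \<in> K"
        then obtain f where f: "f \<in> F" "\<kappa> k = \<kappa> f" using F(3) by (metis (no_types, lifting) imageE imageI)
        have fK: "f \<in> K" using f F by blast
        interpret q: group_hom G "G Mod S i" "(#>) (S i)" using group_hom_FactGroup[OF S_normal] .
        have "inv f \<otimes> k \<in> S j" if "j < j0" for j
        proof -
          have "S j #> f = S j #> k" using fun_cong[OF f(2), of j] that by (simp add: \<kappa>_def)
          then show ?thesis using Mod_diff Kc fK k by blast
        qed
        moreover have dK: "inv f \<otimes> k \<in> K" using fK k subgroup.m_closed[OF Ks] subgroup.m_inv_closed[OF Ks] by blast
        ultimately have "S i #> (inv f \<otimes> k) \<in> (#>) (S i) ` ad G x ` K" using False by blast
        then obtain l where l: "l \<in> K" "S i #> (inv f \<otimes> k) = S i #> ad G x l" by blast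
        have "S i #> k = S i #> (f \<otimes> (inv f \<otimes> k))" using Kc fK k by (simp add: mult_inv_cancel)
        also have "\<dots> = S i #> (f \<otimes> ad G x l)"
          using l Kc fK k dK x_carrier q.hom_mult by (metis commutator_closed)
        finally show "\<exists>f\<in>F. \<exists>l\<in>K. S i #> k = S i #> (f \<otimes> ad G x l)" using f l by blast
      qed
      have C0: "card F > 0" using F \<open>F \<noteq> {}\<close> by (simp add: card_gt_0_iff)
      have lb: "ldim i K \<le> real (n i) * ln (real (card F))" for i
      proof -
        have "real (idx i K) \<le> real (card F) ^ n i" using bound[of i] by (metis of_nat_le_iff of_nat_power)
        then have "ldim i K \<le> ln (real (card F) ^ n i)"
          unfolding ldim_def using C0 idx_pos[OF Ks, of i] by (subst ln_le_cancel_iff) auto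
        then show ?thesis using C0 by (simp add: ln_realpow)
      qed
      have lim: "(\<lambda>i. ln (real (card F)) * (real (n i) / gdim i)) \<longlonglongrightarrow> ln (real (card F)) * 0"
        by (intro tendsto_intros ratio_gdim)
      have "eventually (\<lambda>i. ln (real (card F)) * (real (n i) / gdim i) < \<eta>') sequentially"
        using \<eta> \<eta>'(1) order_tendstoD(2)[OF lim, of \<eta>'] by simp
      then have "eventually (\<lambda>i. False) sequentially"
        using gpos[of 0] eventually_ge_at_top[of j0]
      proof eventually_elim
        case (elim i)
        have "real (n i) * ln (real (card F)) < \<eta>' * gdim i"
          using elim(1,2) by (simp add: field_simps)
        then show ?case using lb[of i] j0(1)[OF elim(3)] by simp
      qed
      then show False by simp
    qed
  qed
qed

theorem full_spectrum: "normal_hspec G T S = {0..1}" "hspec G T S = {0..1}"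
proof -
  have "{0..1} \<subseteq> normal_hspec G T S"
  proof
    fix e :: ereal assume e: "e \<in> {0..1}"
    then obtain \<eta> where \<eta>: "e = ereal \<eta>" "0 \<le> \<eta>" "\<eta> \<le> 1" by (cases e) auto
    obtain K where K: "K \<in> large \<eta>" "\<And>L. L \<in> large \<eta> \<Longrightarrow> L \<subseteq> K \<Longrightarrow> L = K"
      using large_minimal[OF \<eta>(3)] by blast
    have "hdim G S K = e" using minimal_hdim[OF \<eta>(2) K] \<eta>(1) by simp
    then show "e \<in> normal_hspec G T S" using K(1) by (auto simp: normal_hspec_def large_def)
  qed
  moreover have "normal_hspec G T S \<subseteq> hspec G T S"
    using normal_imp_subgroup by (auto simp: normal_hspec_def hspec_def)
  moreover have "hspec G T S \<subseteq> {0..1}"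
    using hdim_bounds by (auto simp: hspec_def)
  ultimately show "normal_hspec G T S = {0..1}" "hspec G T S = {0..1}" by auto
qed

end


section \<open>The five filtration series\<close>

lemma (in group) subgroup_nat_pow_closed:
  "subgroup S G \<Longrightarrow> s \<in> S \<Longrightarrow> s [^] (m::nat) \<in> S"
  by (induction m) (auto simp: subgroup.one_closed subgroup.m_closed)

section \<open>Normality, closedness and powers of \<open>x\<close> for the individual
  series\<close>

context dense_tower
begin

text \<open>A closed normal subgroup containing a 2-power of \<open>x\<close> has finite index, so
  the product is a finite union of its cosets.\<close>

lemma set_mult_closed_finite_index:
  assumes A: "A \<lhd> G" "closedin T A" "x [^] (2 ^ k :: nat) \<in> A" and B: "B \<lhd> G"
  shows "closedin T (A <#> B)"
proof (rule closedin_finite_index)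
  show "subgroup A G" "closedin T A" using A normal_imp_subgroup by auto
  show sub: "subgroup (A <#> B) G" using set_mult_normal[OF A(1) B] normal_imp_subgroup by blast
  show "A \<subseteq> A <#> B"
    using A B normal_imp_subgroup subgroup.subset by (intro subset_set_mult_left) blast+
  show "finite ((#>) A ` (A <#> B))"
    using Mod_finite_generated(1)[OF A] subgroup.subset[OF sub]
    by (elim finite_subset[rotated]) (auto simp: carrier_FactGroup)
qed

text \<open>The recursion step shared by the lower, Frattini and dimension series, with
  \<open>B\<close> the commutator part. The squares alone supply the next power of
  \<open>x\<close>.\<close>

lemma normal_series_step:
  assumes A: "A \<lhd> G" "x [^] (2 ^ k :: nat) \<in> A" and B: "B \<lhd> G"
  shows "power_subgroup G T A 2 <#> B \<lhd> G" "closedin T (power_subgroup G T A 2 <#> B)"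
    "x [^] (2 ^ Suc k :: nat) \<in> power_subgroup G T A 2 <#> B"
proof -
  let ?P = "power_subgroup G T A 2"
  have P: "?P \<lhd> G" "closedin T ?P" using power_subgroup_normal[OF A(1)] power_subgroup_closed by auto
  have As: "A \<subseteq> carrier G" using A(1) normal_imp_subgroup subgroup.subset by blast
  have "(x [^] (2 ^ k :: nat)) [^] (2::nat) \<in> ?P" using power_mem_power_subgroup[OF As A(2)] .
  then have xP: "x [^] (2 ^ Suc k :: nat) \<in> ?P" using x_carrier by (simp add: nat_pow_pow mult.commute)
  show "?P <#> B \<lhd> G" using set_mult_normal P B by blast
  show "closedin T (?P <#> B)" using set_mult_closed_finite_index[OF P xP B] .
  have "?P \<subseteq> ?P <#> B"
    using P B normal_imp_subgroup subgroup.subset by (intro subset_set_mult_left) blast+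
  then show "x [^] (2 ^ Suc k :: nat) \<in> ?P <#> B" using xP by blast
qed

lemma carrier_normal: "carrier G \<lhd> G" by (rule normal_self)

lemma lower_series_props:
  "lower_series G T i \<lhd> G \<and> closedin T (lower_series G T i) \<and> x [^] (2 ^ i :: nat) \<in> lower_series G T i"
proof -
  \<comment> \<open>Terms 0 and 1 of this series coincide, so the induction runs over
    \<open>Suc i\<close>.\<close>
  have *: "lower_series G T (Suc i) \<lhd> G \<and> closedin T (lower_series G T (Suc i)) \<and>
      x [^] (2 ^ i :: nat) \<in> lower_series G T (Suc i)" for i
  proof (induction i)
    case 0
    then show ?case using carrier_normal closedin_carrier_G x_carrier by simp
  next
    case (Suc i)
    then show ?case
      using normal_series_step[of "lower_series G T (Suc i)" i] commutator_subgroup_normal carrier_normal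
      by simp
  qed
  have "x [^] (2 ^ Suc j :: nat) \<in> lower_series G T (Suc j)" for j
  proof -
    have "(x [^] (2 ^ j :: nat)) [^] (2::nat) \<in> lower_series G T (Suc j)"
      using *[of j] normal_imp_subgroup[of "lower_series G T (Suc j)" G] subgroup_nat_pow_closed by blast
    then show ?thesis using x_carrier by (simp add: nat_pow_pow mult.commute)
  qed
  then show ?thesis using * carrier_normal closedin_carrier_G x_carrier by (cases i) auto
qed

text \<open>Each commutator with \<open>x\<close> moves one term down. This yields
  \<open>n i = i\<close> for the lower series, where the powers of \<open>x\<close> alone would give
  far too large a value.\<close>

lemma ad_funpow_lower_series:
  assumes g: "g \<in> carrier G"
  shows "(ad G x ^^ i) g \<in> lower_series G T i"
proof -
  have c: "(ad G x ^^ i) g \<in> carrier G" for i using g x_carrier by (induction i) auto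
  have *: "(ad G x ^^ i) g \<in> lower_series G T (Suc i)" for i
  proof (induction i)
    case 0
    then show ?case using g by simp
  next
    case (Suc i)
    have N: "lower_series G T (Suc i) \<lhd> G" using lower_series_props by blast
    let ?L = "lower_series G T (Suc i)"
    have Lc: "?L \<subseteq> carrier G" using N normal_imp_subgroup subgroup.subset by blast
    have "ad G x ((ad G x ^^ i) g) \<in> commutator_subgroup G T ?L (carrier G)"
      using commutator_mem_commutator_subgroup[OF Lc _ Suc x_carrier] by simp
    moreover have "commutator_subgroup G T ?L (carrier G) \<subseteq> lower_series G T (Suc (Suc i))"
      using commutator_subgroup_normal[OF N carrier_normal] power_subgroup_normal[OF N, of 2]
        normal_imp_subgroup subgroup.subset
      by (simp only: lower_series.simps) (intro subset_set_mult_right; blast)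
    ultimately show ?case by auto
  qed
  show ?thesis
  proof (cases i)
    case 0
    then show ?thesis using g by simp
  next
    case (Suc j)
    have "ad G x ((ad G x ^^ j) g) \<in> lower_series G T (Suc j)"
      using *[of j] lower_series_props[of "Suc j"] x_carrier by (intro normal_commutator_left) auto
    then show ?thesis using Suc by simp
  qed
qed

lemma frattini_series_props:
  "frattini_series G T i \<lhd> G \<and> closedin T (frattini_series G T i) \<and>
    x [^] (2 ^ i :: nat) \<in> frattini_series G T i"
proof (induction i)
  case 0
  then show ?case using carrier_normal closedin_carrier_G x_carrier by simp
next
  case (Suc i)
  then show ?case
    using normal_series_step[of "frattini_series G T i" i] commutator_subgroup_normal by simp
qed

lemma two_power_series_props:
  "two_power_series G T i \<lhd> G \<and> closedin T (two_power_series G T i) \<and>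
    x [^] (2 ^ i :: nat) \<in> two_power_series G T i"
  unfolding two_power_series_def
  using power_subgroup_normal[OF carrier_normal] power_subgroup_closed
    power_mem_power_subgroup[OF subset_refl x_carrier] by blast

lemma foldr_normal:
  "(\<And>j. j \<in> set js \<Longrightarrow> C j \<lhd> G) \<Longrightarrow> foldr (\<lambda>j P. C j <#> P) js {\<one>} \<lhd> G"
  by (induction js) (auto intro: set_mult_normal one_is_normal)

lemma foldr_subset:
  "subgroup L G \<Longrightarrow> (\<And>j. j \<in> set js \<Longrightarrow> C j \<subseteq> L) \<Longrightarrow> foldr (\<lambda>j P. C j <#> P) js {\<one>} \<subseteq> L"
  by (induction js) (auto simp: subgroup.one_closed set_mult_subset)

lemma dimension_series_props:
  "dimension_series G T i \<lhd> G \<and> closedin T (dimension_series G T i) \<and>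
    (\<forall>l. i \<le> 2 ^ l \<longrightarrow> x [^] (2 ^ l :: nat) \<in> dimension_series G T i)"
proof (induction i rule: less_induct)
  case (less i)
  show ?case
  proof (cases "i < 2")
    case True
    then show ?thesis using carrier_normal closedin_carrier_G x_carrier
      by (simp add: dimension_series.simps[of G T i])
  next
    case False
    let ?m = "(i + 1) div 2"
    let ?C = "\<lambda>j. commutator_subgroup G T (dimension_series G T j) (dimension_series G T (i - j))"
    have eq: "dimension_series G T i = power_subgroup G T (dimension_series G T ?m) 2 <#>
        foldr (\<lambda>j P. ?C j <#> P) [1..<i] {\<one>}"
      using False by (subst dimension_series.simps) simp
    have B: "foldr (\<lambda>j P. ?C j <#> P) [1..<i] {\<one>} \<lhd> G"
      using less.IH by (intro foldr_normal commutator_subgroup_normal) auto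
    have m: "?m < i" using False by auto
    have A: "dimension_series G T ?m \<lhd> G" using less.IH[OF m] by blast
    have xp: "x [^] (2 ^ l :: nat) \<in> dimension_series G T ?m" if "?m \<le> 2 ^ l" for l
      using less.IH[OF m] that by blast
    have "?m \<le> 2 ^ i" using less_exp[of i] by linarith
    note step = normal_series_step[OF A xp B]
    show ?thesis
    proof (intro conjI allI impI)
      show "dimension_series G T i \<lhd> G" "closedin T (dimension_series G T i)"
        unfolding eq using step[OF \<open>?m \<le> 2 ^ i\<close>] by blast+
      fix l assume l: "i \<le> 2 ^ l"
      then obtain l' where l': "l = Suc l'" using False by (cases l) auto
      then have "?m \<le> 2 ^ l'" using l by auto
      then show "x [^] (2 ^ l :: nat) \<in> dimension_series G T i" unfolding eq l' using step(3) by blast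
    qed
  qed
qed

text \<open>On \<open>Z\<close> and on \<open>H/Z\<close> the operator \<open>(x - 1)^(2^l)\<close>
  is the commutator with \<open>x^(2^l)\<close>, an element of \<open>S\<close>. For
  \<open>y\<close> this determines the iterated commutator only up to a factor from
  \<open>Z\<close>.\<close>

lemma two_power_conditions:
  assumes S: "S \<lhd> G" and x: "x [^] (2 ^ l :: nat) \<in> S"
  shows "z \<in> Z \<Longrightarrow> (ad G x ^^ (2 ^ l)) z \<in> S"
    "S #> (ad G x ^^ (2 ^ l)) y \<in> (#>) S ` Z"
    "x [^] (2 ^ (2 ^ l) :: nat) \<in> S"
proof -
  have Ss: "subgroup S G" using S normal_imp_subgroup by blast
  show "(ad G x ^^ (2 ^ l)) z \<in> S" if "z \<in> Z"
    using that normal_commutator_right[OF S _ x] Z_carrier by (simp add: Z.ad_two_power x_carrier)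
  show "x [^] (2 ^ (2 ^ l) :: nat) \<in> S"
  proof -
    have "l \<le> 2 ^ l" using less_exp[of l] by simp
    then have "(2::nat) ^ (2 ^ l) = 2 ^ l * 2 ^ (2 ^ l - l)" by (simp flip: power_add)
    then have "x [^] (2 ^ (2 ^ l) :: nat) = (x [^] (2 ^ l :: nat)) [^] (2 ^ (2 ^ l - l) :: nat)"
      using x_carrier by (simp add: nat_pow_pow)
    then show ?thesis using subgroup_nat_pow_closed[OF Ss x] by simp
  qed
  show "S #> (ad G x ^^ (2 ^ l)) y \<in> (#>) S ` Z"
  proof -
    interpret q: group_hom G "G Mod Z" "(#>) Z" using group_hom_FactGroup[OF Z_normal] .
    interpret A: elementary_abelian_normal "G Mod Z" "(#>) Z ` H" by (rule Z_Mod_elementary_abelian)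
    define c where "c = group_commutator G y (x [^] (2 ^ l :: nat))"
    define d where "d = (ad G x ^^ (2 ^ l)) y"
    have cS: "c \<in> S" unfolding c_def using normal_commutator_right[OF S y_carrier x] .
    have cc: "c \<in> carrier G" using cS subgroup.mem_carrier[OF Ss] by blast
    have dc: "d \<in> carrier G" unfolding d_def using hom_ad_funpow[OF q.group_hom_axioms y_carrier x_carrier] by blast
    have "Z #> d = (ad (G Mod Z) (Z #> x) ^^ (2 ^ l)) (Z #> y)"
      unfolding d_def using hom_ad_funpow[OF q.group_hom_axioms y_carrier x_carrier] by blast
    also have "\<dots> = ad (G Mod Z) ((Z #> x) [^]\<^bsub>G Mod Z\<^esub> (2 ^ l :: nat)) (Z #> y)"
      using y_H q.hom_closed[OF x_carrier] by (intro A.ad_two_power) auto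
    also have "\<dots> = Z #> c"
      using hom_commutator[OF q.group_hom_axioms y_carrier] x_carrier by (simp add: c_def q.hom_nat_pow)
    finally have "d \<in> Z #> c" using rcos_self[OF dc Z_subgroup] by metis
    then obtain z where z: "z \<in> Z" "d = z \<otimes> c" by (auto simp: r_coset_def)
    interpret s: group_hom G "G Mod S" "(#>) S" using group_hom_FactGroup[OF S] .
    have "S #> d = (S #> z) \<otimes>\<^bsub>G Mod S\<^esub> (S #> c)"
      unfolding z(2) by (rule s.hom_mult[OF Z_carrier[OF z(1)] cc])
    also have "S #> c = \<one>\<^bsub>G Mod S\<^esub>" using cS cc Ss by (simp add: coset_join2)
    also have "(S #> z) \<otimes>\<^bsub>G Mod S\<^esub> \<one>\<^bsub>G Mod S\<^esub> = S #> z"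
      by (rule s.H.r_one[OF s.hom_closed[OF Z_carrier[OF z(1)]]])
    finally show ?thesis using z unfolding d_def by blast
  qed
qed

end

text \<open>The exponent in \<open>M_index\<close> is the number of unordered pairs among
  \<open>2 ^ k\<close> conjugates of \<open>y\<close>.\<close>

locale graded_tower = dense_tower G T x H Z y
  for G :: "'a monoid" (structure) and T x H Z y +
  fixes M :: "nat \<Rightarrow> 'a set"
  assumes M_0: "M 0 = carrier G"
    and M_normal: "M k \<lhd> G" and M_closed: "closedin T (M k)"
    and M_x: "x [^] (2 ^ k :: nat) \<in> M k"
    and M_index: "1 \<le> k \<Longrightarrow> 2 ^ (2 ^ k * (2 ^ k - 1) div 2) \<le> card ((#>) (M k) ` carrier G)"
begin

lemma obtain_N_series:
  obtains E :: "nat \<Rightarrow> 'a set" where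
    "\<And>i. subgroup (E i) G" "\<And>i. closedin T (E i)" "E 1 = carrier G" "\<And>i j. i \<le> j \<Longrightarrow> E j \<subseteq> E i"
    "\<And>i g. 1 \<le> i \<Longrightarrow> g \<in> E i \<Longrightarrow> g \<otimes> g \<in> E (2 * i)"
    "\<And>i j g h. 1 \<le> i \<Longrightarrow> 1 \<le> j \<Longrightarrow> g \<in> E i \<Longrightarrow> h \<in> E j \<Longrightarrow> group_commutator G g h \<in> E (i + j)"
    "E (4 * 2 ^ k) \<subseteq> M k"
proof -
  interpret q: group_hom G "G Mod M k" "(#>) (M k)" using group_hom_FactGroup[OF M_normal] .
  interpret Q: tower "G Mod M k" "M k #> x" "(#>) (M k) ` H" "(#>) (M k) ` Z"
    using tower_Mod[OF M_normal] .
  have Ms: "subgroup (M k) G" using M_normal normal_imp_subgroup by blast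
  have 1: "(M k #> x) [^]\<^bsub>G Mod M k\<^esub> (2 ^ k :: nat) = \<one>\<^bsub>G Mod M k\<^esub>"
    using M_x x_carrier Ms by (simp add: q.hom_nat_pow[symmetric] coset_join2)
  have 2: "\<exists>j::nat. \<exists>h\<in>(#>) (M k) ` H. g = (M k #> x) [^]\<^bsub>G Mod M k\<^esub> j \<otimes>\<^bsub>G Mod M k\<^esub> h"
    if g: "g \<in> carrier (G Mod M k)" for g
  proof -
    obtain g' where g': "g' \<in> carrier G" "g = M k #> g'" using g by (auto simp: carrier_FactGroup)
    then obtain j :: nat and h where h: "h \<in> H" "M k #> g' = M k #> (x [^] j \<otimes> h)"
      using Mod_cyclic[OF M_normal M_closed M_x] by blast
    then have "g = (M k #> x) [^]\<^bsub>G Mod M k\<^esub> j \<otimes>\<^bsub>G Mod M k\<^esub> (M k #> h)"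
      using g' x_carrier H_carrier by (simp only: q.hom_mult q.hom_nat_pow nat_pow_closed)
    then show ?thesis using h by blast
  qed
  obtain E :: "nat \<Rightarrow> 'a set set" where E: "\<And>i. subgroup (E i) (G Mod M k)" "E 1 = carrier (G Mod M k)" "\<And>i j. i \<le> j \<Longrightarrow> E j \<subseteq> E i"
    "\<And>i g. 1 \<le> i \<Longrightarrow> g \<in> E i \<Longrightarrow> g \<otimes>\<^bsub>G Mod M k\<^esub> g \<in> E (2 * i)"
    "\<And>i j g h. 1 \<le> i \<Longrightarrow> 1 \<le> j \<Longrightarrow> g \<in> E i \<Longrightarrow> h \<in> E j \<Longrightarrow> group_commutator (G Mod M k) g h \<in> E (i + j)"
    "E (4 * 2 ^ k) = {\<one>\<^bsub>G Mod M k\<^esub>}"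
    using Q.exists_N_series[OF 1 2] by metis
  define D where "D i = {g \<in> carrier G. M k #> g \<in> E i}" for i
  have Ds: "subgroup (D i) G" for i unfolding D_def by (rule subgroup_preimage[OF q.group_hom_axioms E(1)])
  show thesis
  proof (rule that[of D])
    show "subgroup (D i) G" for i by (rule Ds)
    show "closedin T (D i)" for i
    proof (rule closedin_finite_index[OF Ms M_closed Ds])
      show "M k \<subseteq> D i"
        using subgroup.mem_carrier[OF Ms] subgroup.one_closed[OF E(1)] coset_join2[OF _ Ms]
        by (auto simp: D_def)
      show "finite ((#>) (M k) ` D i)"
        by (rule finite_subset[OF _ Mod_finite_generated(1)[OF M_normal M_closed M_x]])
          (auto simp: D_def carrier_FactGroup)
    qed
    show "D 1 = carrier G"
    proof
      show "carrier G \<subseteq> D 1" unfolding D_def E(2) using q.hom_closed by blast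
    qed (auto simp: D_def)
    show "D j \<subseteq> D i" if "i \<le> j" for i j using E(3)[OF that] by (auto simp: D_def)
    show "g \<otimes> g \<in> D (2 * i)" if "1 \<le> i" "g \<in> D i" for i g
      using E(4)[of i "M k #> g"] that q.hom_mult by (auto simp: D_def simp del: mult_FactGroup)
    show "group_commutator G g h \<in> D (i + j)" if "1 \<le> i" "1 \<le> j" "g \<in> D i" "h \<in> D j" for i j g h
      using E(5)[of i j "M k #> g" "M k #> h"] that hom_commutator[OF q.group_hom_axioms]
      by (auto simp: D_def)
    show "D (4 * 2 ^ k) \<subseteq> M k"
      using E(6) coset_eq_subgroup_iff[OF Ms] by (auto simp: D_def)
  qed
qed

text \<open>Each series is compared with the weight filtration of \<open>G/M k\<close>, pulled back
  to \<open>G\<close>: term \<open>i\<close> of the lower and dimension series lies in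
  \<open>E i\<close>, that of the Frattini and 2-power series in \<open>E (2 ^ i)\<close>. Weight
  \<open>4 * 2 ^ k = 2 ^ (k + 2)\<close> is inside \<open>M k\<close>.\<close>

lemma series_le_M:
  shows "i \<ge> 4 * 2 ^ k \<Longrightarrow> lower_series G T i \<subseteq> M k"
    "i \<ge> 4 * 2 ^ k \<Longrightarrow> dimension_series G T i \<subseteq> M k"
    "frattini_series G T (k + 2) \<subseteq> M k"
    "two_power_series G T (k + 2) \<subseteq> M k"
proof -
  obtain E :: "nat \<Rightarrow> 'a set" where E: "\<And>i. subgroup (E i) G" "\<And>i. closedin T (E i)"
    "E 1 = carrier G" "\<And>i j. i \<le> j \<Longrightarrow> E j \<subseteq> E i"
    "\<And>i g. 1 \<le> i \<Longrightarrow> g \<in> E i \<Longrightarrow> g \<otimes> g \<in> E (2 * i)"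
    "\<And>i j g h. 1 \<le> i \<Longrightarrow> 1 \<le> j \<Longrightarrow> g \<in> E i \<Longrightarrow> h \<in> E j \<Longrightarrow> group_commutator G g h \<in> E (i + j)"
    "E (4 * 2 ^ k) \<subseteq> M k"
    using obtain_N_series[of k] by metis
  have Ec: "g \<in> E i \<Longrightarrow> g \<in> carrier G" for g i using subgroup.mem_carrier[OF E(1)] .
  have sq: "power_subgroup G T K 2 \<subseteq> E j" if "K \<subseteq> E i" "1 \<le> i" "j \<le> 2 * i" for K i j
  proof (rule power_subgroup_minimal[OF E(1,2)])
    fix g assume "g \<in> K"
    then have "g \<in> E i" using that by blast
    then show "g [^] (2::nat) \<in> E j" using E(5)[OF that(2)] E(4)[OF that(3)] Ec
      by (auto simp: numeral_2_eq_2)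
  qed
  have comm: "commutator_subgroup G T K L \<subseteq> E m"
    if "K \<subseteq> E i" "L \<subseteq> E j" "1 \<le> i" "1 \<le> j" "m \<le> i + j" for K L i j m
    using E(6)[OF that(3,4)] E(4)[OF that(5)] that(1,2)
    by (intro commutator_subgroup_minimal E(1,2)) blast
  have L: "lower_series G T (Suc i) \<subseteq> E (Suc i)" for i
  proof (induction i)
    case 0
    then show ?case using E(3) by simp
  next
    case (Suc i)
    show ?case unfolding lower_series.simps
      using E(3) by (intro set_mult_subset[OF E(1)] sq[OF Suc] comm[OF Suc, of _ 1]) auto
  qed
  show "lower_series G T i \<subseteq> M k" if "i \<ge> 4 * 2 ^ k"
  proof -
    have "0 < i" using that by (metis gr0I le_zero_eq mult_eq_0_iff power_not_zero zero_neq_numeral)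
    then show ?thesis using L[of "i - 1"] E(4)[OF that] E(7) by simp
  qed
  have D: "1 \<le> i \<Longrightarrow> dimension_series G T i \<subseteq> E i" for i
  proof (induction i rule: less_induct)
    case (less i)
    show ?case
    proof (cases "i < 2")
      case True
      then have "i = 1" using less by simp
      then show ?thesis using E(3) dimension_series.simps[of G T i] by simp
    next
      case False
      let ?m = "(i + 1) div 2"
      have m: "?m < i" "1 \<le> ?m" "i \<le> 2 * ?m" using False by auto
      have "power_subgroup G T (dimension_series G T ?m) 2 \<subseteq> E i"
        using less.IH[OF m(1,2)] m by (intro sq)
      moreover have "foldr (\<lambda>j P. commutator_subgroup G T (dimension_series G T j)
          (dimension_series G T (i - j)) <#> P) [1..<i] {\<one>} \<subseteq> E i"
      proof (rule foldr_subset[OF E(1)])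
        fix j assume "j \<in> set [1..<i]"
        then have j: "1 \<le> j" "j < i" "1 \<le> i - j" "i - j < i" "i \<le> j + (i - j)" by auto
        show "commutator_subgroup G T (dimension_series G T j) (dimension_series G T (i - j)) \<subseteq> E i"
          using comm[OF less.IH[OF j(2,1)] less.IH[OF j(4,3)] j(1,3,5)] .
      qed
      ultimately show ?thesis
        using False set_mult_subset[OF E(1)] by (subst dimension_series.simps) simp
    qed
  qed
  show "dimension_series G T i \<subseteq> M k" if "i \<ge> 4 * 2 ^ k"
  proof -
    have "1 \<le> i" using that by (metis gr0I le_zero_eq mult_eq_0_iff power_not_zero zero_neq_numeral One_nat_def Suc_leI)
    then show ?thesis using D[of i] E(4)[OF that] E(7) by blast
  qed
  have F: "frattini_series G T i \<subseteq> E (2 ^ i)" for i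
  proof (induction i)
    case 0
    then show ?case using E(3) by simp
  next
    case (Suc i)
    have "1 \<le> (2::nat) ^ i" by simp
    with Suc show ?case
      by (simp only: frattini_series.simps) (intro set_mult_subset E(1) sq[OF Suc] comm[OF Suc Suc]; simp)
  qed
  have four: "(2::nat) ^ (k + 2) = 4 * 2 ^ k" by (simp add: power_add)
  show "frattini_series G T (k + 2) \<subseteq> M k" using F[of "k + 2"] E(7) unfolding four by blast
  have P: "g [^] (2 ^ i :: nat) \<in> E (2 ^ i)" if g: "g \<in> carrier G" for g i
  proof (induction i)
    case 0
    then show ?case using E(3) g by simp
  next
    case (Suc i)
    have "g [^] (2 ^ Suc i :: nat) = g [^] (2 ^ i :: nat) \<otimes> g [^] (2 ^ i :: nat)"
      using g by (simp add: nat_pow_mult mult_2)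
    then show ?case using E(5)[OF _ Suc] by simp
  qed
  have "two_power_series G T i \<subseteq> E (2 ^ i)" for i
    unfolding two_power_series_def using P by (intro power_subgroup_minimal E(1,2))
  from this[of "k + 2"] show "two_power_series G T (k + 2) \<subseteq> M k" using E(7) unfolding four by blast
qed

text \<open>The factor 16 is dictated by the dimension series, where \<open>n i\<close> may be
  \<open>2 * i\<close> and \<open>i\<close> may come close to \<open>8 * 2 ^ k\<close>. The
  quadratic lower bound on the logarithmic index then settles both limit conditions.\<close>

lemma filtered_towerI:
  assumes S: "\<And>i. S i \<lhd> G" "\<And>i. closedin T (S i)"
    and ad: "\<And>i z. z \<in> Z \<Longrightarrow> (ad G x ^^ n i) z \<in> S i"
      "\<And>i. S i #> (ad G x ^^ n i) y \<in> (#>) (S i) ` Z"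
    and xp: "\<And>i. x [^] (2 ^ n i :: nat) \<in> S i"
    and n: "filterlim n at_top sequentially"
    and le: "eventually (\<lambda>i. \<exists>k\<ge>1. S i \<subseteq> M k \<and> n i \<le> 16 * 2 ^ k) sequentially"
  shows "filtered_tower G T x H Z y S n"
proof -
  define g where "g i = ln (real (card ((#>) (S i) ` carrier G)))" for i
  \<comment> \<open>With \<open>2 ^ k = 2 * m\<close> the exponent in \<open>M_index\<close> is
    \<open>m * (2 * m - 1)\<close>, at least \<open>m * m\<close>, while
    \<open>n i \<le> 32 * m\<close>; the denominator is \<open>32 * 32\<close>.\<close>
  define c :: real where "c = ln 2 / 1024"
  have c: "c > 0" by (simp add: c_def)
  have bound: "eventually (\<lambda>i. c * real (n i) * real (n i) \<le> g i) sequentially"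
    using le
  proof eventually_elim
    case (elim i)
    then obtain k where k: "k \<ge> 1" "S i \<subseteq> M k" "n i \<le> 16 * 2 ^ k" by blast
    have Ss: "subgroup (S i) G" using S(1) normal_imp_subgroup by blast
    have Ms: "subgroup (M k) G" using M_normal normal_imp_subgroup by blast
    have fin: "finite ((#>) (S i) ` carrier G)"
      using Mod_finite_generated(1)[OF S xp] by (simp add: carrier_FactGroup)
    have MS: "M k <#> S i = M k"
    proof
      show "M k <#> S i \<subseteq> M k" using k(2) by (intro set_mult_subset Ms) auto
      show "M k \<subseteq> M k <#> S i" using subset_set_mult_left[OF subgroup.subset[OF Ms] Ss] .
    qed
    have "(#>) (M k) ` carrier G = (\<lambda>C. M k <#> C) ` (#>) (S i) ` carrier G"
      unfolding image_image
      using setmult_rcos_assoc[OF subgroup.subset[OF Ms] subgroup.subset[OF Ss]] MS by (intro image_cong) auto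
    then have "card ((#>) (M k) ` carrier G) \<le> card ((#>) (S i) ` carrier G)"
      using card_image_le[OF fin] by simp
    then have "2 ^ (2 ^ k * (2 ^ k - 1) div 2) \<le> card ((#>) (S i) ` carrier G)"
      using M_index[OF k(1)] by linarith
    then have "(2::real) ^ (2 ^ k * (2 ^ k - 1) div 2) \<le> real (card ((#>) (S i) ` carrier G))"
      by (metis of_nat_le_iff of_nat_numeral of_nat_power)
    then have "ln ((2::real) ^ (2 ^ k * (2 ^ k - 1) div 2)) \<le> g i"
      unfolding g_def by (subst ln_le_cancel_iff) (auto intro: less_le_trans[rotated])
    then have 1: "real (2 ^ k * (2 ^ k - 1) div 2) * ln 2 \<le> g i" by (simp add: ln_realpow)
    obtain m where m: "(2::nat) ^ k = 2 * m" "m \<ge> 1" using k(1) by (cases k) auto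
    have "(2::nat) ^ k * (2 ^ k - 1) div 2 = m * (2 * m - 1)" unfolding m by simp
    moreover have "m * m \<le> m * (2 * m - 1)" using m(2) by (intro mult_left_mono) auto
    ultimately have "m * m \<le> 2 ^ k * (2 ^ k - 1) div 2" by simp
    then have "real (m * m) \<le> real (2 ^ k * (2 ^ k - 1) div 2)" by (rule of_nat_mono)
    then have "real (m * m) * ln 2 \<le> real (2 ^ k * (2 ^ k - 1) div 2) * ln 2"
      by (rule mult_right_mono) simp
    then have 2: "real (m * m) * ln 2 \<le> g i" using 1 by linarith
    have "n i \<le> 32 * m" using k(3) m by simp
    then have "n i * n i \<le> (32 * m) * (32 * m)" by (intro mult_mono) auto
    then have "real (n i * n i) \<le> real ((32 * m) * (32 * m))" by (rule of_nat_mono)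
    then have "real (n i) * real (n i) \<le> 1024 * real (m * m)" by simp
    then have "c * (real (n i) * real (n i)) \<le> c * (1024 * real (m * m))"
      using c by (intro mult_left_mono) auto
    also have "\<dots> = real (m * m) * ln 2" by (simp add: c_def)
    finally show ?case using 2 by (simp add: mult.assoc)
  qed
  have nr: "filterlim (\<lambda>i. real (n i)) at_top sequentially"
    using filterlim_compose[OF filterlim_real_sequentially n] .
  have pos: "eventually (\<lambda>i. n i \<ge> 1) sequentially" using n by (simp add: filterlim_at_top)
  have cn: "filterlim (\<lambda>i. c * real (n i)) at_top sequentially"
    using c nr by (intro filterlim_tendsto_pos_mult_at_top[OF tendsto_const])
  have top: "filterlim g at_top sequentially"
  proof (rule filterlim_at_top_mono[OF cn])
    show "eventually (\<lambda>i. c * real (n i) \<le> g i) sequentially"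
      using bound pos
    proof eventually_elim
      case (elim i)
      have "c * real (n i) * 1 \<le> c * real (n i) * real (n i)"
        using elim(2) c by (intro mult_left_mono) auto
      then show ?case using elim(1) by simp
    qed
  qed
  have "(\<lambda>i. real (n i) / g i) \<longlonglongrightarrow> 0"
  proof (rule tendsto_sandwich[of "\<lambda>_. 0" _ _ "\<lambda>i. inverse (c * real (n i))"])
    show "(\<lambda>i. inverse (c * real (n i))) \<longlonglongrightarrow> 0" using cn by (rule tendsto_inverse_0_at_top)
    show "eventually (\<lambda>i. 0 \<le> real (n i) / g i) sequentially"
      using bound
    proof eventually_elim
      case (elim i)
      have "0 \<le> c * real (n i) * real (n i)" using c by simp
      then show ?case using elim by simp
    qed
    show "eventually (\<lambda>i. real (n i) / g i \<le> inverse (c * real (n i))) sequentially"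
      using bound pos
    proof eventually_elim
      case (elim i)
      have "0 < c * real (n i) * real (n i)" using c elim by simp
      then have "real (n i) / g i \<le> real (n i) / (c * real (n i) * real (n i))"
        using elim by (intro divide_left_mono) auto
      also have "\<dots> = inverse (c * real (n i))" using elim(2) c by (simp add: field_simps)
      finally show ?case .
    qed
  qed simp
  then show ?thesis
    using S ad xp top unfolding g_def
    by (intro filtered_tower.intro filtered_tower_axioms.intro dense_tower_axioms) auto
qed

lemma filtered_tower_two_power:
  assumes S: "\<And>i. S i \<lhd> G" "\<And>i. closedin T (S i)" and x: "\<And>i. x [^] (2 ^ l i :: nat) \<in> S i"
    and l: "filterlim (\<lambda>i. (2::nat) ^ l i) at_top sequentially"
    and le: "eventually (\<lambda>i. \<exists>k\<ge>1. S i \<subseteq> M k \<and> 2 ^ l i \<le> 16 * (2::nat) ^ k) sequentially"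
  shows "filtered_tower G T x H Z y S (\<lambda>i. 2 ^ l i)"
  using two_power_conditions[OF S(1) x] by (intro filtered_towerI S l le) auto

lemma two_power_at_top: "filterlim (\<lambda>i. (2::nat) ^ i) at_top sequentially"
  by (rule filterlim_at_top_mono[OF filterlim_ident]) (auto intro: always_eventually less_imp_le)

lemma ex_two_power_between:
  assumes "8 \<le> i"
  obtains k where "1 \<le> k" "4 * 2 ^ k \<le> i" "i < 8 * (2::nat) ^ k"
proof -
  have "1 \<le> i div 4" using assms by presburger
  then obtain k where k: "2 ^ k \<le> i div 4" "i div 4 < 2 ^ (k + 1)"
    using ex_power_ivl1[of 2 "i div 4"] by auto
  have "k \<noteq> 0"
  proof
    assume "k = 0"
    then show False using k assms by simp
  qed
  then show thesis using k by (intro that[of k]) auto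
qed

theorem all_series:
  assumes "S \<in> {M, lower_series G T, dimension_series G T, two_power_series G T, frattini_series G T}"
  shows "normal_hspec G T S = {0..1}" "hspec G T S = {0..1}"
proof -
  have "\<exists>n. filtered_tower G T x H Z y S n"
  proof -
    have evk: "eventually (\<lambda>i. \<exists>k\<ge>1. S i \<subseteq> M k \<and> 2 ^ i \<le> 16 * (2::nat) ^ k) sequentially"
      if "\<And>k. S (k + 2) \<subseteq> M k"
    proof (rule eventually_mono[OF eventually_ge_at_top[of 3]])
      fix i :: nat assume i: "3 \<le> i"
      define j where "j = i - 2"
      have j: "i = j + 2" "1 \<le> j" using i by (auto simp: j_def)
      have "S i \<subseteq> M j" unfolding j(1) by (rule that)
      moreover have "(2::nat) ^ i \<le> 16 * 2 ^ j" unfolding j(1) by (simp add: power_add)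
      ultimately show "\<exists>k\<ge>1. S i \<subseteq> M k \<and> 2 ^ i \<le> 16 * (2::nat) ^ k" using j(2) by blast
    qed
    from assms consider "S = M" | "S = lower_series G T" | "S = dimension_series G T"
      | "S = two_power_series G T" | "S = frattini_series G T" by blast
    then show ?thesis
    proof cases
      case 1
      have "eventually (\<lambda>i. \<exists>k\<ge>1. S i \<subseteq> M k \<and> 2 ^ i \<le> 16 * (2::nat) ^ k) sequentially"
        using 1 by (intro eventually_mono[OF eventually_ge_at_top[of 1]]) auto
      then have "filtered_tower G T x H Z y S (\<lambda>i. 2 ^ i)"
        using 1 M_normal M_closed M_x two_power_at_top
        by (intro filtered_tower_two_power[where l = "\<lambda>i. i"]) auto
      then show ?thesis by blast
    next
      case 2
      \<comment> \<open>Here \<open>n i = 2 ^ i\<close> would break the bound by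
        \<open>16 * 2 ^ k\<close>, since \<open>M k\<close> is only known to contain the terms from
        \<open>4 * 2 ^ k\<close> on; the iterated commutators allow \<open>n i = i\<close>.\<close>
      have "filtered_tower G T x H Z y S (\<lambda>i. i)"
      proof (rule filtered_towerI)
        show "S i \<lhd> G" "closedin T (S i)" "x [^] (2 ^ i :: nat) \<in> S i" for i
          using lower_series_props 2 by auto
        show "(ad G x ^^ i) z \<in> S i" if "z \<in> Z" for i z
          using ad_funpow_lower_series Z_carrier that 2 by auto
        show "S i #> (ad G x ^^ i) y \<in> (#>) (S i) ` Z" for i
        proof -
          have Ss: "subgroup (S i) G" using lower_series_props 2 normal_imp_subgroup by blast
          have "(ad G x ^^ i) y \<in> S i" using ad_funpow_lower_series y_carrier 2 by auto
          then have "S i #> (ad G x ^^ i) y = S i #> \<one>"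
            using Ss subgroup.mem_carrier[OF Ss] by (simp add: coset_join2 subgroup.subset)
          then show ?thesis using subgroup.one_closed[OF Z_subgroup] by blast
        qed
        show "eventually (\<lambda>i. \<exists>k\<ge>1. S i \<subseteq> M k \<and> i \<le> 16 * 2 ^ k) sequentially"
        proof (rule eventually_mono[OF eventually_ge_at_top[of 8]])
          fix i :: nat assume "8 \<le> i"
          then obtain k where "1 \<le> k" "4 * 2 ^ k \<le> i" "i < 8 * (2::nat) ^ k" using ex_two_power_between by blast
          then show "\<exists>k\<ge>1. S i \<subseteq> M k \<and> i \<le> 16 * 2 ^ k"
            using series_le_M(1) 2 by (intro exI[of _ k]) auto
        qed
      qed (rule filterlim_ident)
      then show ?thesis by blast
    next
      case 3
      \<comment> \<open>Term \<open>i\<close> of the dimension series contains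
        \<open>x^(2^l)\<close> whenever \<open>i \<le> 2 ^ l\<close>; the least such
        \<open>l\<close> rounds \<open>i\<close> up to a power of 2 that is at most
        \<open>2 * i\<close>.\<close>
      define l where "l i = (LEAST l. i \<le> (2::nat) ^ l)" for i
      have l: "i \<le> 2 ^ l i" for i
        unfolding l_def by (rule LeastI[of _ i]) (simp add: less_imp_le)
      have l2: "2 ^ l i \<le> 2 * i" if "1 \<le> i" for i
      proof (cases "l i")
        case (Suc m)
        then have "\<not> i \<le> 2 ^ m" using not_less_Least[of m "\<lambda>l. i \<le> (2::nat) ^ l"] by (simp add: l_def)
        then show ?thesis using Suc by simp
      qed (use that in simp)
      have "filtered_tower G T x H Z y S (\<lambda>i. 2 ^ l i)"
      proof (rule filtered_tower_two_power)
        show "S i \<lhd> G" "closedin T (S i)" "x [^] (2 ^ l i :: nat) \<in> S i" for i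
          using dimension_series_props l 3 by auto
        show "filterlim (\<lambda>i. (2::nat) ^ l i) at_top sequentially"
          by (rule filterlim_at_top_mono[OF filterlim_ident]) (simp add: l)
        show "eventually (\<lambda>i. \<exists>k\<ge>1. S i \<subseteq> M k \<and> 2 ^ l i \<le> 16 * (2::nat) ^ k) sequentially"
        proof (rule eventually_mono[OF eventually_ge_at_top[of 8]])
          fix i :: nat assume i: "8 \<le> i"
          then obtain k where "1 \<le> k" "4 * 2 ^ k \<le> i" "i < 8 * (2::nat) ^ k" using ex_two_power_between by blast
          moreover have "2 ^ l i \<le> 2 * i" using l2 i by simp
          ultimately show "\<exists>k\<ge>1. S i \<subseteq> M k \<and> 2 ^ l i \<le> 16 * (2::nat) ^ k"
            using series_le_M(2) 3 by (intro exI[of _ k]) auto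
        qed
      qed
      then show ?thesis by blast
    next
      case 4
      have "filtered_tower G T x H Z y S (\<lambda>i. 2 ^ i)"
        using two_power_series_props series_le_M(4) two_power_at_top 4 evk
        by (intro filtered_tower_two_power[where l = "\<lambda>i. i"]) auto
      then show ?thesis by blast
    next
      case 5
      have "filtered_tower G T x H Z y S (\<lambda>i. 2 ^ i)"
        using frattini_series_props series_le_M(3) two_power_at_top 5 evk
        by (intro filtered_tower_two_power[where l = "\<lambda>i. i"]) auto
      then show ?thesis by blast
    qed
  qed
  then obtain n where "filtered_tower G T x H Z y S n" by blast
  then interpret S: filtered_tower G T x H Z y S n .
  show "normal_hspec G T S = {0..1}" "hspec G T S = {0..1}" by (rule S.full_spectrum)+
qed

end


section \<open>The finite wreath products\<close>

lemma group_wreath: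
  assumes A: "group A" and H: "group H"
  shows "group (wreath A H)"
proof -
  interpret A: group A by fact
  interpret H: group H by fact
  have car: "carrier (wreath A H) = (carrier H \<rightarrow>\<^sub>E carrier A) \<times> carrier H"
    and one: "\<one>\<^bsub>wreath A H\<^esub> = (\<lambda>m\<in>carrier H. \<one>\<^bsub>A\<^esub>, \<one>\<^bsub>H\<^esub>)"
    by (auto simp: wreath_def)
  have mult: "(f, h) \<otimes>\<^bsub>wreath A H\<^esub> (f', h') =
      (\<lambda>m\<in>carrier H. f m \<otimes>\<^bsub>A\<^esub> f' (m \<otimes>\<^bsub>H\<^esub> h), h \<otimes>\<^bsub>H\<^esub> h')" for f h f' h'
    by (simp add: wreath_def)
  show ?thesis
  proof (rule groupI)
    fix u v assume "u \<in> carrier (wreath A H)" "v \<in> carrier (wreath A H)"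
    then show "u \<otimes>\<^bsub>wreath A H\<^esub> v \<in> carrier (wreath A H)"
      by (cases u; cases v) (auto simp: car mult PiE_iff)
  next
    show "\<one>\<^bsub>wreath A H\<^esub> \<in> carrier (wreath A H)" by (simp add: car one)
  next
    fix u v w
    assume "u \<in> carrier (wreath A H)" "v \<in> carrier (wreath A H)" "w \<in> carrier (wreath A H)"
    then show "u \<otimes>\<^bsub>wreath A H\<^esub> v \<otimes>\<^bsub>wreath A H\<^esub> w = u \<otimes>\<^bsub>wreath A H\<^esub> (v \<otimes>\<^bsub>wreath A H\<^esub> w)"
      by (cases u; cases v; cases w)
        (auto simp: car mult PiE_iff H.m_assoc A.m_assoc intro!: restrict_ext)
  next
    fix u assume u: "u \<in> carrier (wreath A H)"
    then obtain f h where fh: "u = (f, h)" "f \<in> carrier H \<rightarrow>\<^sub>E carrier A" "h \<in> carrier H"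
      by (auto simp: car)
    have "(\<lambda>m\<in>carrier H. \<one>\<^bsub>A\<^esub> \<otimes>\<^bsub>A\<^esub> f (m \<otimes>\<^bsub>H\<^esub> \<one>\<^bsub>H\<^esub>)) = f"
    proof
      fix m
      show "(\<lambda>m\<in>carrier H. \<one>\<^bsub>A\<^esub> \<otimes>\<^bsub>A\<^esub> f (m \<otimes>\<^bsub>H\<^esub> \<one>\<^bsub>H\<^esub>)) m = f m"
        using fh by (cases "m \<in> carrier H") (auto simp: PiE_iff extensional_def)
    qed
    moreover have "(\<lambda>m\<in>carrier H. (\<lambda>m\<in>carrier H. \<one>\<^bsub>A\<^esub>) m \<otimes>\<^bsub>A\<^esub> f (m \<otimes>\<^bsub>H\<^esub> \<one>\<^bsub>H\<^esub>)) =
        (\<lambda>m\<in>carrier H. \<one>\<^bsub>A\<^esub> \<otimes>\<^bsub>A\<^esub> f (m \<otimes>\<^bsub>H\<^esub> \<one>\<^bsub>H\<^esub>))"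
      by (rule restrict_ext) simp
    ultimately show "\<one>\<^bsub>wreath A H\<^esub> \<otimes>\<^bsub>wreath A H\<^esub> u = u" using fh by (simp add: one mult)
    let ?v = "(\<lambda>m\<in>carrier H. inv\<^bsub>A\<^esub> f (m \<otimes>\<^bsub>H\<^esub> inv\<^bsub>H\<^esub> h), inv\<^bsub>H\<^esub> h)"
    have "?v \<in> carrier (wreath A H)" using fh by (auto simp: car PiE_iff)
    moreover have "?v \<otimes>\<^bsub>wreath A H\<^esub> u = \<one>\<^bsub>wreath A H\<^esub>"
      using fh by (auto simp: mult one PiE_iff intro!: restrict_ext)
    ultimately show "\<exists>v\<in>carrier (wreath A H). v \<otimes>\<^bsub>wreath A H\<^esub> u = \<one>\<^bsub>wreath A H\<^esub>" by blast
  qed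
qed

abbreviation Zn :: "nat \<Rightarrow> int set" where "Zn k \<equiv> {0..<2 ^ k}"

lemma carrier_W_level: "carrier (W_level k) = (Zn k \<rightarrow>\<^sub>E {0..<2}) \<times> Zn k"
  by (simp add: W_level_def wreath_def carrier_integer_mod_group)

text \<open>Encodes the base group by subsets of \<open>Zn k\<close>, so that its multiplication
  becomes symmetric difference.\<close>

definition ind :: "nat \<Rightarrow> int set \<Rightarrow> int \<Rightarrow> int" where
  "ind k A = (\<lambda>m\<in>Zn k. if m \<in> A then 1 else 0)"

lemma ind_apply: "m \<in> Zn k \<Longrightarrow> ind k A m = (if m \<in> A then 1 else 0)"
  unfolding ind_def by simp

lemma ind_eqI:
  "(\<And>m. m \<in> Zn k \<Longrightarrow> F m = (if m \<in> A then 1 else 0)) \<Longrightarrow> (\<lambda>m\<in>Zn k. F m) = ind k A"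
  unfolding ind_def by (rule restrict_ext)

lemma ind_closed [simp]: "ind k A \<in> Zn k \<rightarrow>\<^sub>E {0..<2}"
  by (auto simp: ind_def)

lemma one_W_level: "\<one>\<^bsub>W_level k\<^esub> = (ind k {}, 0)"
  by (simp add: W_level_def wreath_def carrier_integer_mod_group ind_def)

lemma mult_W_level:
  "(f, h) \<otimes>\<^bsub>W_level k\<^esub> (f', h') = (\<lambda>m\<in>Zn k. (f m + f' ((m + h) mod 2 ^ k)) mod 2, (h + h') mod 2 ^ k)"
  by (simp add: W_level_def wreath_def carrier_integer_mod_group)

lemma mult_W_level_ind:
  assumes "\<And>m. m \<in> Zn k \<Longrightarrow> (f m + f' ((m + h) mod 2 ^ k)) mod 2 = (if m \<in> A then 1 else 0)"
  shows "(f, h) \<otimes>\<^bsub>W_level k\<^esub> (f', h') = (ind k A, (h + h') mod 2 ^ k)"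
  unfolding mult_W_level using ind_eqI[OF assms] by simp

interpretation W_level: plain_group "W_level k" for k
  by (simp add: plain_group_def W_level_def group_wreath)

lemma card_W_level: "\<exists>n. card (carrier (W_level k)) = 2 ^ n"
proof -
  have "card (carrier (W_level k)) = 2 ^ (2 ^ k) * 2 ^ k"
    by (simp add: carrier_W_level card_cartesian_product card_funcsetE nat_power_eq)
  then show ?thesis by (metis power_add)
qed

lemma finite_W_level: "finite (carrier (W_level k))"
  by (auto simp: carrier_W_level intro!: finite_cartesian_product finite_PiE)

lemma x_level_eq: "x_level k = (ind k {}, 1)"
  by (simp add: x_level_def carrier_integer_mod_group ind_def)

lemma y_level_eq: "y_level k = (ind k {0}, 0)"
  by (simp add: y_level_def ind_def carrier_integer_mod_group)

lemma x_level_closed: "1 \<le> k \<Longrightarrow> x_level k \<in> carrier (W_level k)"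
proof -
  assume "1 \<le> k"
  then have "(1::int) < 2 ^ k" by simp
  then show ?thesis by (simp add: x_level_eq carrier_W_level)
qed

lemma y_level_closed: "y_level k \<in> carrier (W_level k)"
  by (simp add: y_level_eq carrier_W_level)

lemma x_level_pow:
  assumes k: "1 \<le> k"
  shows "x_level k [^]\<^bsub>W_level k\<^esub> (j::nat) = (ind k {}, int j mod 2 ^ k)"
proof (induction j)
  case 0
  then show ?case by (simp add: one_W_level)
next
  case (Suc j)
  have "(ind k {}, int j mod 2 ^ k) \<otimes>\<^bsub>W_level k\<^esub> (ind k {}, 1) = (ind k {}, (int j mod 2 ^ k + 1) mod 2 ^ k)"
    by (rule mult_W_level_ind) (simp add: ind_apply)
  then show ?case using Suc by (simp add: x_level_eq mod_simps add.commute)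
qed

lemma base_mult:
  "(ind k A, 0) \<otimes>\<^bsub>W_level k\<^esub> (ind k B, 0) = (ind k ((A - B) \<union> (B - A)), 0)"
proof -
  have "(ind k A, 0) \<otimes>\<^bsub>W_level k\<^esub> (ind k B, 0) = (ind k ((A - B) \<union> (B - A)), (0 + 0) mod 2 ^ k)"
    by (rule mult_W_level_ind) (auto simp: ind_apply)
  then show ?thesis by simp
qed

lemma y_conj_x_pow:
  assumes k: "1 \<le> k" and j: "j < 2 ^ k"
  shows "group_conjugate (W_level k) (y_level k) (x_level k [^]\<^bsub>W_level k\<^esub> j) = (ind k {int j}, 0)"
proof -
  have "int j < int (2 ^ k)" using j by (simp only: of_nat_less_iff)
  then have jn: "int j < 2 ^ k" by simp
  have x: "x_level k [^]\<^bsub>W_level k\<^esub> j = (ind k {}, int j)"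
    using x_level_pow[OF k, of j] jn by simp
  have "(ind k {0}, 0) \<otimes>\<^bsub>W_level k\<^esub> (ind k {}, int j) = (ind k {0}, (0 + int j) mod 2 ^ k)"
    by (rule mult_W_level_ind) (auto simp: ind_apply)
  also have "\<dots> = (ind k {}, int j) \<otimes>\<^bsub>W_level k\<^esub> (ind k {int j}, 0)"
  proof -
    have "(m + int j) mod 2 ^ k = int j \<longleftrightarrow> m = 0" if "m \<in> Zn k" for m
    proof
      assume "(m + int j) mod 2 ^ k = int j"
      then have "(m + int j) mod 2 ^ k = int j mod 2 ^ k" using jn by simp
      then have "2 ^ k dvd m" by (simp add: mod_eq_dvd_iff)
      then show "m = 0" using that by (auto dest: zdvd_imp_le)
    qed (use jn in simp)
    then have "(ind k {}, int j) \<otimes>\<^bsub>W_level k\<^esub> (ind k {int j}, 0) = (ind k {0}, (int j + 0) mod 2 ^ k)"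
      by (intro mult_W_level_ind) (simp add: ind_apply)
    then show ?thesis by simp
  qed
  finally have e: "y_level k \<otimes>\<^bsub>W_level k\<^esub> x_level k [^]\<^bsub>W_level k\<^esub> j =
    x_level k [^]\<^bsub>W_level k\<^esub> j \<otimes>\<^bsub>W_level k\<^esub> (ind k {int j}, 0)" by (simp only: x y_level_eq)
  have c: "x_level k [^]\<^bsub>W_level k\<^esub> j \<in> carrier (W_level k)" "y_level k \<in> carrier (W_level k)"
    "(ind k {int j}, 0) \<in> carrier (W_level k)"
    using x_level_closed[OF k] y_level_closed W_level.nat_pow_closed by (auto simp: carrier_W_level[of k, symmetric])
      (simp add: carrier_W_level)
  show ?thesis
    unfolding group_conjugate_def using c
    by (simp add: W_level.m_assoc e W_level.mult_inv_cancel)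
qed

lemma ind_generate:
  assumes k: "1 \<le> k" and A: "finite A" "A \<subseteq> Zn k"
  shows "(ind k A, 0) \<in> generate (W_level k)
    {group_conjugate (W_level k) (y_level k) (x_level k [^]\<^bsub>W_level k\<^esub> i) | i :: int. True}"
    (is "_ \<in> generate _ ?S")
  using A
proof (induction rule: finite_induct)
  case empty
  have "(ind k {}, 0) = \<one>\<^bsub>W_level k\<^esub>" by (simp add: one_W_level)
  then show ?case by (simp add: generate.one)
next
  case (insert i A)
  have i: "nat i < 2 ^ k" "int (nat i) = i" using insert by (auto simp: nat_less_iff)
  have "(ind k {i}, 0) = group_conjugate (W_level k) (y_level k) (x_level k [^]\<^bsub>W_level k\<^esub> (int (nat i)))"
    using y_conj_x_pow[OF k i(1)] i(2) int_pow_int by metis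
  then have "(ind k {i}, 0) \<in> generate (W_level k) ?S" by (intro generate.incl) blast
  then have "(ind k A, 0) \<otimes>\<^bsub>W_level k\<^esub> (ind k {i}, 0) \<in> generate (W_level k) ?S"
    using insert by (intro generate.eng) auto
  moreover have "(A - {i}) \<union> ({i} - A) = insert i A" using insert by auto
  ultimately show ?case by (simp add: base_mult)
qed

lemma B_level_eq: "B_level k = {(ind k A, 0) | A. A \<subseteq> Zn k}"
proof
  have "(ind k A, 0) \<in> carrier (W_level k)" for A
    unfolding carrier_W_level by (intro SigmaI ind_closed) simp
  then show "{(ind k A, 0) | A. A \<subseteq> Zn k} \<subseteq> B_level k" by (auto simp: B_level_def)
  show "B_level k \<subseteq> {(ind k A, 0) | A. A \<subseteq> Zn k}"
  proof
    fix w assume "w \<in> B_level k"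
    then obtain f where f: "w = (f, 0)" "f \<in> Zn k \<rightarrow>\<^sub>E {0..<2}"
      by (auto simp: B_level_def carrier_W_level)
    have "f = ind k {m \<in> Zn k. f m = 1}"
    proof
      fix m
      show "f m = ind k {m \<in> Zn k. f m = 1} m"
      proof (cases "m \<in> Zn k")
        case True
        then have "f m \<in> {0..<2}" using f(2) by blast
        then have "f m = 0 \<or> f m = 1" by auto
        then show ?thesis using True by (auto simp: ind_def)
      next
        case False
        then show ?thesis using f(2) by (auto simp: ind_def PiE_iff extensional_def)
      qed
    qed
    then show "w \<in> {(ind k A, 0) | A. A \<subseteq> Zn k}" using f(1) by blast
  qed
qed

lemma B_level_generate:
  assumes k: "1 \<le> k"
  shows "B_level k \<subseteq> generate (W_level k)
    {group_conjugate (W_level k) (y_level k) (x_level k [^]\<^bsub>W_level k\<^esub> i) | i :: int. True}"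
  unfolding B_level_eq using ind_generate[OF k] finite_subset[of _ "Zn k"] by auto

lemma snd_hom: "group_hom (W_level k) (integer_mod_group (2 ^ k)) snd"
proof -
  have "snd \<in> hom (W_level k) (integer_mod_group (2 ^ k))"
    by (auto simp: hom_def carrier_W_level carrier_integer_mod_group mult_W_level)
  then show ?thesis by (simp add: group_hom_def group_hom_axioms_def W_level.group_axioms)
qed

lemma B_level_normal: "B_level k \<lhd> W_level k"
proof -
  interpret s: group_hom "W_level k" "integer_mod_group (2 ^ k)" snd by (rule snd_hom)
  have "B_level k = kernel (W_level k) (integer_mod_group (2 ^ k)) snd"
    by (auto simp: B_level_def kernel_def)
  then show ?thesis using s.normal_kernel by simp
qed

lemma B_level_sq: "u \<in> B_level k \<Longrightarrow> u \<otimes>\<^bsub>W_level k\<^esub> u = \<one>\<^bsub>W_level k\<^esub>"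
  by (auto simp: B_level_eq base_mult one_W_level)

lemma B_level_comm:
  "u \<in> B_level k \<Longrightarrow> v \<in> B_level k \<Longrightarrow> u \<otimes>\<^bsub>W_level k\<^esub> v = v \<otimes>\<^bsub>W_level k\<^esub> u"
  by (auto simp: B_level_eq base_mult Un_commute)

lemma generate_W_level:
  assumes k: "1 \<le> k"
  shows "generate (W_level k) {x_level k, y_level k} = carrier (W_level k)"
proof
  let ?g = "generate (W_level k) {x_level k, y_level k}"
  have xy: "{x_level k, y_level k} \<subseteq> carrier (W_level k)" using x_level_closed[OF k] y_level_closed by simp
  show "?g \<subseteq> carrier (W_level k)" using xy by (rule W_level.generate_incl)
  have sub: "subgroup ?g (W_level k)" using xy by (rule W_level.generate_is_subgroup)
  have x: "x_level k \<in> ?g" and y: "y_level k \<in> ?g" by (auto intro: generate.incl)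
  have xi: "x_level k [^]\<^bsub>W_level k\<^esub> (i::int) \<in> ?g" for i
    using W_level.subgroup_int_pow_closed[OF sub x] .
  have "group_conjugate (W_level k) (y_level k) (x_level k [^]\<^bsub>W_level k\<^esub> (i::int)) \<in> ?g" for i
    unfolding group_conjugate_def using xi y sub by (meson subgroup.m_closed subgroup.m_inv_closed)
  then have "generate (W_level k) {group_conjugate (W_level k) (y_level k) (x_level k [^]\<^bsub>W_level k\<^esub> i) | i :: int. True} \<subseteq> ?g"
    by (intro W_level.generate_subgroup_incl sub) auto
  then have B: "B_level k \<subseteq> ?g" using B_level_generate[OF k] by blast
  show "carrier (W_level k) \<subseteq> ?g"
  proof
    fix w assume w: "w \<in> carrier (W_level k)"
    then obtain f h where fh: "w = (f, h)" "f \<in> Zn k \<rightarrow>\<^sub>E {0..<2}" "h \<in> Zn k"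
      by (auto simp: carrier_W_level)
    have "x_level k [^]\<^bsub>W_level k\<^esub> (nat h) = (ind k {}, h)"
      using x_level_pow[OF k, of "nat h"] fh by simp
    moreover have "(f, 0) \<in> B_level k" using fh by (auto simp: B_level_def carrier_W_level)
    moreover from this obtain A where A: "f = ind k A" by (auto simp: B_level_eq)
    have "(ind k A, 0) \<otimes>\<^bsub>W_level k\<^esub> (ind k {}, h) = (ind k A, (0 + h) mod 2 ^ k)"
      by (rule mult_W_level_ind) (auto simp: ind_apply)
    then have "(f, 0) \<otimes>\<^bsub>W_level k\<^esub> (ind k {}, h) = w" using fh A by simp
    ultimately show "w \<in> ?g" using B xi[of "int (nat h)"] sub by (metis int_pow_int subgroup.m_closed subsetD)
  qed
qed

section \<open>The transition maps in explicit form\<close>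

definition transition :: "nat \<Rightarrow> (int \<Rightarrow> int) \<times> int \<Rightarrow> (int \<Rightarrow> int) \<times> int" where
  "transition k = (\<lambda>(f, h) \<in> carrier (W_level (Suc k)). (\<lambda>m\<in>Zn k. (f m + f (m + 2 ^ k)) mod 2, h mod 2 ^ k))"

text \<open>The two residues modulo \<open>2 * n\<close> above a residue modulo \<open>n\<close> are
  exchanged by adding \<open>n\<close>, so a sum over both depends only on the residue modulo
  \<open>n\<close>. This makes the folding of coordinates in \<open>transition\<close> compatible
  with shifts.\<close>

lemma mod_double:
  fixes n s :: int and g :: "int \<Rightarrow> int"
  assumes n: "n > 0"
  shows "g (s mod (2 * n)) + g ((s + n) mod (2 * n)) = g (s mod n) + g (s mod n + n)"
proof -
  have a: "s mod (2 * n) = n * (s div n mod 2) + s mod n"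
    using zmod_zmult2_eq[of 2 s n] by (simp add: mult.commute)
  have b: "(s + n) mod (2 * n) = n * ((s div n + 1) mod 2) + s mod n"
    using zmod_zmult2_eq[of 2 "s + n" n] n by (simp add: mult.commute)
  show ?thesis
  proof (cases "even (s div n)")
    case True
    then have "s div n mod 2 = 0" "(s div n + 1) mod 2 = 1" by (simp_all add: mod2_eq_if)
    then show ?thesis unfolding a b by (simp add: add.commute[of n])
  next
    case False
    then have "s div n mod 2 = 1" "(s div n + 1) mod 2 = 0" by (simp_all add: mod2_eq_if)
    then show ?thesis unfolding a b by (simp add: add.commute[of n])
  qed
qed

lemma transition_hom: "transition k \<in> hom (W_level (Suc k)) (W_level k)"
proof (rule homI)
  fix u assume "u \<in> carrier (W_level (Suc k))"
  then show "transition k u \<in> carrier (W_level k)"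
    by (auto simp: transition_def carrier_W_level)
next
  fix u v assume u: "u \<in> carrier (W_level (Suc k))" and v: "v \<in> carrier (W_level (Suc k))"
  obtain f h f' h' where fh: "u = (f, h)" "v = (f', h')" by (cases u; cases v) auto
  let ?n = "2 ^ k :: int"
  define F where "F = (\<lambda>m. (f m + f' ((m + h) mod (2 * ?n))) mod 2)"
  define fu fv where "fu = (\<lambda>m\<in>Zn k. (f m + f (m + ?n)) mod 2)" and "fv = (\<lambda>m\<in>Zn k. (f' m + f' (m + ?n)) mod 2)"
  have uv: "u \<otimes>\<^bsub>W_level (Suc k)\<^esub> v \<in> carrier (W_level (Suc k))" using u v by simp
  have main: "(F m + F (m + ?n)) mod 2 = (fu m + fv ((m + h mod ?n) mod ?n)) mod 2" if m: "m \<in> Zn k" for m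
  proof -
    define r where "r = (m + h) mod ?n"
    have rZ: "r \<in> Zn k" by (simp add: r_def)
    have r: "(m + h mod ?n) mod ?n = r" by (simp add: r_def mod_simps)
    have e: "m + ?n + h = m + h + ?n" by simp
    have a: "f' ((m + h) mod (2 * ?n)) + f' ((m + ?n + h) mod (2 * ?n)) = f' r + f' (r + ?n)"
      unfolding e r_def by (rule mod_double) simp
    have "(F m + F (m + ?n)) mod 2 =
        (f m + f' ((m + h) mod (2 * ?n)) + (f (m + ?n) + f' ((m + ?n + h) mod (2 * ?n)))) mod 2"
      by (simp only: F_def mod_add_eq)
    also have "\<dots> = (f m + f (m + ?n) + (f' ((m + h) mod (2 * ?n)) + f' ((m + ?n + h) mod (2 * ?n)))) mod 2"
      by (simp only: add.assoc add.left_commute)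
    also have "\<dots> = (f m + f (m + ?n) + (f' r + f' (r + ?n))) mod 2" by (simp only: a)
    also have "\<dots> = (fu m + fv r) mod 2"
      unfolding fu_def fv_def restrict_apply'[OF m] restrict_apply'[OF rZ] by (simp only: mod_add_eq)
    finally show ?thesis unfolding r .
  qed
  have uv_eq: "u \<otimes>\<^bsub>W_level (Suc k)\<^esub> v = (\<lambda>m\<in>Zn (Suc k). F m, (h + h') mod (2 * ?n))"
    by (simp add: fh mult_W_level F_def)
  have "transition k (u \<otimes>\<^bsub>W_level (Suc k)\<^esub> v) = (\<lambda>m\<in>Zn k. (F m + F (m + ?n)) mod 2, (h + h') mod (2 * ?n) mod ?n)"
  proof -
    have "(\<lambda>m\<in>Zn k. ((\<lambda>m\<in>Zn (Suc k). F m) m + (\<lambda>m\<in>Zn (Suc k). F m) (m + ?n)) mod 2) =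
        (\<lambda>m\<in>Zn k. (F m + F (m + ?n)) mod 2)"
    proof (rule restrict_ext)
      fix m assume "m \<in> Zn k"
      then have "m \<in> Zn (Suc k)" "m + ?n \<in> Zn (Suc k)" by auto
      then show "((\<lambda>m\<in>Zn (Suc k). F m) m + (\<lambda>m\<in>Zn (Suc k). F m) (m + ?n)) mod 2 = (F m + F (m + ?n)) mod 2"
        by (simp only: restrict_apply')
    qed
    then show ?thesis using uv unfolding uv_eq transition_def by (simp only: restrict_apply' prod.case)
  qed
  also have "(\<lambda>m\<in>Zn k. (F m + F (m + ?n)) mod 2) = (\<lambda>m\<in>Zn k. (fu m + fv ((m + h mod ?n) mod ?n)) mod 2)"
    using main by (rule restrict_ext)
  also have "(h + h') mod (2 * ?n) mod ?n = (h mod ?n + h' mod ?n) mod ?n"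
    by (simp add: mod_mod_cancel mod_simps)
  also have "(\<lambda>m\<in>Zn k. (fu m + fv ((m + h mod ?n) mod ?n)) mod 2, (h mod ?n + h' mod ?n) mod ?n) =
      (fu, h mod ?n) \<otimes>\<^bsub>W_level k\<^esub> (fv, h' mod ?n)" by (simp only: mult_W_level)
  also have "(fu, h mod ?n) = transition k u"
    using u unfolding fh transition_def fu_def by (simp only: restrict_apply' prod.case)
  also have "(fv, h' mod ?n) = transition k v"
    using v unfolding fh transition_def fv_def by (simp only: restrict_apply' prod.case)
  finally show "transition k (u \<otimes>\<^bsub>W_level (Suc k)\<^esub> v) = transition k u \<otimes>\<^bsub>W_level k\<^esub> transition k v" .
qed

lemma transition_x: "1 \<le> k \<Longrightarrow> transition k (x_level (Suc k)) = x_level k"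
proof -
  assume k: "1 \<le> k"
  have "(1::int) < 2 ^ k" using k by simp
  then show ?thesis using x_level_closed[of "Suc k"] k
    by (auto simp: transition_def x_level_eq ind_apply intro!: ind_eqI)
qed

lemma transition_y: "transition k (y_level (Suc k)) = y_level k"
  using y_level_closed[of "Suc k"]
  by (auto simp: transition_def y_level_eq ind_apply intro!: ind_eqI)

text \<open>The definite description is evaluated by exhibiting the folding map and comparing
  homomorphisms on the two generators.\<close>

lemma W_transition_eq:
  assumes k: "1 \<le> k"
  shows "W_transition k = transition k"
  unfolding W_transition_def gen_hom_def
proof (rule the_equality)
  show "transition k \<in> hom (W_level (Suc k)) (W_level k) \<inter> extensional (carrier (W_level (Suc k))) \<and>
    continuous_map (top_level (Suc k)) (top_level k) (transition k) \<and>
    transition k (x_level (Suc k)) = x_level k \<and> transition k (y_level (Suc k)) = y_level k"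
    using transition_hom transition_x[OF k] transition_y hom_in_carrier[OF transition_hom]
    by (auto simp: transition_def top_level_def continuous_map_from_discrete_topology Pi_iff)
  fix \<phi> assume \<phi>: "\<phi> \<in> hom (W_level (Suc k)) (W_level k) \<inter> extensional (carrier (W_level (Suc k))) \<and>
    continuous_map (top_level (Suc k)) (top_level k) \<phi> \<and>
    \<phi> (x_level (Suc k)) = x_level k \<and> \<phi> (y_level (Suc k)) = y_level k"
  interpret p: group_hom "W_level (Suc k)" "W_level k" \<phi>
    using \<phi> by (simp add: group_hom_def group_hom_axioms_def W_level.group_axioms)
  interpret t: group_hom "W_level (Suc k)" "W_level k" "transition k"
    using transition_hom by (simp add: group_hom_def group_hom_axioms_def W_level.group_axioms)
  have "\<phi> w = transition k w" if "w \<in> generate (W_level (Suc k)) {x_level (Suc k), y_level (Suc k)}" for w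
    using that
  proof (induction rule: generate.induct)
    case one
    then show ?case by (simp only: p.hom_one t.hom_one)
  next
    case (incl h)
    then show ?case using \<phi> transition_x[OF k] transition_y by auto
  next
    case (inv h)
    then have "h \<in> carrier (W_level (Suc k))" "\<phi> h = transition k h"
      using \<phi> transition_x[OF k] transition_y x_level_closed[of "Suc k"] y_level_closed by auto
    then show ?case by (simp only: p.hom_inv t.hom_inv)
  next
    case (eng h1 h2)
    then have "h1 \<in> carrier (W_level (Suc k))" "h2 \<in> carrier (W_level (Suc k))"
      using generate_W_level[of "Suc k"] by auto
    then show ?case using eng by (simp only: p.hom_mult t.hom_mult)
  qed
  then have "\<phi> w = transition k w" if "w \<in> carrier (W_level (Suc k))" for w
    using that generate_W_level[of "Suc k"] by simp
  then show "\<phi> = transition k"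
    using \<phi> by (intro extensionalityI[of _ "carrier (W_level (Suc k))"]) (auto simp: transition_def)
qed

section \<open>A lower bound for the index of the relation subgroups\<close>

text \<open>The truncated Magnus embedding: \<open>((f, h), M)\<close> stands for \<open>(1 + f + M) h\<close> in the skew group ring
  of \<open>\<langle>x\<rangle>\<close> over the tensor algebra of the base group modulo degree 3, with \<open>M\<close> an element of degree 2.\<close>

definition magnus :: "nat \<Rightarrow> (((int \<Rightarrow> int) \<times> int) \<times> (int \<times> int) set) monoid" where
  "magnus k =
     \<lparr>carrier = carrier (W_level k) \<times> Pow (Zn k \<times> Zn k),
      monoid.mult = (\<lambda>(u, M) (v, N). (u \<otimes>\<^bsub>W_level k\<^esub> v,
         {(i, j) \<in> Zn k \<times> Zn k. ((i, j) \<in> M) \<noteq>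
            ((((i + snd u) mod 2 ^ k, (j + snd u) mod 2 ^ k) \<in> N) \<noteq>
             (fst u i = 1 \<and> fst v ((j + snd u) mod 2 ^ k) = 1))})),
      one = (\<one>\<^bsub>W_level k\<^esub>, {})\<rparr>"

lemma carrier_magnus: "carrier (magnus k) = carrier (W_level k) \<times> Pow (Zn k \<times> Zn k)"
  and one_magnus: "\<one>\<^bsub>magnus k\<^esub> = (\<one>\<^bsub>W_level k\<^esub>, {})"
  by (simp_all add: magnus_def)

text \<open>Inequality of truth values is addition in the field with two elements. The degree 2 part
  of the product has three summands: \<open>M\<close>, the shift of \<open>N\<close> by the top
  component of \<open>u\<close>, and the tensor product of the base part of \<open>u\<close> with
  the shifted base part of \<open>v\<close>.\<close>

lemma mult_magnus:
  "(u, M) \<otimes>\<^bsub>magnus k\<^esub> (v, N) = (u \<otimes>\<^bsub>W_level k\<^esub> v,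
     {(i, j) \<in> Zn k \<times> Zn k. ((i, j) \<in> M) \<noteq>
        ((((i + snd u) mod 2 ^ k, (j + snd u) mod 2 ^ k) \<in> N) \<noteq>
         (fst u i = 1 \<and> fst v ((j + snd u) mod 2 ^ k) = 1))})"
  by (simp add: magnus_def)

lemma add_mod_two_eq_one_iff:
  fixes a b :: int
  assumes "a \<in> {0..<2}" "b \<in> {0..<2}"
  shows "(a + b) mod 2 = 1 \<longleftrightarrow> (a = 1) \<noteq> (b = 1)"
proof -
  have "a = 0 \<or> a = 1" "b = 0 \<or> b = 1" using assms by auto
  then show ?thesis by auto
qed

lemma fst_mult_W_level:
  assumes "u \<in> carrier (W_level k)" "v \<in> carrier (W_level k)" "i \<in> Zn k"
  shows "fst (u \<otimes>\<^bsub>W_level k\<^esub> v) i = 1 \<longleftrightarrow> (fst u i = 1) \<noteq> (fst v ((i + snd u) mod 2 ^ k) = 1)"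
proof -
  obtain f h f' h' where e: "u = (f, h)" "v = (f', h')" by (cases u; cases v) auto
  have f: "f \<in> Zn k \<rightarrow> {0..<2}" "f' \<in> Zn k \<rightarrow> {0..<2}"
    using assms(1,2) e by (auto simp: carrier_W_level)
  have "(i + h) mod 2 ^ k \<in> Zn k" by simp
  then have "f i \<in> {0..<2}" "f' ((i + h) mod 2 ^ k) \<in> {0..<2}" using f assms(3) by blast+
  from add_mod_two_eq_one_iff[OF this] show ?thesis using assms(3) by (simp add: e mult_W_level)
qed

lemma snd_mult_W_level: "snd (u \<otimes>\<^bsub>W_level k\<^esub> v) = (snd u + snd v) mod 2 ^ k"
  by (cases u; cases v) (simp add: mult_W_level)

lemma Collect_pair_cong:
  "(\<And>i j. i \<in> A \<Longrightarrow> j \<in> B \<Longrightarrow> P i j \<longleftrightarrow> Q i j) \<Longrightarrow>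
    {(i, j) \<in> A \<times> B. P i j} = {(i, j) \<in> A \<times> B. Q i j}"
  by auto

text \<open>Both bracketings are brought to the truth values \<open>A\<close> to \<open>E'\<close>,
  which turns associativity into a Boolean identity: bilinearity of the tensor term.\<close>

lemma group_magnus: "group (magnus k)"
proof (rule groupI)
  fix p q assume "p \<in> carrier (magnus k)" "q \<in> carrier (magnus k)"
  then show "p \<otimes>\<^bsub>magnus k\<^esub> q \<in> carrier (magnus k)"
    by (cases p; cases q) (auto simp: carrier_magnus mult_magnus)
next
  show "\<one>\<^bsub>magnus k\<^esub> \<in> carrier (magnus k)" by (simp add: carrier_magnus one_magnus)
next
  fix p q r
  assume pqr: "p \<in> carrier (magnus k)" "q \<in> carrier (magnus k)" "r \<in> carrier (magnus k)"
  obtain u M v N w P where e: "p = (u, M)" "q = (v, N)" "r = (w, P)" by (cases p; cases q; cases r) auto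
  have c: "u \<in> carrier (W_level k)" "v \<in> carrier (W_level k)" "w \<in> carrier (W_level k)"
    using pqr by (auto simp: e carrier_magnus)
  have mm: "(i + (snd u + snd v) mod 2 ^ k) mod 2 ^ k = (i + snd u + snd v) mod 2 ^ k"
    "((i + snd u) mod 2 ^ k + snd v) mod 2 ^ k = (i + snd u + snd v) mod 2 ^ k" for i
    by (simp_all add: mod_simps add.assoc)
  have Z: "(i + snd u) mod 2 ^ k \<in> Zn k" for i by simp
  define A B C D E E' where
    "A = (\<lambda>i j. (i, j) \<in> M)" and
    "B = (\<lambda>i j. ((i + snd u) mod 2 ^ k, (j + snd u) mod 2 ^ k) \<in> N)" and
    "C = (\<lambda>i j. ((i + snd u + snd v) mod 2 ^ k, (j + snd u + snd v) mod 2 ^ k) \<in> P)" and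
    "D = (\<lambda>i. fst u i = 1)" and
    "E = (\<lambda>j. fst v ((j + snd u) mod 2 ^ k) = 1)" and
    "E' = (\<lambda>j. fst w ((j + snd u + snd v) mod 2 ^ k) = 1)"
  note defs = A_def B_def C_def D_def E_def E'_def
  have l: "(p \<otimes>\<^bsub>magnus k\<^esub> q \<otimes>\<^bsub>magnus k\<^esub> r) = (u \<otimes>\<^bsub>W_level k\<^esub> v \<otimes>\<^bsub>W_level k\<^esub> w,
      {(i, j) \<in> Zn k \<times> Zn k. (A i j \<noteq> (B i j \<noteq> (D i \<and> E j))) \<noteq> (C i j \<noteq> ((D i \<noteq> E i) \<and> E' j))})"
    unfolding e mult_magnus
  proof (rule arg_cong[where f = "Pair _"], rule Collect_pair_cong)
    fix i j assume "i \<in> Zn k" "j \<in> Zn k"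
    then show "((i, j) \<in> {(i, j) \<in> Zn k \<times> Zn k. ((i, j) \<in> M) \<noteq>
        ((((i + snd u) mod 2 ^ k, (j + snd u) mod 2 ^ k) \<in> N) \<noteq>
         (fst u i = 1 \<and> fst v ((j + snd u) mod 2 ^ k) = 1))}) \<noteq>
        ((((i + snd (u \<otimes>\<^bsub>W_level k\<^esub> v)) mod 2 ^ k, (j + snd (u \<otimes>\<^bsub>W_level k\<^esub> v)) mod 2 ^ k) \<in> P) \<noteq>
         (fst (u \<otimes>\<^bsub>W_level k\<^esub> v) i = 1 \<and> fst w ((j + snd (u \<otimes>\<^bsub>W_level k\<^esub> v)) mod 2 ^ k) = 1)) \<longleftrightarrow>
        (A i j \<noteq> (B i j \<noteq> (D i \<and> E j))) \<noteq> (C i j \<noteq> ((D i \<noteq> E i) \<and> E' j))"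
      by (simp only: mem_Collect_eq mem_Sigma_iff case_prod_conv snd_mult_W_level fst_mult_W_level[OF c(1,2)] mm defs
          simp_thms)
  qed
  have r: "(p \<otimes>\<^bsub>magnus k\<^esub> (q \<otimes>\<^bsub>magnus k\<^esub> r)) = (u \<otimes>\<^bsub>W_level k\<^esub> (v \<otimes>\<^bsub>W_level k\<^esub> w),
      {(i, j) \<in> Zn k \<times> Zn k. A i j \<noteq> ((B i j \<noteq> (C i j \<noteq> (E i \<and> E' j))) \<noteq> (D i \<and> (E j \<noteq> E' j)))})"
    unfolding e mult_magnus
  proof (rule arg_cong[where f = "Pair _"], rule Collect_pair_cong)
    fix i j assume ij: "i \<in> Zn k" "j \<in> Zn k"
    let ?s = "\<lambda>i. (i + snd u) mod 2 ^ k"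
    have "(?s i, ?s j) \<in> {(i, j) \<in> Zn k \<times> Zn k. ((i, j) \<in> N) \<noteq>
        ((((i + snd v) mod 2 ^ k, (j + snd v) mod 2 ^ k) \<in> P) \<noteq>
         (fst v i = 1 \<and> fst w ((j + snd v) mod 2 ^ k) = 1))} \<longleftrightarrow> (B i j \<noteq> (C i j \<noteq> (E i \<and> E' j)))"
      by (simp only: mem_Collect_eq mem_Sigma_iff case_prod_conv Z mm defs simp_thms)
    moreover have "fst (v \<otimes>\<^bsub>W_level k\<^esub> w) (?s j) = 1 \<longleftrightarrow> (E j \<noteq> E' j)"
      by (simp only: fst_mult_W_level[OF c(2,3) Z] mm defs)
    ultimately show "((i, j) \<in> M) \<noteq>
        (((?s i, ?s j) \<in> {(i, j) \<in> Zn k \<times> Zn k. ((i, j) \<in> N) \<noteq>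
        ((((i + snd v) mod 2 ^ k, (j + snd v) mod 2 ^ k) \<in> P) \<noteq>
         (fst v i = 1 \<and> fst w ((j + snd v) mod 2 ^ k) = 1))}) \<noteq>
         (fst u i = 1 \<and> fst (v \<otimes>\<^bsub>W_level k\<^esub> w) (?s j) = 1)) \<longleftrightarrow>
        A i j \<noteq> ((B i j \<noteq> (C i j \<noteq> (E i \<and> E' j))) \<noteq> (D i \<and> (E j \<noteq> E' j)))"
      by (simp only: A_def D_def)
  qed
  show "p \<otimes>\<^bsub>magnus k\<^esub> q \<otimes>\<^bsub>magnus k\<^esub> r = p \<otimes>\<^bsub>magnus k\<^esub> (q \<otimes>\<^bsub>magnus k\<^esub> r)"
    unfolding l r W_level.m_assoc[OF c]
  proof (rule arg_cong[where f = "Pair _"], rule Collect_pair_cong)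
    fix i j
    show "(A i j \<noteq> (B i j \<noteq> (D i \<and> E j))) \<noteq> (C i j \<noteq> ((D i \<noteq> E i) \<and> E' j)) \<longleftrightarrow>
        A i j \<noteq> ((B i j \<noteq> (C i j \<noteq> (E i \<and> E' j))) \<noteq> (D i \<and> (E j \<noteq> E' j)))"
      by (cases "D i"; cases "E' j"; simp; blast)
  qed
next
  fix p assume p: "p \<in> carrier (magnus k)"
  then obtain u M where e: "p = (u, M)" "u \<in> carrier (W_level k)" "M \<subseteq> Zn k \<times> Zn k"
    by (auto simp: carrier_magnus)
  have "{(i, j) \<in> Zn k \<times> Zn k. ((i, j) \<in> {}) \<noteq>
        ((((i + snd \<one>\<^bsub>W_level k\<^esub>) mod 2 ^ k, (j + snd \<one>\<^bsub>W_level k\<^esub>) mod 2 ^ k) \<in> M) \<noteq>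
         (fst \<one>\<^bsub>W_level k\<^esub> i = 1 \<and> fst u ((j + snd \<one>\<^bsub>W_level k\<^esub>) mod 2 ^ k) = 1))} =
      {(i, j) \<in> Zn k \<times> Zn k. (i, j) \<in> M}"
    by (rule Collect_pair_cong) (simp add: one_W_level ind_apply)
  also have "\<dots> = M" using e(3) by blast
  finally show "\<one>\<^bsub>magnus k\<^esub> \<otimes>\<^bsub>magnus k\<^esub> p = p"
    unfolding e(1) one_magnus mult_magnus W_level.l_one[OF e(2)] by (rule arg_cong)
  let ?u = "inv\<^bsub>W_level k\<^esub> u"
  \<comment> \<open>The set is the sum of the two other degree 2 terms of the product with
    \<open>p\<close>, so that they cancel.\<close>
  let ?q = "(?u, {(i, j) \<in> Zn k \<times> Zn k. ((((i + snd ?u) mod 2 ^ k, (j + snd ?u) mod 2 ^ k) \<in> M) \<noteq>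
         (fst ?u i = 1 \<and> fst u ((j + snd ?u) mod 2 ^ k) = 1))})"
  have "?q \<in> carrier (magnus k)"
    unfolding carrier_magnus by (intro SigmaI PowI W_level.inv_closed e(2)) auto
  moreover have "?q \<otimes>\<^bsub>magnus k\<^esub> p = \<one>\<^bsub>magnus k\<^esub>"
    unfolding e(1) mult_magnus one_magnus W_level.l_inv[OF e(2)]
    by (rule arg_cong[where f = "Pair _"]) auto
  ultimately show "\<exists>q\<in>carrier (magnus k). q \<otimes>\<^bsub>magnus k\<^esub> p = \<one>\<^bsub>magnus k\<^esub>" by blast
qed

interpretation magnus: plain_group "magnus k" for k
  by (simp add: plain_group_def group_magnus)

lemma fst_magnus_hom: "group_hom (magnus k) (W_level k) fst"
  by (auto simp: group_hom_def group_hom_axioms_def group_magnus W_level.group_axioms hom_def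
      carrier_magnus mult_magnus)

lemma card_magnus: "\<exists>n. card (carrier (magnus k)) = 2 ^ n" "finite (carrier (magnus k))"
proof -
  obtain n where "card (carrier (W_level k)) = 2 ^ n" using card_W_level by blast
  then have "card (carrier (magnus k)) = 2 ^ n * 2 ^ card (Zn k \<times> Zn k)"
    by (simp add: carrier_magnus card_cartesian_product card_Pow)
  then show "\<exists>n. card (carrier (magnus k)) = 2 ^ n" by (metis power_add)
  show "finite (carrier (magnus k))" using finite_W_level by (simp add: carrier_magnus)
qed

text \<open>A kernel element lives in degree 2, so its products with an element over the base group
  have no tensor term, and a base element causes no shift. Both products add the degree 2
  parts.\<close>

lemma magnus_kernel_central:
  assumes z: "z \<in> carrier (magnus k)" "fst z = \<one>\<^bsub>W_level k\<^esub>"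
    and p: "p \<in> carrier (magnus k)" "fst p \<in> B_level k"
  shows "z \<otimes>\<^bsub>magnus k\<^esub> p = p \<otimes>\<^bsub>magnus k\<^esub> z"
proof -
  obtain M where M: "z = (\<one>\<^bsub>W_level k\<^esub>, M)" "M \<subseteq> Zn k \<times> Zn k" using z by (cases z) (auto simp: carrier_magnus)
  obtain A N where N: "p = ((ind k A, 0), N)" "N \<subseteq> Zn k \<times> Zn k"
    using p by (cases p) (auto simp: carrier_magnus B_level_eq)
  have c: "(ind k A, 0) \<in> carrier (W_level k)" using p N by (simp add: carrier_magnus)
  have e1: "(\<one>\<^bsub>W_level k\<^esub>, M) \<otimes>\<^bsub>magnus k\<^esub> ((ind k A, 0), N) =
      ((ind k A, 0), {(i, j) \<in> Zn k \<times> Zn k. ((i, j) \<in> M) \<noteq> ((i, j) \<in> N)})"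
    unfolding mult_magnus W_level.l_one[OF c]
    by (rule arg_cong[where f = "Pair _"], rule Collect_pair_cong) (simp add: one_W_level ind_apply)
  have e2: "((ind k A, 0), N) \<otimes>\<^bsub>magnus k\<^esub> (\<one>\<^bsub>W_level k\<^esub>, M) =
      ((ind k A, 0), {(i, j) \<in> Zn k \<times> Zn k. ((i, j) \<in> N) \<noteq> ((i, j) \<in> M)})"
    unfolding mult_magnus W_level.r_one[OF c]
    by (rule arg_cong[where f = "Pair _"], rule Collect_pair_cong) (simp add: one_W_level ind_apply)
  show ?thesis unfolding M N e1 e2
    by (rule arg_cong[where f = "Pair _"], rule Collect_pair_cong) blast
qed

lemma magnus_kernel_mult:
  assumes "M \<subseteq> Zn k \<times> Zn k" "N \<subseteq> Zn k \<times> Zn k"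
  shows "(\<one>\<^bsub>W_level k\<^esub>, M) \<otimes>\<^bsub>magnus k\<^esub> (\<one>\<^bsub>W_level k\<^esub>, N) = (\<one>\<^bsub>W_level k\<^esub>, (M - N) \<union> (N - M))"
proof -
  have "{(i, j) \<in> Zn k \<times> Zn k. ((i, j) \<in> M) \<noteq>
        ((((i + snd \<one>\<^bsub>W_level k\<^esub>) mod 2 ^ k, (j + snd \<one>\<^bsub>W_level k\<^esub>) mod 2 ^ k) \<in> N) \<noteq>
         (fst \<one>\<^bsub>W_level k\<^esub> i = 1 \<and> fst \<one>\<^bsub>W_level k\<^esub> ((j + snd \<one>\<^bsub>W_level k\<^esub>) mod 2 ^ k) = 1))} =
      {(i, j) \<in> Zn k \<times> Zn k. ((i, j) \<in> M) \<noteq> ((i, j) \<in> N)}"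
    by (rule Collect_pair_cong) (simp add: one_W_level ind_apply)
  also have "\<dots> = (M - N) \<union> (N - M)" using assms by blast
  finally show ?thesis unfolding mult_magnus W_level.l_one[OF W_level.one_closed] by (rule arg_cong)
qed

definition magnus_x :: "nat \<Rightarrow> ((int \<Rightarrow> int) \<times> int) \<times> (int \<times> int) set" where
  "magnus_x k = (x_level k, {})"

definition magnus_y :: "nat \<Rightarrow> ((int \<Rightarrow> int) \<times> int) \<times> (int \<times> int) set" where
  "magnus_y k = (y_level k, {})"

lemma magnus_xy_closed:
  assumes "1 \<le> k"
  shows "magnus_x k \<in> carrier (magnus k)" "magnus_y k \<in> carrier (magnus k)"
  using x_level_closed[OF assms] y_level_closed by (auto simp: magnus_x_def magnus_y_def carrier_magnus)

lemma magnus_x_pow: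
  assumes "1 \<le> k"
  shows "magnus_x k [^]\<^bsub>magnus k\<^esub> (j::nat) = (x_level k [^]\<^bsub>W_level k\<^esub> j, {})"
proof (induction j)
  case (Suc j)
  have "fst (x_level k [^]\<^bsub>W_level k\<^esub> j) i \<noteq> 1" if "i \<in> Zn k" for i
    using that x_level_pow[OF assms, of j] by (simp add: ind_apply)
  then show ?case using Suc by (auto simp: magnus_x_def mult_magnus)
qed (simp add: one_magnus)

text \<open>The element is the conjugate of \<open>magnus_y k\<close> by the power \<open>j\<close>
  of \<open>magnus_x k\<close>; no degree 2 term arises, because powers of \<open>magnus_x k\<close>
  have trivial base part.\<close>

lemma magnus_base_mem:
  assumes k: "1 \<le> k" and D: "subgroup D (magnus k)" "magnus_x k \<in> D" "magnus_y k \<in> D" and j: "j < 2 ^ k"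
  shows "((ind k {int j}, 0), {}) \<in> D"
proof -
  let ?xj = "x_level k [^]\<^bsub>W_level k\<^esub> j"
  let ?X = "magnus_x k [^]\<^bsub>magnus k\<^esub> j"
  let ?e = "((ind k {int j}, 0), {})"
  have c: "?X \<in> carrier (magnus k)" "magnus_y k \<in> carrier (magnus k)" "?e \<in> carrier (magnus k)"
    using magnus_xy_closed[OF k] magnus.nat_pow_closed
    by (auto simp: carrier_magnus[of k, symmetric]) (simp add: carrier_magnus carrier_W_level)
  have cW: "?xj \<in> carrier (W_level k)" "y_level k \<in> carrier (W_level k)"
    "(ind k {int j}, 0) \<in> carrier (W_level k)"
    using x_level_closed[OF k] y_level_closed by (auto intro: W_level.nat_pow_closed) (simp add: carrier_W_level)
  have 0: "fst ?xj i \<noteq> 1" if "i \<in> Zn k" for i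
    using that x_level_pow[OF k, of j] by (simp add: ind_apply)
  have "magnus_y k \<otimes>\<^bsub>magnus k\<^esub> ?X = (y_level k \<otimes>\<^bsub>W_level k\<^esub> ?xj, {})"
    using 0 unfolding magnus_x_pow[OF k] magnus_y_def mult_magnus by auto
  moreover have "?X \<otimes>\<^bsub>magnus k\<^esub> ?e = (?xj \<otimes>\<^bsub>W_level k\<^esub> (ind k {int j}, 0), {})"
    using 0 unfolding magnus_x_pow[OF k] mult_magnus by auto
  moreover have "y_level k \<otimes>\<^bsub>W_level k\<^esub> ?xj = ?xj \<otimes>\<^bsub>W_level k\<^esub> (ind k {int j}, 0)"
    unfolding y_conj_x_pow[OF k j, symmetric] group_conjugate_def using cW
    by (simp add: W_level.m_assoc W_level.mult_inv_cancel)
  ultimately have xe: "?X \<otimes>\<^bsub>magnus k\<^esub> ?e = magnus_y k \<otimes>\<^bsub>magnus k\<^esub> ?X" by simp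
  have "?e = inv\<^bsub>magnus k\<^esub> ?X \<otimes>\<^bsub>magnus k\<^esub> (magnus_y k \<otimes>\<^bsub>magnus k\<^esub> ?X)"
    unfolding xe[symmetric] using magnus.mult_inv_cancel(2)[OF c(1,3)] by (rule sym)
  moreover have "?X \<in> D" using magnus.subgroup_nat_pow_closed[OF D(1,2)] .
  ultimately show ?thesis using D by (simp add: subgroup.m_closed subgroup.m_inv_closed)
qed

text \<open>Up to degree 2 the commutator of \<open>1 + e_i\<close> and \<open>1 + e_j\<close> is
  \<open>1 + e_i e_j + e_j e_i\<close>. It is identified as the solution \<open>z\<close> of
  \<open>(e j \<otimes> e i) \<otimes> z = e i \<otimes> e j\<close>, which avoids computing
  inverses in the Magnus group.\<close>

lemma magnus_commutator_mem:
  assumes k: "1 \<le> k" and D: "subgroup D (magnus k)" "magnus_x k \<in> D" "magnus_y k \<in> D"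
    and ij: "i < j" "j < 2 ^ k"
  shows "(\<one>\<^bsub>W_level k\<^esub>, {(int i, int j), (int j, int i)}) \<in> D"
proof -
  define e where "e l = ((ind k {int l}, 0 :: int), {} :: (int \<times> int) set)" for l
  have eD: "e i \<in> D" "e j \<in> D" using magnus_base_mem[OF k D] ij by (auto simp: e_def)
  have "int i < int (2 ^ k)" "int j < int (2 ^ k)" using ij by (simp_all only: of_nat_less_iff)
  then have n: "int i \<in> Zn k" "int j \<in> Zn k" by simp_all
  let ?w = "(ind k {int i, int j}, 0 :: int)"
  have prod: "e a \<otimes>\<^bsub>magnus k\<^esub> e b = (?w, {(int a, int b)})"
    if ab: "a \<noteq> b" "{a, b} = {i, j}" "int a \<in> Zn k" "int b \<in> Zn k" for a b
  proof -
    have "{int a} - {int b} \<union> ({int b} - {int a}) = {int i, int j}"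
    proof -
      have "{int a} - {int b} \<union> ({int b} - {int a}) = int ` {a, b}" using ab(1) by auto
      then show ?thesis unfolding ab(2) by simp
    qed
    moreover have "{(m, l) \<in> Zn k \<times> Zn k. ((m, l) \<in> {}) \<noteq>
        ((((m + 0) mod 2 ^ k, (l + 0) mod 2 ^ k) \<in> {}) \<noteq>
        (ind k {int a} m = 1 \<and> ind k {int b} ((l + 0) mod 2 ^ k) = 1))} = {(int a, int b)}"
    proof -
      have "{(m, l) \<in> Zn k \<times> Zn k. ((m, l) \<in> {}) \<noteq>
        ((((m + 0) mod 2 ^ k, (l + 0) mod 2 ^ k) \<in> {}) \<noteq>
        (ind k {int a} m = 1 \<and> ind k {int b} ((l + 0) mod 2 ^ k) = 1))} =
        {(m, l) \<in> Zn k \<times> Zn k. m = int a \<and> l = int b}"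
        by (rule Collect_pair_cong) (simp add: ind_apply)
      also have "\<dots> = {(int a, int b)}" using ab(3,4) by blast
      finally show ?thesis .
    qed
    ultimately show ?thesis by (simp only: e_def mult_magnus base_mult fst_conv snd_conv)
  qed
  have 1: "e i \<otimes>\<^bsub>magnus k\<^esub> e j = (?w, {(int i, int j)})" using ij n by (intro prod) auto
  have 2: "e j \<otimes>\<^bsub>magnus k\<^esub> e i = (?w, {(int j, int i)})" using ij n by (intro prod) auto
  let ?z = "(\<one>\<^bsub>W_level k\<^esub>, {(int i, int j), (int j, int i)})"
  have wc: "?w \<in> carrier (W_level k)" unfolding carrier_W_level by (intro SigmaI ind_closed) simp
  have "{(m, l) \<in> Zn k \<times> Zn k. ((m, l) \<in> {(int j, int i)}) \<noteq>
      ((((m + 0) mod 2 ^ k, (l + 0) mod 2 ^ k) \<in> {(int i, int j), (int j, int i)}) \<noteq>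
      (ind k {int i, int j} m = 1 \<and> ind k {} ((l + 0) mod 2 ^ k) = 1))} = {(int i, int j)}"
  proof -
    have "{(m, l) \<in> Zn k \<times> Zn k. ((m, l) \<in> {(int j, int i)}) \<noteq>
      ((((m + 0) mod 2 ^ k, (l + 0) mod 2 ^ k) \<in> {(int i, int j), (int j, int i)}) \<noteq>
      (ind k {int i, int j} m = 1 \<and> ind k {} ((l + 0) mod 2 ^ k) = 1))} =
      {(m, l) \<in> Zn k \<times> Zn k. m = int i \<and> l = int j}"
    proof (rule Collect_pair_cong)
      fix m l assume "m \<in> Zn k" "l \<in> Zn k"
      then have "(m + 0) mod 2 ^ k = m" "(l + 0) mod 2 ^ k = l" "ind k {} l = 0" by (simp_all add: ind_apply)
      moreover have "((m, l) = (int j, int i)) \<noteq> ((m, l) = (int i, int j) \<or> (m, l) = (int j, int i)) \<longleftrightarrow>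
          m = int i \<and> l = int j"
      proof -
        have ne: "int i \<noteq> int j" using ij by simp
        show ?thesis
        proof (cases "m = int j \<and> l = int i")
          case True
          then show ?thesis using ne by (metis prod.inject)
        next
          case False
          then show ?thesis by (simp only: prod.inject) blast
        qed
      qed
      ultimately show "(((m, l) \<in> {(int j, int i)}) \<noteq>
      ((((m + 0) mod 2 ^ k, (l + 0) mod 2 ^ k) \<in> {(int i, int j), (int j, int i)}) \<noteq>
      (ind k {int i, int j} m = 1 \<and> ind k {} ((l + 0) mod 2 ^ k) = 1))) \<longleftrightarrow> m = int i \<and> l = int j"
        by (simp only: insert_iff empty_iff) simp
    qed
    also have "\<dots> = {(int i, int j)}" using n by blast
    finally show ?thesis .
  qed
  then have "(?w, {(int j, int i)}) \<otimes>\<^bsub>magnus k\<^esub> ?z = (?w \<otimes>\<^bsub>W_level k\<^esub> \<one>\<^bsub>W_level k\<^esub>, {(int i, int j)})"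
    by (simp only: mult_magnus one_W_level fst_conv snd_conv)
  then have 3: "(e j \<otimes>\<^bsub>magnus k\<^esub> e i) \<otimes>\<^bsub>magnus k\<^esub> ?z = e i \<otimes>\<^bsub>magnus k\<^esub> e j"
    unfolding 1 2 using wc by simp
  have zc: "?z \<in> carrier (magnus k)" using n by (simp add: carrier_magnus)
  have ec: "e i \<in> carrier (magnus k)" "e j \<in> carrier (magnus k)" using eD subgroup.mem_carrier[OF D(1)] by auto
  have "?z = inv\<^bsub>magnus k\<^esub> (e j \<otimes>\<^bsub>magnus k\<^esub> e i) \<otimes>\<^bsub>magnus k\<^esub> (e i \<otimes>\<^bsub>magnus k\<^esub> e j)"
    unfolding 3[symmetric] using zc ec magnus.m_closed magnus.mult_inv_cancel(2) by metis
  then show ?thesis using eD D(1) by (simp add: subgroup.m_closed subgroup.m_inv_closed)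
qed

text \<open>The product of the commutators over a set of pairs has as degree 2 part the symmetric
  set of these pairs. The pairs are read off again below the diagonal, so all subsets of pairs give
  different elements.\<close>

lemma magnus_card_le:
  assumes k: "1 \<le> k" and D: "subgroup D (magnus k)" "magnus_x k \<in> D" "magnus_y k \<in> D"
  shows "2 ^ (2 ^ k * (2 ^ k - 1) div 2) \<le> card D"
proof -
  define n where "n = (2::nat) ^ k"
  \<comment> \<open>The larger index comes first, so that the cardinality is the sum of all
    \<open>j < n\<close>.\<close>
  define U where "U = (SIGMA j:{..<n}. {..<j})"
  define sy where "sy P = (\<lambda>(j, i). (int i, int j)) ` P \<union> (\<lambda>(j, i). (int j, int i)) ` P" for P :: "(nat \<times> nat) set"
  have Zn: "int j \<in> Zn k" if "j < n" for j
  proof -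
    have "int j < int (2 ^ k)" using that by (simp only: of_nat_less_iff n_def)
    then show ?thesis by simp
  qed
  have fin: "finite U" by (auto simp: U_def)
  have "card U = (\<Sum>j<n. j)" by (simp add: U_def)
  also have "\<dots> = n * (n - 1) div 2"
  proof -
    obtain m where m: "n = Suc m" by (cases n) (auto simp: n_def)
    show ?thesis using gauss_sum_nat[of m] by (simp add: m lessThan_Suc_atMost atMost_atLeast0 mult.commute)
  qed
  finally have card: "card U = n * (n - 1) div 2" .
  have mem: "(\<one>\<^bsub>W_level k\<^esub>, sy P) \<in> D" if "finite P" "P \<subseteq> U" for P
    using that
  proof (induction rule: finite_induct)
    case empty
    then show ?case using subgroup.one_closed[OF D(1)] by (simp add: sy_def one_magnus)
  next
    case (insert a P)
    obtain j i where a: "a = (j, i)" "i < j" "j < n" using insert by (auto simp: U_def)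
    have PU: "P \<subseteq> U" using insert by auto
    have subP: "sy P \<subseteq> Zn k \<times> Zn k"
    proof
      fix p assume "p \<in> sy P"
      then obtain j i where "(j, i) \<in> U" "p = (int i, int j) \<or> p = (int j, int i)"
        using PU by (auto simp: sy_def)
      moreover from this have "j < n" "i < n" by (auto simp: U_def)
      ultimately show "p \<in> Zn k \<times> Zn k" using Zn by auto
    qed
    have sa: "{(int i, int j), (int j, int i)} \<subseteq> Zn k \<times> Zn k" using a Zn[of i] Zn[of j] by auto
    have disj: "sy P \<inter> {(int i, int j), (int j, int i)} = {}"
    proof -
      have "(i, j) \<notin> P" using PU a by (auto simp: U_def)
      then show ?thesis using insert.hyps a by (auto simp: sy_def)
    qed
    have "(\<one>\<^bsub>W_level k\<^esub>, sy P) \<otimes>\<^bsub>magnus k\<^esub> (\<one>\<^bsub>W_level k\<^esub>, {(int i, int j), (int j, int i)}) \<in> D"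
      using insert.IH[OF PU] magnus_commutator_mem[OF k D a(2)] a(3) D(1) by (simp add: subgroup.m_closed n_def)
    also have "(\<one>\<^bsub>W_level k\<^esub>, sy P) \<otimes>\<^bsub>magnus k\<^esub> (\<one>\<^bsub>W_level k\<^esub>, {(int i, int j), (int j, int i)}) =
        (\<one>\<^bsub>W_level k\<^esub>, sy (insert a P))"
      unfolding magnus_kernel_mult[OF subP sa] using disj by (auto simp: sy_def a)
    finally show ?case .
  qed
  have "inj_on (\<lambda>P. (\<one>\<^bsub>W_level k\<^esub>, sy P)) (Pow U)"
  proof (rule inj_onI)
    fix P Q assume PQ: "P \<in> Pow U" "Q \<in> Pow U" "(\<one>\<^bsub>W_level k\<^esub>, sy P) = (\<one>\<^bsub>W_level k\<^esub>, sy Q)"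
    have rec: "P = {(j, i) \<in> U. (int j, int i) \<in> sy P}" if "P \<subseteq> U" for P
      using that by (fastforce simp: sy_def U_def)
    show "P = Q" using rec[of P] rec[of Q] PQ by auto
  qed
  moreover have "(\<lambda>P. (\<one>\<^bsub>W_level k\<^esub>, sy P)) ` Pow U \<subseteq> D"
    using mem finite_subset[OF _ fin] by auto
  moreover have "finite D" using subgroup.subset[OF D(1)] card_magnus(2) finite_subset by blast
  ultimately have "card (Pow U) \<le> card D" by (rule card_inj_on_le)
  then show ?thesis using fin card by (simp add: card_Pow n_def)
qed


section \<open>The inverse limit of the wreath products\<close>

lemma W_limit_eq:
  "W_limit = (product_group {1..} W_level)\<lparr>carrier :=
     {w \<in> carrier (product_group {1..} W_level). \<forall>k\<ge>1. transition k (w (Suc k)) = w k}\<rparr>"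
  by (simp add: W_limit_def Let_def W_transition_eq cong: conj_cong)

lemma carrier_W_limit:
  "w \<in> carrier W_limit \<longleftrightarrow> w \<in> extensional {1..} \<and> (\<forall>k\<ge>1. w k \<in> carrier (W_level k)) \<and>
    (\<forall>k\<ge>1. transition k (w (Suc k)) = w k)"
  by (auto simp: W_limit_eq PiE_iff)

lemma mult_W_limit: "k \<ge> 1 \<Longrightarrow> (v \<otimes>\<^bsub>W_limit\<^esub> w) k = v k \<otimes>\<^bsub>W_level k\<^esub> w k"
  by (simp add: W_limit_eq)

lemma one_W_limit: "\<one>\<^bsub>W_limit\<^esub> = (\<lambda>k\<in>{1..}. \<one>\<^bsub>W_level k\<^esub>)"
  by (simp add: W_limit_eq)

lemma group_hom_transition: "group_hom (W_level (Suc k)) (W_level k) (transition k)"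
  using transition_hom by (simp add: group_hom_def group_hom_axioms_def W_level.group_axioms)

lemma group_W_limit: "group W_limit"
proof -
  let ?P = "product_group {1..} W_level"
  have P: "group ?P" using W_level.group_axioms by (intro product_group)
  let ?S = "{w \<in> carrier ?P. \<forall>k\<ge>1. transition k (w (Suc k)) = w k}"
  have "subgroup ?S ?P"
  proof (rule group.subgroupI[OF P])
    have "\<one>\<^bsub>?P\<^esub> \<in> ?S" using group_hom.hom_one[OF group_hom_transition] by (auto simp: PiE_iff)
    then show "?S \<noteq> {}" by blast
    show "inv\<^bsub>?P\<^esub> w \<in> ?S" if w: "w \<in> ?S" for w
    proof -
      have c: "w k \<in> carrier (W_level k)" if "k \<ge> 1" for k using w that by (auto simp: PiE_iff)
      have "inv\<^bsub>?P\<^esub> w = (\<lambda>k\<in>{1..}. inv\<^bsub>W_level k\<^esub> w k)"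
        using w W_level.group_axioms by (intro inv_product_group) auto
      moreover have "transition k (inv\<^bsub>W_level (Suc k)\<^esub> w (Suc k)) = inv\<^bsub>W_level k\<^esub> w k" if "k \<ge> 1" for k
        using group_hom.hom_inv[OF group_hom_transition c[of "Suc k"]] w that by simp
      ultimately show ?thesis using c by (auto simp: PiE_iff)
    qed
    show "v \<otimes>\<^bsub>?P\<^esub> w \<in> ?S" if vw: "v \<in> ?S" "w \<in> ?S" for v w
    proof -
      have c: "v k \<in> carrier (W_level k)" "w k \<in> carrier (W_level k)" if "k \<ge> 1" for k
        using vw that by (auto simp: PiE_iff)
      have "transition k (v (Suc k) \<otimes>\<^bsub>W_level (Suc k)\<^esub> w (Suc k)) = v k \<otimes>\<^bsub>W_level k\<^esub> w k" if "k \<ge> 1" for k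
        using hom_mult[OF transition_hom c[of "Suc k"]] vw that by simp
      then show ?thesis using c by (auto simp: PiE_iff)
    qed
  qed auto
  then show ?thesis unfolding W_limit_eq by (rule subgroup.subgroup_is_group[OF _ P])
qed

interpretation W_limit: plain_group W_limit
  by (simp add: plain_group_def group_W_limit)

lemma projection_hom: "k \<ge> 1 \<Longrightarrow> group_hom W_limit (W_level k) (\<lambda>w. w k)"
  by (auto simp: group_hom_def group_hom_axioms_def group_W_limit W_level.group_axioms hom_def
      carrier_W_limit mult_W_limit)

lemma topspace_W_topology: "topspace W_topology = carrier W_limit"
  by (auto simp: W_topology_def top_level_def carrier_W_limit PiE_iff extensional_def)

lemma projection_continuous:
  "k \<ge> 1 \<Longrightarrow> continuous_map W_topology (top_level k) (\<lambda>w. w k)"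
  unfolding W_topology_def
  by (intro continuous_map_from_subtopology continuous_map_product_projection) simp

lemma x_limit_closed: "x_limit \<in> carrier W_limit"
  using x_level_closed transition_x by (auto simp: x_limit_def carrier_W_limit)

lemma y_limit_closed: "y_limit \<in> carrier W_limit"
  using y_level_closed transition_y by (auto simp: y_limit_def carrier_W_limit)

text \<open>The right-hand side is a closed subgroup containing the generators. Conversely, a basic
  neighbourhood of \<open>w\<close> restricts finitely many coordinates, and matching
  \<open>w\<close> at a single high one suffices, as the projected generators generate
  \<open>B_level\<close> there.\<close>

lemma B_limit_eq: "B_limit = {w \<in> carrier W_limit. \<forall>k\<ge>1. w k \<in> B_level k}"
proof
  let ?C = "{w \<in> carrier W_limit. \<forall>k\<ge>1. w k \<in> B_level k}"
  let ?S = "{group_conjugate W_limit y_limit (x_limit [^]\<^bsub>W_limit\<^esub> i) | i :: int. True}"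
  have SC: "?S \<subseteq> carrier W_limit"
    using x_limit_closed y_limit_closed by (auto simp: group_conjugate_def)
  have proj: "group_conjugate W_limit y_limit (x_limit [^]\<^bsub>W_limit\<^esub> i) k =
      group_conjugate (W_level k) (y_level k) (x_level k [^]\<^bsub>W_level k\<^esub> i)" if k: "k \<ge> 1" for k and i :: int
  proof -
    interpret p: group_hom W_limit "W_level k" "\<lambda>w. w k" using projection_hom[OF k] .
    have xy: "x_limit k = x_level k" "y_limit k = y_level k" using k by (auto simp: x_limit_def y_limit_def)
    have xi: "(x_limit [^]\<^bsub>W_limit\<^esub> i) k = x_level k [^]\<^bsub>W_level k\<^esub> i"
      using p.hom_int_pow[OF x_limit_closed] xy by simp
    have c: "x_limit [^]\<^bsub>W_limit\<^esub> i \<in> carrier W_limit" using x_limit_closed by simp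
    show ?thesis unfolding group_conjugate_def
      using p.hom_mult p.hom_inv[OF c] c y_limit_closed by (simp add: xi xy)
  qed
  show "B_limit \<subseteq> ?C"
    unfolding B_limit_def closed_generate_def
  proof (rule closure_of_minimal)
    have C_eq: "?C = (\<Inter>k\<in>{1..}. {w \<in> topspace W_topology. w k \<in> B_level k})"
      by (auto simp: topspace_W_topology)
    have "closedin (top_level k) (B_level k)" for k
      by (auto simp: top_level_def B_level_def)
    then show "closedin W_topology ?C"
      unfolding C_eq using closedin_continuous_map_preimage[OF projection_continuous]
      by (intro closedin_INT) auto
    have "subgroup ?C W_limit"
    proof -
      have "subgroup {w \<in> carrier W_limit. w k \<in> B_level k} W_limit" if "k \<ge> 1" for k
        using subgroup_preimage[OF projection_hom[OF that] normal_imp_subgroup[OF B_level_normal]] .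
      moreover have "?C = (\<Inter>k\<in>{1..}. {w \<in> carrier W_limit. w k \<in> B_level k})" by auto
      ultimately show ?thesis using W_limit.subgroups_Inter[of "(\<lambda>k. {w \<in> carrier W_limit. w k \<in> B_level k}) ` {1..}"]
        by auto
    qed
    moreover have "?S \<subseteq> ?C"
    proof
      fix w assume w: "w \<in> ?S"
      then obtain i :: int where i: "w = group_conjugate W_limit y_limit (x_limit [^]\<^bsub>W_limit\<^esub> i)" by blast
      have "w k \<in> B_level k" if k: "k \<ge> 1" for k
      proof -
        have "y_level k \<in> B_level k" by (simp add: B_level_def y_level_closed) (simp add: y_level_eq)
        then show ?thesis unfolding i proj[OF k] unfolding group_conjugate_def
          using x_level_closed[OF k] by (intro normal.inv_op_closed1[OF B_level_normal] W_level.int_pow_closed)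
      qed
      then show "w \<in> ?C" using w SC by blast
    qed
    ultimately show "generate W_limit ?S \<subseteq> ?C" using W_limit.generate_subgroup_incl by blast
  qed
  show "?C \<subseteq> B_limit"
  proof
    fix w assume w: "w \<in> ?C"
    have wc: "w \<in> carrier W_limit" using w by blast
    have "\<exists>v. v \<in> generate W_limit ?S \<and> v \<in> U" if U: "w \<in> U" "openin W_topology U" for U
    proof -
      obtain V where V: "openin (product_topology top_level {1..}) V" "U = V \<inter> carrier W_limit"
        using U(2) by (auto simp: W_topology_def openin_subtopology)
      then obtain A where A: "finite {i \<in> {1..}. A i \<noteq> topspace (top_level i)}"
        "w \<in> PiE {1..} A" "PiE {1..} A \<subseteq> V"
        using U(1) openin_product_topology_alt[of top_level "{1..}" V] by auto
      \<comment> \<open>Beyond \<open>K\<close> the neighbourhood imposes no restriction; the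
        inserted 1 keeps the set nonempty and \<open>K\<close> in the index range.\<close>
      define K where "K = Max (insert 1 {i \<in> {1..}. A i \<noteq> topspace (top_level i)})"
      have K1: "K \<ge> 1" unfolding K_def using A(1) by (intro Max_ge) auto
      have KA: "A i = topspace (top_level i)" if "i > K" for i
      proof (rule ccontr)
        assume "A i \<noteq> topspace (top_level i)"
        then have "i \<le> K" unfolding K_def using A(1) that K1 by (intro Max_ge) auto
        then show False using that by simp
      qed
      interpret p: group_hom W_limit "W_level K" "\<lambda>w. w K" using projection_hom[OF K1] .
      have "w K \<in> generate (W_level K) {group_conjugate (W_level K) (y_level K) (x_level K [^]\<^bsub>W_level K\<^esub> i) | i :: int. True}"
        using w K1 B_level_generate[OF K1] by blast
      also have "{group_conjugate (W_level K) (y_level K) (x_level K [^]\<^bsub>W_level K\<^esub> i) | i :: int. True} = (\<lambda>w. w K) ` ?S"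
        using proj[OF K1] by (auto simp: image_iff) metis+
      also have "generate (W_level K) ((\<lambda>w. w K) ` ?S) = (\<lambda>w. w K) ` generate W_limit ?S"
        using p.generate_img[OF SC] .
      finally obtain v where v: "v \<in> generate W_limit ?S" "v K = w K" by auto
      have vc: "v \<in> carrier W_limit" using v(1) W_limit.generate_incl[OF SC] by blast
      \<comment> \<open>Agreement at \<open>K\<close> passes down along the transition maps, by
        induction on the distance to \<open>K\<close>.\<close>
      have desc: "v (K - d) = w (K - d)" if "d < K" for d
        using that
      proof (induction d)
        case (Suc d)
        then have e: "Suc (K - Suc d) = K - d" "1 \<le> K - Suc d" by auto
        have "transition (K - Suc d) (v (Suc (K - Suc d))) = v (K - Suc d)"
          "transition (K - Suc d) (w (Suc (K - Suc d))) = w (K - Suc d)"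
          using vc wc e(2) carrier_W_limit by auto
        then show ?case using Suc e(1) by simp
      qed (use v in simp)
      have low: "v i = w i" if "1 \<le> i" "i \<le> K" for i
      proof -
        have "K - i < K" "K - (K - i) = i" using that by auto
        then show ?thesis using desc[of "K - i"] by simp
      qed
      have "v i \<in> A i" if "1 \<le> i" for i
      proof (cases "i \<le> K")
        case True
        then show ?thesis using low[OF that] A(2) that by auto
      next
        case False
        then show ?thesis using KA[of i] vc that by (simp add: top_level_def carrier_W_limit)
      qed
      then have "v \<in> PiE {1..} A" using vc by (auto simp: PiE_iff carrier_W_limit)
      then show ?thesis using v(1) vc A(3) V(2) by blast
    qed
    then show "w \<in> B_limit"
      unfolding B_limit_def closed_generate_def in_closure_of using wc by (auto simp: topspace_W_topology)
  qed
qed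

section \<open>Homomorphisms from the free pro-2 group\<close>

locale free_pro_two =
  fixes F :: "'a monoid" and T :: "'a topology" and a b :: 'a
  assumes free: "free_pro_p_group 2 F T a b"
begin

lemma topological_group_F: "topological_group F T" and compact_F: "compact_space T"
  and Hausdorff_F: "Hausdorff_space T" and a_closed: "a \<in> carrier F" and b_closed: "b \<in> carrier F"
  and dense_F: "closed_generate F T {a, b} = carrier F"
  using free by (auto simp: free_pro_p_group_def pro_p_group_def profinite_group_def)

sublocale F: semitopological_group F T
  using topological_group_F by (rule topological_group_semitopological)

text \<open>The set where the two maps agree is a closed subgroup containing \<open>a\<close> and
  \<open>b\<close>.\<close>

lemma hom_unique:
  fixes H :: "'c monoid"
  assumes H: "group H" and \<phi>: "\<phi> \<in> hom F H" "continuous_map T (discrete_topology (carrier H)) \<phi>"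
    and \<psi>: "\<psi> \<in> hom F H" "continuous_map T (discrete_topology (carrier H)) \<psi>"
    and eq: "\<phi> a = \<psi> a" "\<phi> b = \<psi> b" and g: "g \<in> carrier F"
  shows "\<phi> g = \<psi> g"
proof -
  interpret p: group_hom F H \<phi> using H \<phi> F.group_axioms by (simp add: group_hom_def group_hom_axioms_def)
  interpret q: group_hom F H \<psi> using H \<psi> F.group_axioms by (simp add: group_hom_def group_hom_axioms_def)
  let ?E = "{g \<in> topspace T. \<phi> g = \<psi> g}"
  have "closedin T ?E" using closedin_continuous_maps_eq[OF Hausdorff_space_discrete_topology \<phi>(2) \<psi>(2)] .
  moreover have "subgroup ?E F"
  proof (rule F.subgroupI)
    have "\<one>\<^bsub>F\<^esub> \<in> ?E" by (simp add: F.topspace_eq)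
    then show "?E \<noteq> {}" by blast
  qed (auto simp: F.topspace_eq)
  ultimately have "closed_generate F T {a, b} \<subseteq> ?E"
    using eq a_closed b_closed by (intro F.closed_generate_minimal) (auto simp: F.topspace_eq)
  then show ?thesis using g dense_F by auto
qed

text \<open>Freeness speaks of finite 2-groups carried by \<open>nat\<close>; the target is copied
  there along an enumeration of its carrier.\<close>

lemma hom_exists:
  fixes H :: "'c monoid"
  assumes H: "group H" "finite (carrier H)" "card (carrier H) = 2 ^ n" and xy: "x \<in> carrier H" "y \<in> carrier H"
  shows "\<exists>\<phi>\<in>hom F H. continuous_map T (discrete_topology (carrier H)) \<phi> \<and> \<phi> a = x \<and> \<phi> b = y"
proof -
  interpret H: group H by fact
  obtain e :: "'c \<Rightarrow> nat" where e: "bij_betw e (carrier H) {0..<card (carrier H)}"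
    using ex_bij_betw_finite_nat[OF H(2)] by blast
  then have inj: "inj_on e (carrier H)" by (simp add: bij_betw_def)
  define d where "d = inv_into (carrier H) e"
  have de: "d (e h) = h" if "h \<in> carrier H" for h using inj that by (simp add: d_def)
  define N where "N = \<lparr>carrier = e ` carrier H, monoid.mult = (\<lambda>i j. e (d i \<otimes>\<^bsub>H\<^esub> d j)), one = e \<one>\<^bsub>H\<^esub>\<rparr>"
  have "group N"
  proof (rule groupI)
    fix i assume "i \<in> carrier N"
    then obtain h where h: "h \<in> carrier H" "i = e h" by (auto simp: N_def)
    show "\<exists>j\<in>carrier N. j \<otimes>\<^bsub>N\<^esub> i = \<one>\<^bsub>N\<^esub>"
      using h by (intro bexI[of _ "e (inv\<^bsub>H\<^esub> h)"]) (auto simp: N_def de)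
  qed (auto simp: N_def de H.m_assoc)
  moreover have "order N = 2 ^ n" using card_image[OF inj] H(3) by (simp add: order_def N_def)
  moreover have "e x \<in> carrier N" "e y \<in> carrier N" using xy by (auto simp: N_def)
  ultimately obtain \<phi> where \<phi>: "\<phi> \<in> hom F N" "continuous_map T (discrete_topology (carrier N)) \<phi>"
    "\<phi> a = e x" "\<phi> b = e y"
    using free unfolding free_pro_p_group_def by blast
  have "d \<in> hom N H" by (auto simp: hom_def N_def de)
  then have "d \<circ> \<phi> \<in> hom F H" using \<phi>(1) by (simp add: hom_compose)
  moreover have "continuous_map (discrete_topology (carrier N)) (discrete_topology (carrier H)) d"
    by (auto simp: N_def de)
  then have "continuous_map T (discrete_topology (carrier H)) (d \<circ> \<phi>)"
    using continuous_map_compose[OF \<phi>(2)] by blast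
  ultimately show ?thesis using \<phi>(3,4) xy de by (intro bexI[of _ "d \<circ> \<phi>"]) auto
qed

abbreviation lev :: "nat \<Rightarrow> 'a \<Rightarrow> (int \<Rightarrow> int) \<times> int" where "lev k \<equiv> to_W_level F T a b k"

lemma lev_props:
  assumes k: "k \<ge> 1"
  shows "lev k \<in> hom F (W_level k)" "continuous_map T (top_level k) (lev k)"
    "lev k a = x_level k" "lev k b = y_level k"
proof -
  obtain n where n: "card (carrier (W_level k)) = 2 ^ n" using card_W_level by blast
  obtain \<phi> where \<phi>: "\<phi> \<in> hom F (W_level k)" "continuous_map T (top_level k) \<phi>"
    "\<phi> a = x_level k" "\<phi> b = y_level k"
    using hom_exists[OF W_level.group_axioms finite_W_level n x_level_closed[OF k] y_level_closed]
    unfolding top_level_def by blast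
  \<comment> \<open>\<open>gen_hom\<close> selects among maps that are extensional on the
    carrier.\<close>
  let ?\<phi> = "restrict \<phi> (carrier F)"
  have h: "?\<phi> \<in> hom F (W_level k)" using \<phi>(1) by (auto simp: hom_def)
  have c: "continuous_map T (top_level k) ?\<phi>"
    using \<phi>(2) by (rule continuous_map_eq) (simp add: F.topspace_eq)
  have "lev k = ?\<phi>"
    unfolding to_W_level_def gen_hom_def
  proof (rule the_equality)
    show "?\<phi> \<in> hom F (W_level k) \<inter> extensional (carrier F) \<and> continuous_map T (top_level k) ?\<phi> \<and>
        ?\<phi> a = x_level k \<and> ?\<phi> b = y_level k"
      using h c \<phi> a_closed b_closed by simp
    fix \<psi> assume \<psi>: "\<psi> \<in> hom F (W_level k) \<inter> extensional (carrier F) \<and> continuous_map T (top_level k) \<psi> \<and>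
        \<psi> a = x_level k \<and> \<psi> b = y_level k"
    have "\<psi> g = ?\<phi> g" if g: "g \<in> carrier F" for g
    proof (rule hom_unique[OF W_level.group_axioms _ _ h _ _ _ g])
      show "\<psi> \<in> hom F (W_level k)" using \<psi> by blast
      show "continuous_map T (discrete_topology (carrier (W_level k))) \<psi>"
        using \<psi> unfolding top_level_def by blast
      show "continuous_map T (discrete_topology (carrier (W_level k))) ?\<phi>"
        using c unfolding top_level_def .
      show "\<psi> a = ?\<phi> a" "\<psi> b = ?\<phi> b" using \<psi> \<phi>(3,4) a_closed b_closed by simp_all
    qed
    then show "\<psi> = ?\<phi>" using \<psi> by (intro extensionalityI[of _ "carrier F"]) auto
  qed
  then show "lev k \<in> hom F (W_level k)" "continuous_map T (top_level k) (lev k)"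
    "lev k a = x_level k" "lev k b = y_level k" using h c \<phi>(3,4) a_closed b_closed by auto
qed

lemma lev_unique:
  assumes "k \<ge> 1" "\<psi> \<in> hom F (W_level k)" "continuous_map T (top_level k) \<psi>"
    "\<psi> a = x_level k" "\<psi> b = y_level k" "g \<in> carrier F"
  shows "\<psi> g = lev k g"
proof (rule hom_unique[OF W_level.group_axioms assms(2) _ lev_props(1)[OF assms(1)] _ _ _ assms(6)])
  show "continuous_map T (discrete_topology (carrier (W_level k))) \<psi>"
    using assms(3) unfolding top_level_def .
  show "continuous_map T (discrete_topology (carrier (W_level k))) (lev k)"
    using lev_props(2)[OF assms(1)] unfolding top_level_def .
  show "\<psi> a = lev k a" "\<psi> b = lev k b" using assms(4,5) lev_props(3,4)[OF assms(1)] by simp_all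
qed

lemma lev_hom: "k \<ge> 1 \<Longrightarrow> group_hom F (W_level k) (lev k)"
  using lev_props by (simp add: group_hom_def group_hom_axioms_def W_level.group_axioms F.group_axioms)

lemma transition_lev:
  assumes k: "k \<ge> 1" and g: "g \<in> carrier F"
  shows "transition k (lev (Suc k) g) = lev k g"
proof -
  have "(transition k \<circ> lev (Suc k)) g = lev k g"
  proof (rule lev_unique[OF k _ _ _ _ g])
    show "transition k \<circ> lev (Suc k) \<in> hom F (W_level k)"
      using lev_props(1)[of "Suc k"] transition_hom by (simp add: hom_compose)
    have "continuous_map (top_level (Suc k)) (top_level k) (transition k)"
      using hom_in_carrier[OF transition_hom] by (auto simp: top_level_def)
    then show "continuous_map T (top_level k) (transition k \<circ> lev (Suc k))"
      using continuous_map_compose[OF lev_props(2)[of "Suc k"]] by simp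
  qed (use lev_props[of "Suc k"] transition_x[OF k] transition_y in auto)
  then show ?thesis by simp
qed

text \<open>Each coordinate of a candidate map is determined by the images of \<open>a\<close> and
  \<open>b\<close>, so the definite description is the tuple of level maps. From here on
  \<open>R\<close> and \<open>Y\<close> are treated level by level.\<close>

lemma to_W_eq:
  assumes g: "g \<in> carrier F"
  shows "to_W F T a b g = (\<lambda>k\<in>{1..}. lev k g)"
proof -
  let ?\<phi> = "\<lambda>g\<in>carrier F. \<lambda>k\<in>{1..}. lev k g"
  have car: "(\<lambda>k\<in>{1..}. lev k g) \<in> carrier W_limit" if "g \<in> carrier F" for g
    using that hom_in_carrier[OF lev_props(1)] transition_lev by (auto simp: carrier_W_limit)
  have h: "?\<phi> \<in> hom F W_limit"
  proof (rule homI)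
    fix g h assume gh: "g \<in> carrier F" "h \<in> carrier F"
    have "?\<phi> (g \<otimes>\<^bsub>F\<^esub> h) = (\<lambda>k\<in>{1..}. lev k g \<otimes>\<^bsub>W_level k\<^esub> lev k h)"
      using gh hom_mult[OF lev_props(1)] by (auto intro!: restrict_ext)
    also have "\<dots> = ?\<phi> g \<otimes>\<^bsub>W_limit\<^esub> ?\<phi> h"
      using gh by (auto simp: W_limit_eq intro!: restrict_ext)
    finally show "?\<phi> (g \<otimes>\<^bsub>F\<^esub> h) = ?\<phi> g \<otimes>\<^bsub>W_limit\<^esub> ?\<phi> h" .
  qed (use car in auto)
  have "to_W F T a b = ?\<phi>"
    unfolding to_W_def gen_hom_def
  proof (rule the_equality)
    have "continuous_map T (product_topology top_level {1..}) ?\<phi>"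
      unfolding continuous_map_componentwise
    proof (intro conjI ballI)
      fix k :: nat assume k: "k \<in> {1..}"
      then have "continuous_map T (top_level k) (lev k)" using lev_props by simp
      then show "continuous_map T (top_level k) (\<lambda>x. ?\<phi> x k)"
        by (rule continuous_map_eq) (use k in \<open>simp add: F.topspace_eq\<close>)
    qed (auto simp: F.topspace_eq)
    then have "continuous_map T W_topology ?\<phi>"
      unfolding W_topology_def using car
      by (intro continuous_map_into_subtopology) (auto simp: F.topspace_eq)
    then show "?\<phi> \<in> hom F W_limit \<inter> extensional (carrier F) \<and> continuous_map T W_topology ?\<phi> \<and>
        ?\<phi> a = x_limit \<and> ?\<phi> b = y_limit"
      using h a_closed b_closed lev_props(3,4)
      by (auto simp: x_limit_def y_limit_def intro!: restrict_ext)
    fix \<psi> assume \<psi>: "\<psi> \<in> hom F W_limit \<inter> extensional (carrier F) \<and> continuous_map T W_topology \<psi> \<and>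
        \<psi> a = x_limit \<and> \<psi> b = y_limit"
    have "\<psi> g k = lev k g" if g: "g \<in> carrier F" and k: "k \<ge> 1" for g k
    proof -
      have "((\<lambda>w. w k) \<circ> \<psi>) g = lev k g"
      proof (rule lev_unique[OF k _ _ _ _ g])
        show "(\<lambda>w. w k) \<circ> \<psi> \<in> hom F (W_level k)"
          using \<psi> group_hom.homh[OF projection_hom[OF k]] hom_compose by blast
        show "continuous_map T (top_level k) ((\<lambda>w. w k) \<circ> \<psi>)"
          using \<psi> continuous_map_compose projection_continuous[OF k] by blast
      qed (use \<psi> k in \<open>auto simp: x_limit_def y_limit_def\<close>)
      then show ?thesis by simp
    qed
    moreover have "\<psi> g \<in> extensional {1..}" if "g \<in> carrier F" for g
      using \<psi> that hom_in_carrier[of \<psi> F W_limit g] by (auto simp: carrier_W_limit)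
    ultimately have "\<psi> g = ?\<phi> g" if "g \<in> carrier F" for g
      using that by (intro extensionalityI[of _ "{1..}"]) auto
    then show "\<psi> = ?\<phi>" using \<psi> by (intro extensionalityI[of _ "carrier F"]) auto
  qed
  then show ?thesis using g by simp
qed

lemma R_sub_eq: "R_sub F T a b = {g \<in> carrier F. \<forall>k\<ge>1. lev k g = \<one>\<^bsub>W_level k\<^esub>}"
proof -
  have "to_W F T a b g = \<one>\<^bsub>W_limit\<^esub> \<longleftrightarrow> (\<forall>k\<ge>1. lev k g = \<one>\<^bsub>W_level k\<^esub>)" if g: "g \<in> carrier F" for g
  proof
    assume e: "to_W F T a b g = \<one>\<^bsub>W_limit\<^esub>"
    show "\<forall>k\<ge>1. lev k g = \<one>\<^bsub>W_level k\<^esub>"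
    proof (intro allI impI)
      fix k :: nat assume "1 \<le> k"
      then show "lev k g = \<one>\<^bsub>W_level k\<^esub>"
        using fun_cong[OF e, of k] unfolding to_W_eq[OF g] one_W_limit by simp
    qed
  next
    assume "\<forall>k\<ge>1. lev k g = \<one>\<^bsub>W_level k\<^esub>"
    then show "to_W F T a b g = \<one>\<^bsub>W_limit\<^esub>"
      unfolding to_W_eq[OF g] one_W_limit by (intro restrict_ext) simp
  qed
  then show ?thesis by (auto simp: R_sub_def kernel_def)
qed

lemma Y_sub_eq: "Y_sub F T a b = {g \<in> carrier F. \<forall>k\<ge>1. lev k g \<in> B_level k}"
proof -
  have "to_W F T a b g \<in> B_limit \<longleftrightarrow> (\<forall>k\<ge>1. lev k g \<in> B_level k)" if g: "g \<in> carrier F" for g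
  proof -
    have "(\<lambda>k\<in>{1..}. lev k g) \<in> carrier W_limit"
      using g hom_in_carrier[OF lev_props(1)] transition_lev by (auto simp: carrier_W_limit)
    then show ?thesis unfolding to_W_eq[OF g] B_limit_eq by auto
  qed
  then show ?thesis by (auto simp: Y_sub_def)
qed

lemma R_level_eq: "R_level F T a b k = {g \<in> carrier F. lev k g = \<one>\<^bsub>W_level k\<^esub>}"
  by (auto simp: R_level_def kernel_def)

lemma Y_level_eq: "Y_level F T a b k = {g \<in> carrier F. lev k g \<in> B_level k}"
  by (simp add: Y_level_def)

end


section \<open>Quotient topologies\<close>

context semitopological_group
begin

lemma openin_quotient:
  "openin (quotient_group_topology G T N) U \<longleftrightarrow>
    U \<subseteq> carrier (G Mod N) \<and> openin T {g \<in> carrier G. N #> g \<in> U}"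
proof -
  let ?L = "\<lambda>U. U \<subseteq> carrier (G Mod N) \<and> openin T {g \<in> carrier G. N #> g \<in> U}"
  have "istopology ?L"
    unfolding istopology_def
  proof (intro conjI allI impI)
    fix S U assume "?L S" "?L U"
    moreover have "{g \<in> carrier G. N #> g \<in> S \<inter> U} = {g \<in> carrier G. N #> g \<in> S} \<inter> {g \<in> carrier G. N #> g \<in> U}"
      by auto
    ultimately show "S \<inter> U \<subseteq> carrier (G Mod N)" "openin T {g \<in> carrier G. N #> g \<in> S \<inter> U}" by auto
  next
    fix \<K> assume K: "\<forall>K\<in>\<K>. ?L K"
    have "{g \<in> carrier G. N #> g \<in> \<Union>\<K>} = \<Union>((\<lambda>K. {g \<in> carrier G. N #> g \<in> K}) ` \<K>)" by auto
    moreover have "openin T (\<Union>((\<lambda>K. {g \<in> carrier G. N #> g \<in> K}) ` \<K>))"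
      using K by (intro openin_Union) auto
    ultimately show "openin T {g \<in> carrier G. N #> g \<in> \<Union>\<K>}" by simp
    show "\<Union>\<K> \<subseteq> carrier (G Mod N)" using K by blast
  qed
  then show ?thesis by (simp add: quotient_group_topology_def topology_inverse')
qed

lemma topspace_quotient: "topspace (quotient_group_topology G T N) = carrier (G Mod N)"
proof -
  have "{g \<in> carrier G. N #> g \<in> carrier (G Mod N)} = topspace T"
    by (auto simp: carrier_FactGroup topspace_eq)
  then have "openin (quotient_group_topology G T N) (carrier (G Mod N))"
    by (simp add: openin_quotient)
  then show ?thesis using openin_quotient openin_subset openin_topspace by (metis subset_antisym)
qed

lemma closedin_quotient:
  "closedin (quotient_group_topology G T N) C \<longleftrightarrow>
    C \<subseteq> carrier (G Mod N) \<and> closedin T {g \<in> carrier G. N #> g \<in> C}"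
proof -
  have "{g \<in> carrier G. N #> g \<in> carrier (G Mod N) - C} = topspace T - {g \<in> carrier G. N #> g \<in> C}"
    by (auto simp: carrier_FactGroup topspace_eq)
  then show ?thesis
    by (auto simp: closedin_def topspace_quotient openin_quotient topspace_eq)
qed

lemma compact_quotient:
  assumes "compact_space T"
  shows "compact_space (quotient_group_topology G T N)"
proof -
  have "continuous_map T (quotient_group_topology G T N) ((#>) N)"
    unfolding continuous_map_def
    by (auto simp: topspace_quotient openin_quotient topspace_eq carrier_FactGroup)
  then have "compactin (quotient_group_topology G T N) ((#>) N ` topspace T)"
    using assms image_compactin unfolding compact_space_def by blast
  then show ?thesis
    by (simp add: compact_space_def topspace_quotient carrier_FactGroup topspace_eq)
qed

lemma semitopological_quotient:
  assumes N: "N \<lhd> G"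
  shows "semitopological_group (G Mod N) (quotient_group_topology G T N)"
proof -
  let ?Q = "quotient_group_topology G T N"
  interpret q: group_hom G "G Mod N" "(#>) N" using group_hom_FactGroup[OF N] .
  \<comment> \<open>A map of the quotient induced by a continuous map of the group is continuous;
    translations and inversion are of this kind.\<close>
  have lift: "continuous_map ?Q ?Q f'"
    if f: "continuous_map T T f" and f': "\<And>g. g \<in> carrier G \<Longrightarrow> f' (N #> g) = N #> f g" for f f'
    unfolding continuous_map_def
  proof (intro conjI allI impI)
    have fc: "f g \<in> carrier G" if "g \<in> carrier G" for g
      using f that by (auto simp: continuous_map_def topspace_eq)
    show m: "f' \<in> topspace ?Q \<rightarrow> topspace ?Q"
      using f' fc by (auto simp: topspace_quotient carrier_FactGroup)
    fix U assume U: "openin ?Q U"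
    have "{g \<in> carrier G. N #> g \<in> {x \<in> topspace ?Q. f' x \<in> U}} =
        {g \<in> topspace T. f g \<in> {g \<in> carrier G. N #> g \<in> U}}"
      using f' fc by (auto simp: topspace_quotient carrier_FactGroup topspace_eq)
    moreover have "openin T {g \<in> topspace T. f g \<in> {g \<in> carrier G. N #> g \<in> U}}"
      using U f by (intro openin_continuous_map_preimage) (auto simp: openin_quotient)
    ultimately show "openin ?Q {x \<in> topspace ?Q. f' x \<in> U}"
      unfolding openin_quotient by (auto simp: topspace_quotient)
  qed
  show ?thesis
  proof (intro semitopological_group.intro semitopological_group_axioms.intro plain_group.intro)
    show "group (G Mod N)" by (rule q.H.group_axioms)
    show "topspace ?Q = carrier (G Mod N)" by (rule topspace_quotient)
    show "continuous_map ?Q ?Q (\<lambda>h. inv\<^bsub>G Mod N\<^esub> h)"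
      by (rule lift[OF inv_continuous]) simp
    fix C assume "C \<in> carrier (G Mod N)"
    then obtain g where g: "g \<in> carrier G" "C = N #> g" by (auto simp: carrier_FactGroup)
    show "continuous_map ?Q ?Q (\<lambda>h. C \<otimes>\<^bsub>G Mod N\<^esub> h)"
      by (rule lift[OF left_continuous[OF g(1)]]) (use g q.hom_mult in \<open>simp del: mult_FactGroup\<close>)
    show "continuous_map ?Q ?Q (\<lambda>h. h \<otimes>\<^bsub>G Mod N\<^esub> C)"
      by (rule lift[OF right_continuous[OF g(1)]]) (use g q.hom_mult in \<open>simp del: mult_FactGroup\<close>)
  qed
qed

text \<open>Reduces closedness of an image in the quotient to that of the product set
  \<open>N <#> K\<close>.\<close>

lemma coset_preimage_image:
  assumes N: "N \<lhd> G" and K: "K \<subseteq> carrier G"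
  shows "{g \<in> carrier G. N #> g \<in> (#>) N ` K} = N <#> K"
proof -
  have Ns: "subgroup N G" using N normal_imp_subgroup by blast
  show ?thesis
  proof
    show "{g \<in> carrier G. N #> g \<in> (#>) N ` K} \<subseteq> N <#> K"
    proof
      fix g assume "g \<in> {g \<in> carrier G. N #> g \<in> (#>) N ` K}"
      then obtain k where k: "g \<in> carrier G" "k \<in> K" "N #> g = N #> k" by auto
      then have "g \<in> N #> k" using rcos_self[OF k(1) Ns] by metis
      then show "g \<in> N <#> K" using k(2) by (auto simp: r_coset_def set_mult_def)
    qed
    show "N <#> K \<subseteq> {g \<in> carrier G. N #> g \<in> (#>) N ` K}"
    proof
      fix g assume "g \<in> N <#> K"
      then obtain n k where g: "n \<in> N" "k \<in> K" "g = n \<otimes> k" by (auto simp: set_mult_def)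
      have kc: "k \<in> carrier G" "n \<in> carrier G" using g K subgroup.mem_carrier[OF Ns] by auto
      have "g \<in> N #> k" using g by (auto simp: r_coset_def)
      then have "N #> g = N #> k" using repr_independence[OF _ kc(1) Ns] by metis
      then show "g \<in> {g \<in> carrier G. N #> g \<in> (#>) N ` K}" using g kc by auto
    qed
  qed
qed

end

section \<open>The group of the theorem\<close>

context free_pro_two
begin

abbreviation "R \<equiv> R_sub F T a b"
abbreviation "Y \<equiv> Y_sub F T a b"
abbreviation "N \<equiv> N_sub F T a b"
abbreviation "q \<equiv> (\<lambda>g. N #>\<^bsub>F\<^esub> g)"

lemma lev_preimage:
  assumes k: "k \<ge> 1" and K: "K \<lhd> W_level k"
  shows "{g \<in> carrier F. lev k g \<in> K} \<lhd> F" "closedin T {g \<in> carrier F. lev k g \<in> K}"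
proof -
  show "{g \<in> carrier F. lev k g \<in> K} \<lhd> F" by (rule normal_preimage[OF lev_hom[OF k] K])
  have "closedin (top_level k) K"
    using subgroup.subset[OF normal_imp_subgroup[OF K]] by (simp add: top_level_def)
  then show "closedin T {g \<in> carrier F. lev k g \<in> K}"
    using closedin_continuous_map_preimage[OF lev_props(2)[OF k]] by (simp add: F.topspace_eq)
qed

lemma level_sub_props:
  assumes k: "k \<ge> 1"
  shows "R_level F T a b k \<lhd> F" "Y_level F T a b k \<lhd> F"
  using lev_preimage(1)[OF k W_level.one_is_normal] lev_preimage(1)[OF k B_level_normal]
  by (simp_all add: R_level_eq Y_level_eq)

lemma R_eq_Inter: "R = \<Inter> ((\<lambda>k. {g \<in> carrier F. lev k g \<in> {\<one>\<^bsub>W_level k\<^esub>}}) ` {1..})"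
  by (auto simp: R_sub_eq)

lemma Y_eq_Inter: "Y = \<Inter> ((\<lambda>k. {g \<in> carrier F. lev k g \<in> B_level k}) ` {1..})"
  by (auto simp: Y_sub_eq)

lemma R_normal: "R \<lhd> F" and Y_normal: "Y \<lhd> F" and R_closed: "closedin T R"
proof -
  show "R \<lhd> F" unfolding R_eq_Inter
    using lev_preimage(1)[OF _ W_level.one_is_normal] by (intro F.normal_Inter) auto
  show "Y \<lhd> F" unfolding Y_eq_Inter
    using lev_preimage(1)[OF _ B_level_normal] by (intro F.normal_Inter) auto
  show "closedin T R" unfolding R_eq_Inter
    using lev_preimage(2)[OF _ W_level.one_is_normal] by (intro closedin_INT) auto
qed

lemma R_le_Y: "R \<subseteq> Y"
  using subgroup.one_closed[OF normal_imp_subgroup[OF B_level_normal]] by (auto simp: R_sub_eq Y_sub_eq)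

lemma R_carrier: "r \<in> R \<Longrightarrow> r \<in> carrier F" and Y_carrier: "y \<in> Y \<Longrightarrow> y \<in> carrier F"
  by (auto simp: R_sub_eq Y_sub_eq)

lemma b_Y: "b \<in> Y"
  using b_closed lev_props(4) y_level_closed by (auto simp: Y_sub_eq B_level_def) (simp add: y_level_eq)

lemma Y_sq: "y \<in> Y \<Longrightarrow> y \<otimes>\<^bsub>F\<^esub> y \<in> R"
  using hom_mult[OF lev_props(1)] B_level_sq by (auto simp: R_sub_eq Y_sub_eq)

lemma Y_commutator:
  assumes "u \<in> Y" "v \<in> Y"
  shows "group_commutator F u v \<in> R"
proof -
  have c: "u \<in> carrier F" "v \<in> carrier F" using assms Y_carrier by auto
  have "lev k (group_commutator F u v) = \<one>\<^bsub>W_level k\<^esub>" if k: "k \<ge> 1" for k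
  proof -
    interpret l: group_hom F "W_level k" "lev k" using lev_hom[OF k] .
    have "lev k u \<otimes>\<^bsub>W_level k\<^esub> lev k v = lev k v \<otimes>\<^bsub>W_level k\<^esub> lev k u"
      using assms k by (intro B_level_comm) (auto simp: Y_sub_eq)
    then show ?thesis
      using hom_commutator[OF lev_hom[OF k] c] W_level.commutator_eq_one_iff l.hom_closed c by simp
  qed
  then show ?thesis using c by (simp add: R_sub_eq)
qed

lemma set_mult_closed_F: "closedin T H \<Longrightarrow> closedin T K \<Longrightarrow> closedin T (H <#>\<^bsub>F\<^esub> K)"
  using topological_group_set_mult_closed[OF topological_group_F compact_F Hausdorff_F] .

lemma normal_subset: "K \<lhd> F \<Longrightarrow> K \<subseteq> carrier F"
  using normal_imp_subgroup subgroup.subset by blast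

lemma N_normal: "N \<lhd> F"
  unfolding N_sub_def
  by (intro F.set_mult_normal F.commutator_subgroup_normal F.power_subgroup_normal R_normal Y_normal)

lemma N_closed: "closedin T N"
  unfolding N_sub_def by (intro set_mult_closed_F F.commutator_subgroup_closed F.power_subgroup_closed)

lemma commutator_mem_N:
  assumes "r \<in> R" "y \<in> Y"
  shows "group_commutator F r y \<in> N"
proof -
  have "group_commutator F r y \<in> commutator_subgroup F T R Y"
    using assms R_carrier Y_carrier by (intro F.commutator_mem_commutator_subgroup) auto
  moreover have "commutator_subgroup F T R Y \<subseteq> N"
    unfolding N_sub_def
    using F.commutator_subgroup_normal[OF R_normal Y_normal] F.power_subgroup_normal[OF R_normal]
    by (intro F.subset_set_mult_left normal_subset normal_imp_subgroup)
  ultimately show ?thesis by blast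
qed

lemma square_mem_N:
  assumes "r \<in> R"
  shows "r \<otimes>\<^bsub>F\<^esub> r \<in> N"
proof -
  have "r [^]\<^bsub>F\<^esub> (2::nat) \<in> power_subgroup F T R 2"
    using assms R_carrier by (intro F.power_mem_power_subgroup) auto
  moreover have "power_subgroup F T R 2 \<subseteq> N"
    unfolding N_sub_def
    using F.commutator_subgroup_normal[OF R_normal Y_normal] F.power_subgroup_normal[OF R_normal]
    by (intro F.subset_set_mult_right normal_subset normal_imp_subgroup)
  ultimately show ?thesis using R_carrier[OF assms] by (auto simp: numeral_2_eq_2)
qed

lemma q_hom: "group_hom F (G_group F T a b) q"
  unfolding G_group_def by (rule F.group_hom_FactGroup[OF N_normal])

lemma q_surj: "q ` carrier F = carrier (G_group F T a b)"
  by (simp add: G_group_def carrier_FactGroup)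

lemma q_normal: "K \<lhd> F \<Longrightarrow> q ` K \<lhd> G_group F T a b"
  by (rule normal.surj_hom_normal_subgroup[OF _ q_hom q_surj])

lemma q_closed:
  assumes "K \<lhd> F" "closedin T K"
  shows "closedin (G_topology F T a b) (q ` K)"
  unfolding G_topology_def F.closedin_quotient
  using F.coset_preimage_image[OF N_normal normal_subset[OF assms(1)]] set_mult_closed_F[OF N_closed assms(2)]
    normal_subset[OF assms(1)] by (auto simp: carrier_FactGroup)

lemma dense_tower_G: "dense_tower (G_group F T a b) (G_topology F T a b) (q a) (q ` Y) (q ` R) (q b)"
proof -
  let ?G = "G_group F T a b" and ?T = "G_topology F T a b"
  interpret q: group_hom F ?G q by (rule q_hom)
  interpret G: semitopological_group ?G ?T
    unfolding G_group_def G_topology_def by (rule F.semitopological_quotient[OF N_normal])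
  have Ns: "subgroup N F" using N_normal normal_imp_subgroup by blast
  have commute: "q u \<otimes>\<^bsub>?G\<^esub> q v = q v \<otimes>\<^bsub>?G\<^esub> q u"
    if "group_commutator F u v \<in> N" "u \<in> carrier F" "v \<in> carrier F" for u v
    using F.commutator_mem_iff[OF N_normal that(2,3)] that(1) by (simp add: G_group_def)
  show ?thesis
  proof (intro dense_tower.intro dense_tower_axioms.intro tower.intro tower_axioms.intro
      G.semitopological_group_axioms G.plain_group_axioms)
    show "q a \<in> carrier ?G" using a_closed by simp
    show "q ` Y \<lhd> ?G" "q ` R \<lhd> ?G" using q_normal R_normal Y_normal by auto
    show "q ` R \<subseteq> q ` Y" using R_le_Y by blast
    show "z \<otimes>\<^bsub>?G\<^esub> h = h \<otimes>\<^bsub>?G\<^esub> z" if "z \<in> q ` R" "h \<in> q ` Y" for z h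
      using that commute commutator_mem_N R_carrier Y_carrier by blast
    show "z \<otimes>\<^bsub>?G\<^esub> z = \<one>\<^bsub>?G\<^esub>" if z: "z \<in> q ` R" for z
    proof -
      obtain r where r: "r \<in> R" "z = q r" using z by blast
      have "q (r \<otimes>\<^bsub>F\<^esub> r) = N" using square_mem_N[OF r(1)] Ns by (intro F.coset_join2) (auto simp: R_carrier r)
      then show ?thesis using q.hom_mult[OF R_carrier[OF r(1)] R_carrier[OF r(1)]] r(2)
        by (simp add: G_group_def)
    qed
    show "h \<otimes>\<^bsub>?G\<^esub> h \<in> q ` R" if h: "h \<in> q ` Y" for h
    proof -
      obtain y where y: "y \<in> Y" "h = q y" using h by blast
      have "h \<otimes>\<^bsub>?G\<^esub> h = q (y \<otimes>\<^bsub>F\<^esub> y)" unfolding y(2) using Y_carrier[OF y(1)] by simp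
      then show ?thesis using Y_sq[OF y(1)] by blast
    qed
    show "group_commutator ?G h k \<in> q ` R" if hk: "h \<in> q ` Y" "k \<in> q ` Y" for h k
    proof -
      obtain u v where u: "u \<in> Y" "h = q u" "v \<in> Y" "k = q v" using hk by blast
      have "group_commutator ?G h k = q (group_commutator F u v)"
        unfolding u(2,4) using hom_commutator[OF q_hom] u Y_carrier by simp
      then show ?thesis using Y_commutator[OF u(1,3)] by blast
    qed
    show "compact_space ?T" unfolding G_topology_def by (rule F.compact_quotient[OF compact_F])
    show "q b \<in> q ` Y" using b_Y by blast
    show "closedin ?T (q ` R)" by (rule q_closed[OF R_normal R_closed])
    show "closed_generate ?G ?T {q a, q b} = carrier ?G"
    proof -
      let ?K = "closed_generate ?G ?T {q a, q b}"
      have sub: "{q a, q b} \<subseteq> carrier ?G" using a_closed b_closed by simp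
      have K: "subgroup ?K ?G" "closedin ?T ?K" "{q a, q b} \<subseteq> ?K"
        using G.closed_generate_subgroup[OF sub] G.closed_generate_closed G.closed_generate_incl[OF sub] by auto
      have "closedin T {g \<in> carrier F. q g \<in> ?K}"
        \<comment> \<open>Density descends because the preimage of a closed subgroup of the quotient
          is a closed subgroup of \<open>F\<close>.\<close>
        using K(2) unfolding G_topology_def F.closedin_quotient by blast
      then have "closed_generate F T {a, b} \<subseteq> {g \<in> carrier F. q g \<in> ?K}"
        using K(3) a_closed b_closed
        by (intro F.closed_generate_minimal subgroup_preimage[OF q_hom K(1)]) auto
      then have "q ` carrier F \<subseteq> ?K" unfolding dense_F by blast
      then have "carrier ?G \<subseteq> ?K" unfolding q_surj .
      then show ?thesis using subgroup.subset[OF K(1)] by blast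
    qed
  qed
qed

section \<open>The subgroups behind the series \<open>M\<close>, and their indices\<close>

lemma N_level_props:
  assumes k: "k \<ge> 1"
  shows "N_level F T a b k \<lhd> F" "closedin T (N_level F T a b k)"
    "a [^]\<^bsub>F\<^esub> (2 ^ k :: nat) \<in> N_level F T a b k"
proof -
  let ?x = "a [^]\<^bsub>F\<^esub> (2 ^ k :: nat)"
  let ?A = "commutator_subgroup F T (R_level F T a b k) (Y_level F T a b k)
    <#>\<^bsub>F\<^esub> power_subgroup F T (R_level F T a b k) 2"
  let ?S = "{group_conjugate F s g | s g. s \<in> {?x} \<and> g \<in> carrier F}"
  let ?C = "normal_closure F T {?x}"
  have S: "?S \<subseteq> carrier F" using a_closed by (auto simp: group_conjugate_def)
  have A: "?A \<lhd> F" using level_sub_props[OF k]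
    by (intro F.set_mult_normal F.commutator_subgroup_normal F.power_subgroup_normal)
  have Ac: "closedin T ?A" by (intro set_mult_closed_F F.commutator_subgroup_closed F.power_subgroup_closed)
  have C: "?C \<lhd> F"
    unfolding normal_closure_def
  proof (rule F.closed_generate_normal[OF S])
    fix s g assume "s \<in> ?S" and g: "g \<in> carrier F"
    then obtain h where h: "h \<in> carrier F" "s = group_conjugate F ?x h" by blast
    have "g \<otimes>\<^bsub>F\<^esub> s \<otimes>\<^bsub>F\<^esub> inv\<^bsub>F\<^esub> g = group_conjugate F ?x (h \<otimes>\<^bsub>F\<^esub> inv\<^bsub>F\<^esub> g)"
      using h g a_closed by (simp add: group_conjugate_def F.group_norm)
    then show "g \<otimes>\<^bsub>F\<^esub> s \<otimes>\<^bsub>F\<^esub> inv\<^bsub>F\<^esub> g \<in> ?S" using h g by blast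
  qed
  have Cc: "closedin T ?C" by (simp add: normal_closure_def F.closed_generate_closed)
  have "group_conjugate F ?x \<one>\<^bsub>F\<^esub> = ?x" using a_closed by (simp add: group_conjugate_def)
  then have "?x \<in> ?S" by (metis (mono_tags, lifting) F.one_closed mem_Collect_eq singletonI)
  then have "?x \<in> ?C" unfolding normal_closure_def using F.closed_generate_incl[OF S] by blast
  then show "?x \<in> N_level F T a b k"
    unfolding N_level_def
    using F.subset_set_mult_right[OF normal_subset[OF C] normal_imp_subgroup[OF A]] by blast
  show "N_level F T a b k \<lhd> F" unfolding N_level_def using F.set_mult_normal[OF A C] .
  show "closedin T (N_level F T a b k)" unfolding N_level_def using set_mult_closed_F[OF Ac Cc] .
qed

text \<open>Over \<open>W_level k\<close> the relators go to the degree 2 kernel, which has exponent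
  2 and commutes with everything over \<open>B_level k\<close>; hence squares of relators and their
  commutators with \<open>Y\<close> die. The power \<open>a^(2^k)\<close> dies because
  \<open>magnus_x k\<close> has order dividing \<open>2 ^ k\<close>.\<close>

lemma magnus_map:
  assumes k: "k \<ge> 1"
  obtains \<psi> where "group_hom F (magnus k) \<psi>" "\<psi> a = magnus_x k" "\<psi> b = magnus_y k"
    "\<And>g. g \<in> N \<Longrightarrow> \<psi> g = \<one>\<^bsub>magnus k\<^esub>" "\<And>g. g \<in> N_level F T a b k \<Longrightarrow> \<psi> g = \<one>\<^bsub>magnus k\<^esub>"
proof -
  obtain n where n: "card (carrier (magnus k)) = 2 ^ n" using card_magnus(1) by blast
  obtain \<psi> where \<psi>: "\<psi> \<in> hom F (magnus k)" "continuous_map T (discrete_topology (carrier (magnus k))) \<psi>"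
    "\<psi> a = magnus_x k" "\<psi> b = magnus_y k"
    using hom_exists[OF group_magnus card_magnus(2) n magnus_xy_closed[OF k]] by blast
  interpret p: group_hom F "magnus k" \<psi>
    using \<psi>(1) by (simp add: group_hom_def group_hom_axioms_def group_magnus F.group_axioms)
  define K where "K = {g \<in> carrier F. \<psi> g \<in> {\<one>\<^bsub>magnus k\<^esub>}}"
  have Ks: "subgroup K F" unfolding K_def
    by (rule subgroup_preimage[OF p.group_hom_axioms magnus.triv_subgroup])
  have Kc: "closedin T K"
    using closedin_continuous_map_preimage[OF \<psi>(2), of "{\<one>\<^bsub>magnus k\<^esub>}"] by (simp add: K_def F.topspace_eq)
  have fst: "fst (\<psi> g) = lev k g" if g: "g \<in> carrier F" for g
  proof -
    have "(fst \<circ> \<psi>) g = lev k g"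
    proof (rule lev_unique[OF k _ _ _ _ g])
      show "fst \<circ> \<psi> \<in> hom F (W_level k)"
        using \<psi>(1) group_hom.homh[OF fst_magnus_hom] by (rule hom_compose)
      have "continuous_map (discrete_topology (carrier (magnus k))) (top_level k) fst"
        by (auto simp: top_level_def carrier_magnus)
      then show "continuous_map T (top_level k) (fst \<circ> \<psi>)" by (rule continuous_map_compose[OF \<psi>(2)])
    qed (simp_all add: \<psi>(3,4) magnus_x_def magnus_y_def)
    then show ?thesis by simp
  qed
  \<comment> \<open>Stated for arbitrary \<open>R'\<close> and \<open>Y'\<close> so as to serve both
    \<open>N\<close> and \<open>N_level\<close>.\<close>
  have CP: "commutator_subgroup F T R' Y' <#>\<^bsub>F\<^esub> power_subgroup F T R' 2 \<subseteq> K"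
    if R': "\<And>r. r \<in> R' \<Longrightarrow> r \<in> carrier F \<and> lev k r = \<one>\<^bsub>W_level k\<^esub>"
      and Y': "\<And>y. y \<in> Y' \<Longrightarrow> y \<in> carrier F \<and> lev k y \<in> B_level k" for R' Y'
  proof (intro F.set_mult_subset[OF Ks] F.commutator_subgroup_minimal[OF Ks Kc] F.power_subgroup_minimal[OF Ks Kc])
    fix r y assume "r \<in> R'" "y \<in> Y'"
    then have ry: "r \<in> carrier F" "lev k r = \<one>\<^bsub>W_level k\<^esub>" "y \<in> carrier F" "lev k y \<in> B_level k"
      using R' Y' by auto
    have "\<psi> r \<otimes>\<^bsub>magnus k\<^esub> \<psi> y = \<psi> y \<otimes>\<^bsub>magnus k\<^esub> \<psi> r"
      using ry fst p.hom_closed by (intro magnus_kernel_central) auto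
    then have "\<psi> (group_commutator F r y) = \<one>\<^bsub>magnus k\<^esub>"
      using hom_commutator[OF p.group_hom_axioms ry(1,3)] magnus.commutator_eq_one_iff p.hom_closed ry by simp
    then show "group_commutator F r y \<in> K" using ry by (simp add: K_def)
  next
    fix r assume "r \<in> R'"
    then have r: "r \<in> carrier F" "lev k r = \<one>\<^bsub>W_level k\<^esub>" using R' by auto
    obtain M where M: "\<psi> r = (\<one>\<^bsub>W_level k\<^esub>, M)" using fst[OF r(1)] r(2) by (metis prod.collapse)
    moreover have "\<psi> r \<in> carrier (magnus k)" using r by simp
    ultimately have "M \<subseteq> Zn k \<times> Zn k" by (auto simp: carrier_magnus)
    then have "\<psi> r \<otimes>\<^bsub>magnus k\<^esub> \<psi> r = \<one>\<^bsub>magnus k\<^esub>"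
      unfolding M by (simp add: magnus_kernel_mult one_magnus)
    then show "r [^]\<^bsub>F\<^esub> (2::nat) \<in> K" using r by (simp add: K_def numeral_2_eq_2)
  qed
  have "N \<subseteq> K" unfolding N_sub_def using k by (intro CP) (auto simp: R_sub_eq Y_sub_eq)
  moreover have "N_level F T a b k \<subseteq> K"
    unfolding N_level_def
  proof (rule F.set_mult_subset[OF Ks])
    show "commutator_subgroup F T (R_level F T a b k) (Y_level F T a b k)
      <#>\<^bsub>F\<^esub> power_subgroup F T (R_level F T a b k) 2 \<subseteq> K"
      by (intro CP) (auto simp: R_level_eq Y_level_eq)
    show "normal_closure F T {a [^]\<^bsub>F\<^esub> (2 ^ k :: nat)} \<subseteq> K"
      unfolding normal_closure_def
    proof (rule F.closed_generate_minimal[OF Ks Kc], rule subsetI)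
      fix s assume "s \<in> {group_conjugate F s g | s g. s \<in> {a [^]\<^bsub>F\<^esub> (2 ^ k :: nat)} \<and> g \<in> carrier F}"
      then obtain g where g: "g \<in> carrier F" "s = group_conjugate F (a [^]\<^bsub>F\<^esub> (2 ^ k :: nat)) g" by blast
      have "\<psi> (a [^]\<^bsub>F\<^esub> (2 ^ k :: nat)) = magnus_x k [^]\<^bsub>magnus k\<^esub> (2 ^ k :: nat)"
        using p.hom_nat_pow[OF a_closed] \<psi>(3) by simp
      also have "\<dots> = \<one>\<^bsub>magnus k\<^esub>"
        by (simp add: magnus_x_pow[OF k] x_level_pow[OF k] one_magnus one_W_level)
      finally have "\<psi> s = \<one>\<^bsub>magnus k\<^esub>"
        unfolding g(2) group_conjugate_def using g(1) a_closed by simp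
      then show "s \<in> K" using g a_closed by (simp add: K_def group_conjugate_def)
    qed
  qed
  ultimately show thesis using that[OF p.group_hom_axioms \<psi>(3,4)] by (auto simp: K_def)
qed

lemma graded_tower_G:
  "graded_tower (G_group F T a b) (G_topology F T a b) (q a) (q ` Y) (q ` R) (q b) (M_series F T a b)"
proof -
  let ?G = "G_group F T a b" and ?T = "G_topology F T a b" and ?M = "M_series F T a b"
  interpret G: dense_tower ?G ?T "q a" "q ` Y" "q ` R" "q b" by (rule dense_tower_G)
  interpret q: group_hom F ?G q by (rule q_hom)
  have M0: "?M 0 = carrier ?G" by (simp add: M_series_def)
  have Mk: "?M k = q ` N_level F T a b k" if "k \<ge> 1" for k using that by (simp add: M_series_def)
  have Mn: "?M k \<lhd> ?G" for k
    using M0 Mk[of k] q_normal[OF N_level_props(1)[of k]] G.carrier_normal by (cases k) auto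
  have Mc: "closedin ?T (?M k)" for k
    using M0 Mk[of k] q_closed[OF N_level_props(1,2)[of k]] G.closedin_carrier_G by (cases k) auto
  have Mx: "q a [^]\<^bsub>?G\<^esub> (2 ^ k :: nat) \<in> ?M k" for k
  proof (cases "k \<ge> 1")
    case True
    have "q a [^]\<^bsub>?G\<^esub> (2 ^ k :: nat) = q (a [^]\<^bsub>F\<^esub> (2 ^ k :: nat))" using q.hom_nat_pow[OF a_closed] by simp
    then show ?thesis unfolding Mk[OF True] using N_level_props(3)[OF True] by blast
  next
    case False
    then have "k = 0" by simp
    then show ?thesis using M0 G.x_carrier by simp
  qed
  have Mi: "2 ^ (2 ^ k * (2 ^ k - 1) div 2) \<le> card ((#>\<^bsub>?G\<^esub>) (?M k) ` carrier ?G)" if k: "k \<ge> 1" for k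
  proof -
    obtain \<psi> where \<psi>: "group_hom F (magnus k) \<psi>" "\<psi> a = magnus_x k" "\<psi> b = magnus_y k"
      "\<And>g. g \<in> N \<Longrightarrow> \<psi> g = \<one>\<^bsub>magnus k\<^esub>" "\<And>g. g \<in> N_level F T a b k \<Longrightarrow> \<psi> g = \<one>\<^bsub>magnus k\<^esub>"
      using magnus_map[OF k] by metis
    interpret p: group_hom F "magnus k" \<psi> by (rule \<psi>(1))
    let ?D = "\<psi> ` carrier F"
    let ?X = "(#>\<^bsub>?G\<^esub>) (?M k) ` carrier ?G"
    have Ms: "subgroup (?M k) ?G" using Mn normal_imp_subgroup by blast
    have Ns: "subgroup N F" using N_normal normal_imp_subgroup by blast
    have fin: "finite ?X"
      using G.Mod_finite_generated(1)[OF Mn Mc Mx] by (simp add: carrier_FactGroup)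
    \<comment> \<open>\<open>\<psi>\<close> is trivial on \<open>N\<close> and on
      \<open>N_level\<close>, so it factors through the cosets of \<open>M k\<close>; the order of
      its image then bounds their number from below.\<close>
    have well: "\<psi> g = \<psi> h" if gh: "g \<in> carrier F" "h \<in> carrier F" "?M k #>\<^bsub>?G\<^esub> q g = ?M k #>\<^bsub>?G\<^esub> q h" for g h
    proof -
      have "q g \<in> ?M k #>\<^bsub>?G\<^esub> q h" using G.rcos_self[OF _ Ms] gh q.hom_closed by metis
      then obtain m where m: "m \<in> N_level F T a b k" "q g = q m \<otimes>\<^bsub>?G\<^esub> q h"
        unfolding Mk[OF k] by (auto simp: r_coset_def)
      have mc: "m \<in> carrier F" using m(1) normal_subset[OF N_level_props(1)[OF k]] by blast
      have "q g = q (m \<otimes>\<^bsub>F\<^esub> h)" using m(2) mc gh by simp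
      then have "g \<in> N #>\<^bsub>F\<^esub> (m \<otimes>\<^bsub>F\<^esub> h)" using F.rcos_self[OF gh(1) Ns] by metis
      then obtain n where n: "n \<in> N" "g = n \<otimes>\<^bsub>F\<^esub> (m \<otimes>\<^bsub>F\<^esub> h)" by (auto simp: r_coset_def)
      have nc: "n \<in> carrier F" using n(1) normal_subset[OF N_normal] by blast
      show ?thesis unfolding n(2) using nc mc gh(2) \<psi>(4)[OF n(1)] \<psi>(5)[OF m(1)] by simp
    qed
    define \<theta> where "\<theta> C = \<psi> (SOME g. g \<in> carrier F \<and> ?M k #>\<^bsub>?G\<^esub> q g = C)" for C
    have "?D \<subseteq> \<theta> ` ?X"
    proof
      fix d assume "d \<in> ?D"
      then obtain g where g: "g \<in> carrier F" "d = \<psi> g" by blast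
      let ?C = "?M k #>\<^bsub>?G\<^esub> q g"
      define h where "h = (SOME h. h \<in> carrier F \<and> ?M k #>\<^bsub>?G\<^esub> q h = ?C)"
      have "h \<in> carrier F \<and> ?M k #>\<^bsub>?G\<^esub> q h = ?C"
        unfolding h_def by (rule someI[of _ g]) (use g in simp)
      then have "\<psi> h = d" using well[of h g] g by blast
      then have "\<theta> ?C = d" by (simp add: \<theta>_def h_def)
      then show "d \<in> \<theta> ` ?X" using g q.hom_closed by blast
    qed
    then have "card ?D \<le> card ?X"
      using fin by (meson card_image_le card_mono finite_imageI le_trans)
    moreover have "2 ^ (2 ^ k * (2 ^ k - 1) div 2) \<le> card ?D"
    proof (rule magnus_card_le[OF k])
      show "subgroup ?D (magnus k)" using p.img_is_subgroup .
      show "magnus_x k \<in> ?D" "magnus_y k \<in> ?D" using \<psi>(2,3) a_closed b_closed by (metis imageI)+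
    qed
    ultimately show ?thesis by simp
  qed
  show ?thesis
    using M0 Mn Mc Mx Mi
    by (intro graded_tower.intro graded_tower_axioms.intro G.dense_tower_axioms) auto
qed

end

theorem theorem1p1:
  fixes F :: "'a monoid" and T :: "'a topology" and a b :: 'a
  assumes "free_pro_p_group 2 F T a b"
  shows "let \<G> = G_group F T a b; \<T> = G_topology F T a b in
         \<forall>S \<in> {M_series F T a b, lower_series \<G> \<T>, dimension_series \<G> \<T>,
               two_power_series \<G> \<T>, frattini_series \<G> \<T>}.
           normal_hspec \<G> \<T> S = hspec \<G> \<T> S \<and> hspec \<G> \<T> S = {0..1}"
proof -
  interpret free_pro_two F T a b using assms by (rule free_pro_two.intro)
  show ?thesis
    unfolding Let_def using graded_tower.all_series[OF graded_tower_G] by metis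
qed

end
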